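(* Let $n\ge2$, let $L=(L_1,\dots,L_n)$ be an $n$-component link in $\mathbb{R}^3$, and let $\mathrm{PCr}(L)$ be its pairwise crossing number. Then $$\mathrm{rop}(L)^{\frac43}\ \ge\ \frac{3\,n^{\frac13}}{n-1}\,\mathrm{PCr}(L),\qquad \mathrm{rop}(L)^2\ \ge\ \frac{16\pi\,n^2}{n^2-1}\,\mathrm{PCr}(L).$$
   Context: An $n$-component link is a $C^1$ embedding of $n$ disjoint circles in $\mathbb{R}^3$, with components $L_1,\dots,L_n$. The ropelength is $\mathrm{rop}(L)=\ell(L)/r(L)$, where $\ell(L)$ is the sum of the lengths of the components and $r(L)$ is the reach (thickness), i.e. the largest radius of a tube embedded as a normal neighborhood of $L$ (with $\mathrm{rop}(L)=+\infty$ if $r(L)=0$). For a regular link diagram $D_L$ and $i\ne j$, $\mathrm{cr}_{i,j}(D_L)=\mathrm{cr}_{j,i}(D_L)$ denotes the number of crossings in $D_L$ between the components $L_i$ and $L_j$ (the number of times $L_i$ overpasses $L_j$ plus the number of times it underpasses $L_j$). The pairwise crossing number of $L$ is the isotopy invariant $$\mathrm{PCr}(L)=\min_{D_L}\ \sum_{1\le i<j\le n}\mathrm{cr}_{i,j}(D_L),$$ the minimum being over all regular diagrams $D_L$ of links in the isotopy class of $L$. *)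

theory Defs
  imports "HOL-Analysis.Analysis"
begin

text \<open>
  A circle in space is parametrised by a 1-periodic function on the whole real line, so that
  \<open>C\<^sup>1\<close> also holds across the base point. An injective immersion of a circle is
  an embedding, by compactness.
\<close>

definition C1_embedded_circle :: "(real \<Rightarrow> real^3) \<Rightarrow> bool" where
  "C1_embedded_circle \<gamma> \<longleftrightarrow>
     \<gamma> C1_differentiable_on UNIV \<and>
     (\<forall>t. \<gamma> (t + 1) = \<gamma> t) \<and>
     (\<forall>t. vector_derivative \<gamma> (at t) \<noteq> 0) \<and>
     inj_on \<gamma> {0..<1}"

text \<open>The components are \<open>L 1\<close>, ..., \<open>L n\<close>; other values of \<open>L\<close> are irrelevant.\<close>

definition link :: "nat \<Rightarrow> (nat \<Rightarrow> real \<Rightarrow> real^3) \<Rightarrow> bool" where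
  "link n L \<longleftrightarrow>
     (\<forall>i\<in>{1..n}. C1_embedded_circle (L i)) \<and>
     disjoint_family_on (\<lambda>i. range (L i)) {1..n}"

definition link_length :: "nat \<Rightarrow> (nat \<Rightarrow> real \<Rightarrow> real^3) \<Rightarrow> real" where
  "link_length n L = (\<Sum>i=1..n. integral {0..1} (\<lambda>t. norm (vector_derivative (L i) (at t))))"

definition normal_disc :: "real \<Rightarrow> (real \<Rightarrow> real^3) \<Rightarrow> real \<Rightarrow> (real^3) set" where
  "normal_disc r \<gamma> t =
     {x. (x - \<gamma> t) \<bullet> vector_derivative \<gamma> (at t) = 0 \<and> norm (x - \<gamma> t) < r}"

text \<open>
  Disjointness of the normal discs is injectivity of the map \<open>(p, v) \<mapsto> p + v\<close>
  from the open normal disc bundle of radius \<open>r\<close> into space. This bundle is a 3-manifold, so by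
  invariance of domain injectivity already makes the map an embedding onto an open neighbourhood.
\<close>

definition embedded_tube :: "nat \<Rightarrow> (nat \<Rightarrow> real \<Rightarrow> real^3) \<Rightarrow> real \<Rightarrow> bool" where
  "embedded_tube n L r \<longleftrightarrow>
     disjoint_family_on (\<lambda>(i, t). normal_disc r (L i) t) ({1..n} \<times> {0..<1})"

text \<open>
  The set below contains \<open>0\<close> (all discs are then empty), and it is bounded when \<open>n \<ge> 1\<close>: a point
  of \<open>L\<close> lies in the normal plane at the point of the same component farthest from it.
\<close>

definition reach :: "nat \<Rightarrow> (nat \<Rightarrow> real \<Rightarrow> real^3) \<Rightarrow> real" where
  "reach n L = Sup {r. 0 \<le> r \<and> embedded_tube n L r}"

definition ropelength :: "nat \<Rightarrow> (nat \<Rightarrow> real \<Rightarrow> real^3) \<Rightarrow> ereal" where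
  "ropelength n L = (if reach n L = 0 then \<infinity> else ereal (link_length n L / reach n L))"

text \<open>Real powers of nonnegative extended reals, for positive exponents.\<close>

definition ereal_powr :: "ereal \<Rightarrow> real \<Rightarrow> ereal" where
  "ereal_powr x a = (if x = \<infinity> then \<infinity> else ereal (real_of_ereal x powr a))"

text \<open>Ambient isotopy respecting the numbering of the components.\<close>

definition isotopic :: "nat \<Rightarrow> (nat \<Rightarrow> real \<Rightarrow> real^3) \<Rightarrow> (nat \<Rightarrow> real \<Rightarrow> real^3) \<Rightarrow> bool" where
  "isotopic n L K \<longleftrightarrow>
     (\<exists>H :: real \<Rightarrow> real^3 \<Rightarrow> real^3.
        continuous_on ({0..1} \<times> UNIV) (\<lambda>(t, x). H t x) \<and>
        (\<forall>t\<in>{0..1}. \<exists>g. homeomorphism UNIV UNIV (H t) g) \<and>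
        (\<forall>x. H 0 x = x) \<and>
        (\<forall>i\<in>{1..n}. H 1 ` range (L i) = range (K i)))"

text \<open>Orthogonal projection onto the plane perpendicular to the unit vector \<open>u\<close>.\<close>

definition plane_proj :: "real^3 \<Rightarrow> real^3 \<Rightarrow> real^3" where
  "plane_proj u x = x - (x \<bullet> u) *\<^sub>R u"

text \<open>
  A regular diagram of \<open>K\<close> is the image of \<open>K\<close> under projection along a unit vector \<open>u\<close>, which
  points towards the viewer, such that the projection is an immersion with finitely many
  multiple points, all of them transverse double points. Self-crossings are covered too.
\<close>

definition regular_diagram :: "nat \<Rightarrow> (nat \<Rightarrow> real \<Rightarrow> real^3) \<Rightarrow> real^3 \<Rightarrow> bool" where
  "regular_diagram n K u \<longleftrightarrow>
     (let P = plane_proj u;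
          X = (\<Union>i\<in>{1..n}. range (K i));
          T = (\<lambda>i t. P (vector_derivative (K i) (at t)))
      in norm u = 1 \<and>
         (\<forall>i\<in>{1..n}. \<forall>t. T i t \<noteq> 0) \<and>
         finite {q. \<exists>x\<in>X. \<exists>y\<in>X. x \<noteq> y \<and> P x = q \<and> P y = q} \<and>
         (\<forall>x\<in>X. \<forall>y\<in>X. \<forall>z\<in>X. P x = P y \<and> P y = P z \<longrightarrow> x = y \<or> y = z \<or> x = z) \<and>
         (\<forall>i\<in>{1..n}. \<forall>j\<in>{1..n}. \<forall>s t.
            K i s \<noteq> K j t \<and> P (K i s) = P (K j t) \<longrightarrow> \<not> collinear {0, T i s, T j t}))"

text \<open>The crossings at which component \<open>i\<close> passes over component \<open>j\<close>.\<close>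

definition overcrossings ::
    "(nat \<Rightarrow> real \<Rightarrow> real^3) \<Rightarrow> real^3 \<Rightarrow> nat \<Rightarrow> nat \<Rightarrow> ((real^3) \<times> (real^3)) set" where
  "overcrossings K u i j =
     {(x, y). x \<in> range (K i) \<and> y \<in> range (K j) \<and>
              plane_proj u x = plane_proj u y \<and> x \<bullet> u > y \<bullet> u}"

definition cr :: "(nat \<Rightarrow> real \<Rightarrow> real^3) \<Rightarrow> real^3 \<Rightarrow> nat \<Rightarrow> nat \<Rightarrow> nat" where
  "cr K u i j = card (overcrossings K u i j) + card (overcrossings K u j i)"

text \<open>
  Every link is isotopic to one with a regular diagram, so the infimum is over a nonempty set of
  natural numbers and is attained.
\<close>

definition PCr :: "nat \<Rightarrow> (nat \<Rightarrow> real \<Rightarrow> real^3) \<Rightarrow> nat" where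
  "PCr n L =
     Inf {(\<Sum>i\<in>{1..n}. \<Sum>j\<in>{i<..n}. cr K u i j) | K u.
            link n K \<and> isotopic n L K \<and> regular_diagram n K u}"

end

theory Submission
  imports Defs
begin

text \<open>
  The projections of \<open>L\<close> itself are used, averaged over all directions. Almost every direction gives
  a regular diagram: the tube makes the unit tangent Lipschitz, so tangent directions form a null
  set, Sard's theorem gives transversality, and the triple points of transversal crossings trace
  out Lipschitz families of directions depending on one parameter. By the area formula the
  average number of crossings between different components then gives
  \<open>4\<pi> PCr L \<le> \<Sum>\<^bsub>i \<noteq> j\<^esub> \<integral>\<integral> 1 / \<bar>x - y\<bar>\<^sup>2\<close> over \<open>x\<close> in \<open>L i\<close> and \<open>y\<close> in \<open>L j\<close>; all integrals along curves are
  replaced by Riemann sums.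

  For a tube of radius 1, different components are at distance at least 2, which bounds the integrand
  by \<open>1/4\<close> and gives the second inequality. For the first one,
  \<open>1 / \<rho>\<^sup>2 \<le> (5/4) / (1 + \<rho>\<^sup>2)\<close> for \<open>\<rho> \<ge> 2\<close>, and the kernel \<open>1 / (1 + \<bar>x - y\<bar>\<^sup>2)\<close> is positive definite, so
  the sum over different components is at most \<open>1 - 1/n\<close> times the sum over all pairs. The latter is
  bounded pointwise: the part of \<open>L\<close> in a ball of radius \<open>\<rho>\<close> has length at most \<open>4/3 (\<rho> + 1)\<^sup>3\<close>,
  because its tube has volume at least \<open>\<pi>\<close> times its length and fits into a ball of radius \<open>\<rho> + 1\<close>.
\<close>

section \<open>Positive definite kernels\<close>

text \<open>Comparing blocks of a kernel needs finite values on the diagonal, and the double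
  integral of \<open>1 / \<rho>\<^sup>2\<close> over one curve diverges. Hence the inverse square is
  first dominated, from distance 2 on, by a positive definite kernel without singularity; the
  constant 1/4 and \<open>(5/4) / (1 + \<rho>\<^sup>2)\<close> both touch it at \<rho> = 2. The
  first estimate comes out with \<open>2 powr (2/3)\<close>; replacing 2 by n gives (n - 1) /
  n^(1/3), and 4 \<pi> against 4 \<pi> / 3 gives the 3. In the second, n / (n - 1) is weakened to
  n^2 / (n^2 - 1). The components are only C^1, so the normal discs give no differentiable
  parametrisation of the tube; its volume is bounded below by wedges between nearby normal planes.
  Of the area formula only an inequality is used: images of small parameter boxes are bounded in
  volume, and a direction with k crossings is covered by at least k of them once the grid is fine
  enough. This fineness depends on the direction, so the average is reached by Fatou's lemma. The
  reach is a supremum, so radii below it are used and the losses vanish in a limit.\<close>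

lemma gram_power_sum_nonneg:
  fixes y :: "'i \<Rightarrow> 'a::euclidean_space" and c :: "'i \<Rightarrow> real"
  shows "0 \<le> (\<Sum>p\<in>I. \<Sum>q\<in>I. c p * c q * (y p \<bullet> y q) ^ k)"
proof (induction k arbitrary: c)
  case 0
  have "(\<Sum>p\<in>I. \<Sum>q\<in>I. c p * c q) = (\<Sum>p\<in>I. c p)\<^sup>2"
    by (simp add: sum_product power2_eq_square)
  then show ?case by simp
next
  case (Suc k)
  \<comment> \<open>One inner product is expanded in the basis and its two coordinates join the
    coefficients; this is why the induction leaves \<open>c\<close> arbitrary.\<close>
  have "(\<Sum>p\<in>I. \<Sum>q\<in>I. c p * c q * (y p \<bullet> y q) ^ Suc k)
      = (\<Sum>p\<in>I. \<Sum>q\<in>I. \<Sum>b\<in>Basis. (c p * (y p \<bullet> b)) * (c q * (y q \<bullet> b)) * (y p \<bullet> y q) ^ k)"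
  proof (intro sum.cong refl)
    fix p q
    have "c p * c q * (y p \<bullet> y q) ^ Suc k = c p * c q * (y p \<bullet> y q) ^ k * (\<Sum>b\<in>Basis. (y p \<bullet> b) * (y q \<bullet> b))"
      by (simp add: euclidean_inner[symmetric])
    then show "c p * c q * (y p \<bullet> y q) ^ Suc k
        = (\<Sum>b\<in>Basis. (c p * (y p \<bullet> b)) * (c q * (y q \<bullet> b)) * (y p \<bullet> y q) ^ k)"
      by (simp add: sum_distrib_left mult_ac)
  qed
  also have "\<dots> = (\<Sum>p\<in>I. \<Sum>b\<in>Basis. \<Sum>q\<in>I. (c p * (y p \<bullet> b)) * (c q * (y q \<bullet> b)) * (y p \<bullet> y q) ^ k)"
    by (intro sum.cong refl sum.swap)
  also have "\<dots> = (\<Sum>b\<in>Basis. \<Sum>p\<in>I. \<Sum>q\<in>I. (c p * (y p \<bullet> b)) * (c q * (y q \<bullet> b)) * (y p \<bullet> y q) ^ k)"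
    by (rule sum.swap)
  also have "\<dots> \<ge> 0"
    by (intro sum_nonneg Suc)
  finally show ?case .
qed

text \<open>Expanding the squared distance splits the kernel into
  \<open>exp (2 * l * (y p \<bullet> y q))\<close> and one factor per point, which \<open>e\<close>
  absorbs. The exponential series has nonnegative coefficients, so positivity of the powers applies
  term by term.\<close>

lemma gaussian_sum_nonneg:
  fixes y :: "'i \<Rightarrow> 'a::euclidean_space" and c :: "'i \<Rightarrow> real"
  assumes "l \<ge> 0"
  shows "0 \<le> (\<Sum>p\<in>I. \<Sum>q\<in>I. c p * c q * exp (- l * (norm (y p - y q))\<^sup>2))"
proof -
  define e where "e p = c p * exp (- l * (norm (y p))\<^sup>2)" for p
  have "(\<lambda>k. \<Sum>p\<in>I. \<Sum>q\<in>I. e p * e q * ((2 * l * (y p \<bullet> y q)) ^ k /\<^sub>R fact k))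
      sums (\<Sum>p\<in>I. \<Sum>q\<in>I. e p * e q * exp (2 * l * (y p \<bullet> y q)))"
    by (intro sums_sum sums_mult exp_converges)
  moreover have "(\<Sum>p\<in>I. \<Sum>q\<in>I. e p * e q * ((2 * l * (y p \<bullet> y q)) ^ k /\<^sub>R fact k)) \<ge> 0" for k
  proof -
    have "(\<Sum>p\<in>I. \<Sum>q\<in>I. e p * e q * ((2 * l * (y p \<bullet> y q)) ^ k /\<^sub>R fact k))
       = (2 * l) ^ k / fact k * (\<Sum>p\<in>I. \<Sum>q\<in>I. e p * e q * (y p \<bullet> y q) ^ k)"
      by (simp add: sum_distrib_left power_mult_distrib field_simps)
    then show ?thesis
      using gram_power_sum_nonneg[of e y k I] assms by simp
  qed
  ultimately have "(\<Sum>p\<in>I. \<Sum>q\<in>I. e p * e q * exp (2 * l * (y p \<bullet> y q))) \<ge> 0"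
    by (rule sums_le[OF _ sums_zero, rotated])
  also have "(\<Sum>p\<in>I. \<Sum>q\<in>I. e p * e q * exp (2 * l * (y p \<bullet> y q)))
      = (\<Sum>p\<in>I. \<Sum>q\<in>I. c p * c q * exp (- l * (norm (y p - y q))\<^sup>2))"
  proof (intro sum.cong refl)
    fix p q
    have "exp (- l * (norm (y p))\<^sup>2) * exp (- l * (norm (y q))\<^sup>2) * exp (2 * l * (y p \<bullet> y q))
       = exp (- l * (norm (y p - y q))\<^sup>2)"
      unfolding exp_add[symmetric]
      by (simp add: power2_norm_eq_inner inner_diff_left inner_diff_right inner_commute algebra_simps)
    then show "e p * e q * exp (2 * l * (y p \<bullet> y q)) = c p * c q * exp (- l * (norm (y p - y q))\<^sup>2)"
      by (simp add: e_def mult_ac)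
  qed
  finally show ?thesis .
qed

text \<open>A mixture of Gaussians: \<open>1 / (1 + \<rho>\<^sup>2)\<close> is the integral of
  \<open>exp (- l) * exp (- l * \<rho>\<^sup>2)\<close> over all nonnegative l.\<close>

lemma cauchy_kernel_sum_nonneg:
  fixes y :: "'i \<Rightarrow> 'a::euclidean_space" and c :: "'i \<Rightarrow> real"
  assumes "finite I"
  shows "0 \<le> (\<Sum>p\<in>I. \<Sum>q\<in>I. c p * c q * (1 / (1 + (norm (y p - y q))\<^sup>2)))"
proof -
  let ?a = "\<lambda>p q. 1 + (norm (y p - y q))\<^sup>2"
  have "((\<lambda>l. \<Sum>p\<in>I. \<Sum>q\<in>I. c p * c q * exp (- ?a p q * l)) has_integral
      (\<Sum>p\<in>I. \<Sum>q\<in>I. c p * c q * (exp (- ?a p q * 0) / ?a p q))) {0..}"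
    by (intro has_integral_sum assms has_integral_mult_right has_integral_exp_minus_to_infinity)
       (simp add: add_pos_nonneg)
  moreover have "0 \<le> (\<Sum>p\<in>I. \<Sum>q\<in>I. c p * c q * exp (- ?a p q * l))" if "l \<in> {0..}" for l
  proof -
    have "(\<Sum>p\<in>I. \<Sum>q\<in>I. c p * c q * exp (- ?a p q * l))
      = exp (- l) * (\<Sum>p\<in>I. \<Sum>q\<in>I. c p * c q * exp (- l * (norm (y p - y q))\<^sup>2))"
      unfolding sum_distrib_left
      by (intro sum.cong refl) (simp add: exp_add[symmetric] algebra_simps flip: exp_diff)
    then show ?thesis
      using gaussian_sum_nonneg[of l c y I] that by simp
  qed
  ultimately have "0 \<le> (\<Sum>p\<in>I. \<Sum>q\<in>I. c p * c q * (exp (- ?a p q * 0) / ?a p q))"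
    by (rule has_integral_nonneg)
  then show ?thesis by simp
qed

text \<open>Positivity is tested with n coefficient vectors, one per component i: the weights times
  the indicator of i minus its mean 1/n. Adding the n inequalities says that pairs inside components
  carry at least the fraction 1/n of the full sum.\<close>

lemma off_diagonal_sum_le:
  fixes K :: "'i \<Rightarrow> 'i \<Rightarrow> real" and w :: "'i \<Rightarrow> real" and comp :: "'i \<Rightarrow> nat"
  assumes "finite I" and pos: "\<And>c :: 'i \<Rightarrow> real. 0 \<le> (\<Sum>p\<in>I. \<Sum>q\<in>I. c p * c q * K p q)"
    and comp: "\<And>p. p \<in> I \<Longrightarrow> comp p \<in> {1..n}" and "n \<ge> 1"
  shows "(\<Sum>p\<in>I. \<Sum>q\<in>I. if comp p = comp q then 0 else w p * w q * K p q)
      \<le> (1 - 1 / real n) * (\<Sum>p\<in>I. \<Sum>q\<in>I. w p * w q * K p q)"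
proof -
  define u where "u i p = of_bool (comp p = i) - 1 / real n" for i p
  have uu: "(\<Sum>i\<in>{1..n}. u i p * u i q) = of_bool (comp p = comp q) - 1 / real n"
    if "p \<in> I" "q \<in> I" for p q
  proof -
    have "(\<Sum>i\<in>{1..n}. u i p * u i q)
       = (\<Sum>i\<in>{1..n}. of_bool (comp p = i) * of_bool (comp q = i)) - (\<Sum>i\<in>{1..n}. of_bool (comp p = i)) / n
         - (\<Sum>i\<in>{1..n}. of_bool (comp q = i)) / n + real n * (1 / n)\<^sup>2"
      unfolding u_def sum_divide_distrib left_diff_distrib right_diff_distrib sum_subtractf
      by (simp add: power2_eq_square)
    also have "(\<Sum>i\<in>{1..n}. of_bool (comp p = i) * of_bool (comp q = i)) = (of_bool (comp p = comp q) :: real)"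
    proof (cases "comp p = comp q")
      case True
      then show ?thesis
        using comp[OF that(1)] by (simp flip: of_bool_conj)
    qed (auto intro!: sum.neutral)
    also have "(\<Sum>i\<in>{1..n}. of_bool (comp p = i)) = (1::real)"
      using comp[OF that(1)] by simp
    also have "(\<Sum>i\<in>{1..n}. of_bool (comp q = i)) = (1::real)"
      using comp[OF that(2)] by simp
    also have "real n * (1 / n)\<^sup>2 = 1 / n"
      by (simp add: power2_eq_square)
    finally show ?thesis by simp
  qed
  have "0 \<le> (\<Sum>i\<in>{1..n}. \<Sum>p\<in>I. \<Sum>q\<in>I. (w p * u i p) * (w q * u i q) * K p q)"
    by (intro sum_nonneg pos)
  also have "\<dots> = (\<Sum>p\<in>I. \<Sum>i\<in>{1..n}. \<Sum>q\<in>I. (w p * u i p) * (w q * u i q) * K p q)"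
    by (rule sum.swap)
  also have "\<dots> = (\<Sum>p\<in>I. \<Sum>q\<in>I. \<Sum>i\<in>{1..n}. (w p * u i p) * (w q * u i q) * K p q)"
    by (intro sum.cong refl sum.swap)
  also have "\<dots> = (\<Sum>p\<in>I. \<Sum>q\<in>I. w p * w q * K p q * (of_bool (comp p = comp q) - 1 / real n))"
    by (intro sum.cong refl) (simp add: uu[symmetric] sum_distrib_left mult_ac)
  also have "\<dots> = (\<Sum>p\<in>I. \<Sum>q\<in>I. (1 - 1 / real n) * (w p * w q * K p q)
      - (if comp p = comp q then 0 else w p * w q * K p q))"
    by (intro sum.cong refl) (simp add: algebra_simps)
  also have "\<dots> = (1 - 1 / real n) * (\<Sum>p\<in>I. \<Sum>q\<in>I. w p * w q * K p q)
      - (\<Sum>p\<in>I. \<Sum>q\<in>I. if comp p = comp q then 0 else w p * w q * K p q)"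
    by (simp add: sum_subtractf sum_distrib_left)
  finally show ?thesis by simp
qed

section \<open>Summing the kernel against the growth bound, and the numerical constants\<close>

text \<open>Layer-cake summation: \<open>k\<close> is minus the derivative of
  \<open>1 / (1 + \<rho>\<^sup>2)\<close>, so a term with \<open>d p \<le> R\<close> is
  \<open>1 / (1 + R\<^sup>2)\<close> plus the integral of \<open>k\<close> from \<open>d p\<close>
  to R. Exchanging sum and integral brings in the weight within distance \<rho>, to which
  \<open>vol\<close> applies. R stays free, to be chosen so that the terms with denominator
  \<open>1 + R\<^sup>2\<close> cancel.\<close>

lemma sum_cauchy_kernel_le:
  fixes d w :: "'i \<Rightarrow> real"
  assumes "finite I" "\<And>p. p \<in> I \<Longrightarrow> 0 \<le> w p" "\<And>p. p \<in> I \<Longrightarrow> 0 \<le> d p"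
    and vol: "\<And>\<rho>. 0 \<le> \<rho> \<Longrightarrow> (\<Sum>p\<in>{p\<in>I. d p \<le> \<rho>}. w p) \<le> 4 / 3 * (\<rho> + 1) ^ 3"
    and "0 \<le> R"
  shows "(\<Sum>p\<in>I. w p * (1 / (1 + (d p)\<^sup>2)))
     \<le> (\<Sum>p\<in>I. w p) / (1 + R\<^sup>2) + 4 / 3 - 4 / 3 * (R + 1) ^ 3 / (1 + R\<^sup>2) + 4 * R + 4 * ln (1 + R\<^sup>2)"
proof -
  define k where "k \<rho> = 2 * \<rho> / (1 + \<rho>\<^sup>2)\<^sup>2" for \<rho> :: real
  have pos: "1 + x\<^sup>2 > (0::real)" "1 + x\<^sup>2 \<noteq> (0::real)" for x
    by (auto simp: add_pos_nonneg add_nonneg_eq_0_iff)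
  have int: "(k has_integral (1 / (1 + a\<^sup>2) - 1 / (1 + b\<^sup>2))) {a..b}" if "a \<le> b" for a b
  proof -
    have "(k has_integral (- 1 / (1 + b\<^sup>2)) - (- 1 / (1 + a\<^sup>2))) {a..b}"
    proof (rule fundamental_theorem_of_calculus[OF that])
      fix x
      have "((\<lambda>x. - 1 / (1 + x\<^sup>2)) has_real_derivative k x) (at x within {a..b})"
        unfolding k_def using pos[of x] by (auto intro!: derivative_eq_intros simp: power2_eq_square)
      then show "((\<lambda>x. - 1 / (1 + x\<^sup>2)) has_vector_derivative k x) (at x within {a..b})"
        by (simp add: has_real_derivative_iff_has_vector_derivative)
    qed
    then show ?thesis by simp
  qed
  have each: "\<exists>J. ((\<lambda>\<rho>. w p * (k \<rho> * of_bool (d p \<le> \<rho>))) has_integral J) {0..R} \<and>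
      w p * (1 / (1 + (d p)\<^sup>2)) \<le> w p / (1 + R\<^sup>2) + J" if "p \<in> I" for p
  proof (cases "d p \<le> R")
    case True
    have "((\<lambda>\<rho>. if \<rho> \<in> {d p..R} then k \<rho> else 0) has_integral (1 / (1 + (d p)\<^sup>2) - 1 / (1 + R\<^sup>2))) {0..R}"
      by (rule has_integral_on_superset[where S="{d p..R}"])
         (use has_integral_restrict[of "{d p..R}" "{d p..R}" k] int[OF True] assms(3)[OF that] in auto)
    then have "((\<lambda>\<rho>. k \<rho> * of_bool (d p \<le> \<rho>)) has_integral (1 / (1 + (d p)\<^sup>2) - 1 / (1 + R\<^sup>2))) {0..R}"
      by (rule has_integral_eq[rotated]) auto
    from has_integral_mult_right[OF this, of "w p"] show ?thesis
      by (intro exI conjI, assumption) (simp add: algebra_simps)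
  next
    case False
    have "((\<lambda>\<rho>. w p * (k \<rho> * of_bool (d p \<le> \<rho>))) has_integral 0) {0..R}"
      by (rule has_integral_is_0) (use False in auto)
    moreover have "R\<^sup>2 \<le> (d p)\<^sup>2"
      using False \<open>0 \<le> R\<close> by (intro power_mono) auto
    then have "w p * (1 / (1 + (d p)\<^sup>2)) \<le> w p * (1 / (1 + R\<^sup>2))"
      using pos assms(2)[OF that] by (intro mult_left_mono divide_left_mono) auto
    ultimately show ?thesis by auto
  qed
  then obtain J where J: "\<And>p. p \<in> I \<Longrightarrow> ((\<lambda>\<rho>. w p * (k \<rho> * of_bool (d p \<le> \<rho>))) has_integral J p) {0..R}"
      "\<And>p. p \<in> I \<Longrightarrow> w p * (1 / (1 + (d p)\<^sup>2)) \<le> w p / (1 + R\<^sup>2) + J p"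
    by metis
  \<comment> \<open>Integration by parts: the integrand left over is
    \<open>4 * (\<rho> + 1)\<^sup>2 / (1 + \<rho>\<^sup>2)\<close>, which equals
    \<open>4 + 8 * \<rho> / (1 + \<rho>\<^sup>2)\<close>.\<close>
  define F where "F \<rho> = - 4 / 3 * (\<rho> + 1) ^ 3 / (1 + \<rho>\<^sup>2) + 4 * \<rho> + 4 * ln (1 + \<rho>\<^sup>2)" for \<rho> :: real
  have "((\<lambda>\<rho>. k \<rho> * (4 / 3 * (\<rho> + 1) ^ 3)) has_integral (F R - F 0)) {0..R}"
  proof (rule fundamental_theorem_of_calculus[OF \<open>0 \<le> R\<close>])
    fix x
    have "(F has_real_derivative k x * (4 / 3 * (x + 1) ^ 3)) (at x within {0..R})"
      unfolding F_def
      apply (rule derivative_eq_intros refl pos)+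
      using pos(2)[of x] unfolding k_def
      apply (simp add: divide_simps)
      apply algebra
      done
    then show "(F has_vector_derivative k x * (4 / 3 * (x + 1) ^ 3)) (at x within {0..R})"
      by (simp add: has_real_derivative_iff_has_vector_derivative)
  qed
  moreover have "((\<lambda>\<rho>. \<Sum>p\<in>I. w p * (k \<rho> * of_bool (d p \<le> \<rho>))) has_integral (\<Sum>p\<in>I. J p)) {0..R}"
    by (intro has_integral_sum assms J)
  moreover have "(\<Sum>p\<in>I. w p * (k \<rho> * of_bool (d p \<le> \<rho>))) \<le> k \<rho> * (4 / 3 * (\<rho> + 1) ^ 3)"
    if "\<rho> \<in> {0..R}" for \<rho>
  proof -
    have "(\<Sum>p\<in>I. w p * (k \<rho> * of_bool (d p \<le> \<rho>))) = k \<rho> * (\<Sum>p\<in>I. if d p \<le> \<rho> then w p else 0)"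
      by (simp add: sum_distrib_left of_bool_def if_distrib mult_ac cong: if_cong)
    also have "(\<Sum>p\<in>I. if d p \<le> \<rho> then w p else 0) = (\<Sum>p\<in>{p\<in>I. d p \<le> \<rho>}. w p)"
      using assms(1) by (simp add: sum.inter_filter)
    also have "k \<rho> * \<dots> \<le> k \<rho> * (4 / 3 * (\<rho> + 1) ^ 3)"
      using that by (intro mult_left_mono vol) (auto simp: k_def)
    finally show ?thesis .
  qed
  ultimately have "(\<Sum>p\<in>I. J p) \<le> F R - F 0"
    by (meson has_integral_le)
  have "(\<Sum>p\<in>I. w p * (1 / (1 + (d p)\<^sup>2))) \<le> (\<Sum>p\<in>I. w p / (1 + R\<^sup>2) + J p)"
    by (intro sum_mono J)
  also have "\<dots> = (\<Sum>p\<in>I. w p) / (1 + R\<^sup>2) + (\<Sum>p\<in>I. J p)"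
    by (simp add: sum.distrib sum_divide_distrib)
  also have "\<dots> \<le> (\<Sum>p\<in>I. w p) / (1 + R\<^sup>2) + (F R - F 0)"
    using \<open>(\<Sum>p\<in>I. J p) \<le> F R - F 0\<close> by simp
  finally show ?thesis by (simp add: F_def)
qed

text \<open>The right side is a slightly raised tangent line at R = 17/4: the slope there is
  136/305, and the value ln (305/16) is at most 3. The derivative of the difference has a second
  zero at 4/17, below which its sign changes; small R are therefore treated apart.\<close>

lemma ln_one_plus_square_le:
  fixes R :: real
  assumes "R \<ge> 0"
  shows "ln (1 + R\<^sup>2) \<le> 136 / 305 * R + 221 / 200"
proof (cases "R \<le> 1")
  case True
  have "ln (1 + R\<^sup>2) \<le> R\<^sup>2"
    by (rule ln_add_one_self_le_self) simp
  also have "R\<^sup>2 \<le> 1"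
    using True assms by (simp add: power_le_one)
  finally show ?thesis using assms by simp
next
  case False
  define f where "f x = 136 / 305 * x - ln (1 + x\<^sup>2)" for x :: real
  have pos: "1 + x\<^sup>2 > (0::real)" for x by (simp add: add_pos_nonneg)
  have f: "(f has_real_derivative 136 * (x - 17 / 4) * (x - 4 / 17) / (305 * (1 + x\<^sup>2))) (at x)" for x
  proof -
    have "(f has_real_derivative 136 / 305 - 2 * x / (1 + x\<^sup>2)) (at x)"
      unfolding f_def using pos[of x] by (auto intro!: derivative_eq_intros simp: field_simps)
    also have "136 / 305 - 2 * x / (1 + x\<^sup>2) = 136 * (x - 17 / 4) * (x - 4 / 17) / (305 * (1 + x\<^sup>2))"
      using pos[of x] by (simp add: divide_simps power2_eq_square) (simp add: algebra_simps)
    finally show ?thesis .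
  qed
  have "f (17 / 4) \<le> f R"
  proof (cases "R \<le> 17 / 4")
    case True
    show ?thesis
    proof (rule DERIV_nonpos_imp_nonincreasing[OF True])
      fix x assume "R \<le> x" "x \<le> 17 / 4"
      then show "\<exists>y. (f has_real_derivative y) (at x) \<and> y \<le> 0"
        using False f[of x] pos[of x]
        by (intro exI[of _ "136 * (x - 17 / 4) * (x - 4 / 17) / (305 * (1 + x\<^sup>2))"])
           (auto intro!: divide_nonpos_pos mult_nonpos_nonneg)
    qed
  next
    case False
    show ?thesis
    proof (rule DERIV_nonneg_imp_nondecreasing[where f = f])
      fix x assume "17 / 4 \<le> x" "x \<le> R"
      then show "\<exists>y. (f has_real_derivative y) (at x) \<and> y \<ge> 0"
        using f[of x] pos[of x]
        by (intro exI[of _ "136 * (x - 17 / 4) * (x - 4 / 17) / (305 * (1 + x\<^sup>2))"]) auto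
    qed (use False in simp)
  qed
  moreover have "ln (305 / 16) \<le> (3::real)"
  proof -
    have "27 / 10 \<le> exp (1::real)"
      using e_approx_32 by (simp add: abs_if split: if_splits)
    then have "(27 / 10) ^ 3 \<le> exp (1::real) ^ 3"
      by (intro power_mono) auto
    also have "exp (1::real) ^ 3 = exp 3"
      by (simp flip: exp_of_nat_mult)
    finally have "305 / 16 \<le> exp (3::real)"
      by (simp add: power3_eq_cube)
    then show ?thesis
      using ln_le_cancel_iff[of "305 / 16" "exp 3"] by simp
  qed
  ultimately show ?thesis
    by (simp add: f_def power2_eq_square)
qed

lemma pi_gt_311: "pi > 311 / 100"
proof -
  have "1 / 5 - (1 / 5) ^ 3 / 3 \<le> arctan (1 / 5)"
    using arctan_lower_bound[of "1 / 5" 1] by (simp add: eval_nat_numeral)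
  moreover have "arctan (1 / 239) \<le> 1 / 239"
    by (rule arctan_le_self) simp
  ultimately show ?thesis
    unfolding pi_machin by (simp add: power3_eq_cube)
qed

text \<open>Purely numerical and with little room: the logarithm bound makes the left side at most
  about 7.2295 R + 7.192, and the coefficient on the right exceeds 7.23. The rational 1747/1000 lies
  just below the cube root of 16/3.\<close>

lemma ball_radius_bound:
  fixes R :: real
  assumes "0 \<le> R"
  shows "5 / 3 + 5 * R + 5 * ln (1 + R\<^sup>2) \<le> 4 * pi / 3 * (16 / 3) powr (1 / 3) * (R + 1)"
proof -
  have "(1747 / 1000 :: real) = ((1747 / 1000) ^ 3) powr (1 / 3)"
    by (simp add: powr_powr flip: powr_numeral)
  also have "\<dots> \<le> (16 / 3) powr (1 / 3)"
    by (intro powr_mono2) (auto simp: power3_eq_cube)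
  finally have "311 / 100 * (1747 / 1000) \<le> pi * (16 / 3) powr (1 / 3)"
    using pi_gt_311 by (intro mult_mono) auto
  then have "723 / 100 \<le> 4 * pi / 3 * (16 / 3) powr (1 / 3)"
    by simp
  then have "723 / 100 * (R + 1) \<le> 4 * pi / 3 * (16 / 3) powr (1 / 3) * (R + 1)"
    using assms by (intro mult_right_mono) auto
  moreover have "5 / 3 + 5 * R + 5 * ln (1 + R\<^sup>2) \<le> 723 / 100 * (R + 1)"
    using ln_one_plus_square_le[OF assms] assms by (simp add: field_simps)
  ultimately show ?thesis by linarith
qed

text \<open>R is the radius whose admissible weight \<open>4 / 3 * (R + 1) ^ 3\<close> is the whole
  of \<open>l\<close>; this cancels the two terms with denominator \<open>1 + R\<^sup>2\<close>.
  Below \<open>l = 4 / 3\<close> no nonnegative R does this, and there bounding the kernel by 1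
  suffices.\<close>

lemma sum_kernel_le_powr:
  fixes d w :: "'i \<Rightarrow> real"
  assumes "finite I" "\<And>p. p \<in> I \<Longrightarrow> 0 \<le> w p" "\<And>p. p \<in> I \<Longrightarrow> 0 \<le> d p"
    and vol: "\<And>\<rho>. 0 \<le> \<rho> \<Longrightarrow> (\<Sum>p\<in>{p\<in>I. d p \<le> \<rho>}. w p) \<le> 4 / 3 * (\<rho> + 1) ^ 3"
  shows "5 / 4 * (\<Sum>p\<in>I. w p * (1 / (1 + (d p)\<^sup>2))) \<le> 4 * pi / 3 * 2 powr (2 / 3) * (\<Sum>p\<in>I. w p) powr (1 / 3)"
proof -
  define l where "l = (\<Sum>p\<in>I. w p)"
  have "l \<ge> 0" unfolding l_def by (intro sum_nonneg assms)
  have "(16 / 3) powr (1 / 3) = 4 powr (1 / 3) * (4 / 3) powr (1 / 3 :: real)"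
    by (simp flip: powr_mult)
  moreover have "4 powr (1 / 3) = (2::real) powr (2 / 3)"
    using powr_powr[of "2::real" 2 "1 / 3"] by simp
  ultimately have split: "(16 / 3) powr (1 / 3) = 2 powr (2 / 3) * (4 / 3) powr (1 / 3 :: real)" by simp
  show ?thesis
  proof (cases "l \<ge> 4 / 3")
    case True
    define R where "R = (3 * l / 4) powr (1 / 3) - 1"
    have "R \<ge> 0"
      using True by (auto simp: R_def intro!: ge_one_powr_ge_zero)
    have R3: "4 / 3 * (R + 1) ^ 3 = l"
      using True by (simp add: R_def powr_power)
    have "5 / 4 * (\<Sum>p\<in>I. w p * (1 / (1 + (d p)\<^sup>2)))
       \<le> 5 / 4 * (l / (1 + R\<^sup>2) + 4 / 3 - 4 / 3 * (R + 1) ^ 3 / (1 + R\<^sup>2) + 4 * R + 4 * ln (1 + R\<^sup>2))"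
      using sum_cauchy_kernel_le[OF assms \<open>R \<ge> 0\<close>] unfolding l_def by simp
    also have "\<dots> = 5 / 3 + 5 * R + 5 * ln (1 + R\<^sup>2)"
      unfolding R3 by simp
    also have "\<dots> \<le> 4 * pi / 3 * (16 / 3) powr (1 / 3) * (R + 1)"
      by (rule ball_radius_bound[OF \<open>R \<ge> 0\<close>])
    also have "\<dots> = 4 * pi / 3 * 2 powr (2 / 3) * ((4 / 3) powr (1 / 3) * (3 * l / 4) powr (1 / 3))"
      unfolding split by (simp add: R_def)
    also have "(4 / 3) powr (1 / 3) * (3 * l / 4) powr (1 / 3) = l powr (1 / 3)"
      using \<open>l \<ge> 0\<close> by (simp flip: powr_mult)
    finally show ?thesis unfolding l_def .
  next
    case False
    have "5 / 4 * (\<Sum>p\<in>I. w p * (1 / (1 + (d p)\<^sup>2))) \<le> 5 / 4 * (\<Sum>p\<in>I. w p * 1)"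
      using assms(2)
      by (intro mult_left_mono sum_mono) (auto simp: divide_le_eq_1 add_pos_nonneg)
    also have "\<dots> = 5 / 4 * l"
      by (simp add: l_def)
    also have "5 / 4 * l \<le> 4 * pi / 3 * 2 powr (2 / 3) * l powr (1 / 3)"
    proof (cases "l = 0")
      case False
      then have l: "l > 0" using \<open>l \<ge> 0\<close> by simp
      have "l powr (2 / 3) \<le> (4 / 3) powr (2 / 3)"
        using l \<open>\<not> l \<ge> 4 / 3\<close> by (intro powr_mono2) auto
      also have "\<dots> \<le> (4 / 3) powr 1"
        by (intro powr_mono) auto
      finally have "5 / 4 * l powr (2 / 3) \<le> 5 / 3" by simp
      also have "\<dots> \<le> 4 * pi / 3 * 2 powr (2 / 3)"
      proof -
        have "(1::real) \<le> 2 powr (2 / 3)" by (intro ge_one_powr_ge_zero) auto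
        then have "3 * 1 \<le> pi * 2 powr (2 / 3)" using pi_gt_311 by (intro mult_mono) auto
        then show ?thesis by simp
      qed
      finally have "5 / 4 * l powr (2 / 3) * l powr (1 / 3) \<le> 4 * pi / 3 * 2 powr (2 / 3) * l powr (1 / 3)"
        by (intro mult_right_mono) auto
      also have "5 / 4 * l powr (2 / 3) * l powr (1 / 3) = 5 / 4 * l"
        using l by (simp flip: powr_add)
      finally show ?thesis .
    qed simp
    finally show ?thesis unfolding l_def .
  qed
qed

section \<open>Inverse-square energy between different components\<close>

lemma inverse_square_sum_le_unit:
  fixes y :: "'i \<Rightarrow> 'a::euclidean_space" and comp :: "'i \<Rightarrow> nat"
  assumes "finite I" and w: "\<And>p. p \<in> I \<Longrightarrow> 0 \<le> w p"
    and comp: "\<And>p. p \<in> I \<Longrightarrow> comp p \<in> {1..n}" and "n \<ge> 2"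
    and sep: "\<And>p q. p \<in> I \<Longrightarrow> q \<in> I \<Longrightarrow> comp p \<noteq> comp q \<Longrightarrow> 2 \<le> norm (y p - y q)"
    and vol: "\<And>q \<rho>. q \<in> I \<Longrightarrow> 0 \<le> \<rho> \<Longrightarrow>
      (\<Sum>p\<in>{p\<in>I. norm (y p - y q) \<le> \<rho>}. w p) \<le> 4 / 3 * (\<rho> + 1) ^ 3"
  shows "(\<Sum>p\<in>I. \<Sum>q\<in>I. if comp p = comp q then 0 else w p * w q / (norm (y p - y q))\<^sup>2)
     \<le> 4 * pi / 3 * ((real n - 1) / real n powr (1 / 3)) * (\<Sum>p\<in>I. w p) powr (4 / 3)"
proof -
  define l where "l = (\<Sum>p\<in>I. w p)"
  have "l \<ge> 0" unfolding l_def by (intro sum_nonneg w)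
  define K where "K p q = 1 / (1 + (norm (y p - y q))\<^sup>2)" for p q
  have "(\<Sum>p\<in>I. \<Sum>q\<in>I. if comp p = comp q then 0 else w p * w q / (norm (y p - y q))\<^sup>2)
     \<le> (\<Sum>p\<in>I. \<Sum>q\<in>I. 5 / 4 * (if comp p = comp q then 0 else w p * w q * K p q))"
  proof (intro sum_mono)
    fix p q assume pq: "p \<in> I" "q \<in> I"
    show "(if comp p = comp q then 0 else w p * w q / (norm (y p - y q))\<^sup>2)
       \<le> 5 / 4 * (if comp p = comp q then 0 else w p * w q * K p q)"
    proof (cases "comp p = comp q")
      case False
      define N where "N = (norm (y p - y q))\<^sup>2"
      have "2\<^sup>2 \<le> N" unfolding N_def using sep[OF pq False] by (intro power_mono) auto
      then have "w p * w q * (1 / N) \<le> w p * w q * (5 / 4 * (1 / (1 + N)))"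
        using w pq by (intro mult_left_mono) (auto simp: field_simps)
      then show ?thesis
        using False by (simp add: K_def N_def[symmetric] mult_ac)
    qed simp
  qed
  also have "\<dots> = 5 / 4 * (\<Sum>p\<in>I. \<Sum>q\<in>I. if comp p = comp q then 0 else w p * w q * K p q)"
    by (simp add: sum_distrib_left)
  also have "\<dots> \<le> 5 / 4 * ((1 - 1 / real n) * (\<Sum>p\<in>I. \<Sum>q\<in>I. w p * w q * K p q))"
    using cauchy_kernel_sum_nonneg[OF \<open>finite I\<close>, of _ y] comp \<open>n \<ge> 2\<close> unfolding K_def
    by (intro mult_left_mono off_diagonal_sum_le \<open>finite I\<close>) auto
  also have "\<dots> = (1 - 1 / real n) * (\<Sum>q\<in>I. w q * (5 / 4 * (\<Sum>p\<in>I. w p * K p q)))"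
    by (subst sum.swap) (simp add: sum_distrib_left sum_divide_distrib mult_ac)
  also have "\<dots> \<le> (1 - 1 / real n) * (\<Sum>q\<in>I. w q * (4 * pi / 3 * 2 powr (2 / 3) * l powr (1 / 3)))"
    unfolding K_def l_def using \<open>n \<ge> 2\<close>
    by (intro mult_left_mono sum_mono sum_kernel_le_powr w assms vol) auto
  also have "\<dots> = (1 - 1 / real n) * (l * (4 * pi / 3 * 2 powr (2 / 3) * l powr (1 / 3)))"
    by (simp only: sum_distrib_right[symmetric] l_def)
  also have "\<dots> = 4 * pi / 3 * (1 - 1 / real n) * 2 powr (2 / 3) * l powr (4 / 3)"
    using \<open>l \<ge> 0\<close> powr_add[of l 1 "1 / 3"] by (cases "l = 0") auto
  \<comment> \<open>The constant obtained so far has 2 in place of n; it is weakened here to reach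
    the form \<open>(real n - 1) / real n powr (1 / 3)\<close>.\<close>
  also have "\<dots> \<le> 4 * pi / 3 * (1 - 1 / real n) * real n powr (2 / 3) * l powr (4 / 3)"
    using \<open>n \<ge> 2\<close> by (intro mult_right_mono mult_left_mono powr_mono2) auto
  also have "(1 - 1 / real n) * real n powr (2 / 3) = (real n - 1) / real n powr (1 / 3)"
    using \<open>n \<ge> 2\<close> powr_add[of "real n" "1 / 3" "2 / 3"] by (simp add: field_simps)
  then have "4 * pi / 3 * (1 - 1 / real n) * real n powr (2 / 3) * l powr (4 / 3)
     = 4 * pi / 3 * ((real n - 1) / real n powr (1 / 3)) * l powr (4 / 3)"
    by (simp only: mult.assoc)
  finally show ?thesis unfolding l_def .
qed

text \<open>Rescaling by 1/r: weights and distances shrink by the same factor, so each term of the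
  double sum is unchanged.\<close>

lemma inverse_square_sum_le:
  fixes y :: "'i \<Rightarrow> 'a::euclidean_space" and comp :: "'i \<Rightarrow> nat"
  assumes "finite I" and w: "\<And>p. p \<in> I \<Longrightarrow> 0 \<le> w p"
    and comp: "\<And>p. p \<in> I \<Longrightarrow> comp p \<in> {1..n}" and "n \<ge> 2" and "r > 0"
    and sep: "\<And>p q. p \<in> I \<Longrightarrow> q \<in> I \<Longrightarrow> comp p \<noteq> comp q \<Longrightarrow> 2 * r \<le> norm (y p - y q)"
    and vol: "\<And>q \<rho>. q \<in> I \<Longrightarrow> 0 \<le> \<rho> \<Longrightarrow>
      r\<^sup>2 * (\<Sum>p\<in>{p\<in>I. norm (y p - y q) \<le> \<rho>}. w p) \<le> 4 / 3 * (\<rho> + r) ^ 3"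
  shows "(\<Sum>p\<in>I. \<Sum>q\<in>I. if comp p = comp q then 0 else w p * w q / (norm (y p - y q))\<^sup>2)
     \<le> 4 * pi / 3 * ((real n - 1) / real n powr (1 / 3)) * ((\<Sum>p\<in>I. w p) / r) powr (4 / 3)"
proof -
  have norm: "norm (y p /\<^sub>R r - y q /\<^sub>R r) = norm (y p - y q) / r" for p q
    using \<open>r > 0\<close> by (simp flip: scaleR_diff_right add: divide_inverse mult.commute)
  have "(\<Sum>p\<in>I. \<Sum>q\<in>I. if comp p = comp q then 0 else (w p / r) * (w q / r) / (norm (y p /\<^sub>R r - y q /\<^sub>R r))\<^sup>2)
     \<le> 4 * pi / 3 * ((real n - 1) / real n powr (1 / 3)) * (\<Sum>p\<in>I. w p / r) powr (4 / 3)"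
  proof (rule inverse_square_sum_le_unit)
    fix p q assume "p \<in> I" "q \<in> I" "comp p \<noteq> comp q"
    then show "2 \<le> norm (y p /\<^sub>R r - y q /\<^sub>R r)"
      using sep[of p q] \<open>r > 0\<close> unfolding norm by (simp add: field_simps)
  next
    fix q :: 'i and \<rho> :: real assume "q \<in> I" "0 \<le> \<rho>"
    have "r\<^sup>2 * (\<Sum>p\<in>{p\<in>I. norm (y p - y q) \<le> \<rho> * r}. w p) \<le> 4 / 3 * (\<rho> * r + r) ^ 3"
      using \<open>q \<in> I\<close> \<open>0 \<le> \<rho>\<close> \<open>r > 0\<close> by (intro vol) auto
    also have "(\<rho> * r + r) ^ 3 = r\<^sup>2 * (r * (\<rho> + 1) ^ 3)"
      by (simp add: power2_eq_square power3_eq_cube algebra_simps)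
    finally have "(\<Sum>p\<in>{p\<in>I. norm (y p - y q) \<le> \<rho> * r}. w p) \<le> 4 / 3 * (\<rho> + 1) ^ 3 * r"
      using \<open>r > 0\<close> by (simp add: mult_ac)
    then show "(\<Sum>p\<in>{p\<in>I. norm (y p /\<^sub>R r - y q /\<^sub>R r) \<le> \<rho>}. w p / r) \<le> 4 / 3 * (\<rho> + 1) ^ 3"
      unfolding norm using \<open>r > 0\<close> by (simp add: pos_divide_le_eq flip: sum_divide_distrib)
  qed (use assms in auto)
  moreover have "(w p / r) * (w q / r) / (norm (y p /\<^sub>R r - y q /\<^sub>R r))\<^sup>2 = w p * w q / (norm (y p - y q))\<^sup>2" for p q
    unfolding norm using \<open>r > 0\<close> by (simp add: power2_eq_square)
  ultimately show ?thesis
    by (simp only: sum_divide_distrib)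
qed

section \<open>Volumes of wedges\<close>

text \<open>A bridge from a product of real lines, where product measure gives the volume of a
  cylinder, to \<open>real^3\<close>.\<close>

definition vec3 :: "real \<times> real \<times> real \<Rightarrow> real^3" where
  "vec3 p = fst p *\<^sub>R axis 1 1 + fst (snd p) *\<^sub>R axis 2 1 + snd (snd p) *\<^sub>R axis 3 1"

lemma vec3_component [simp]:
  "vec3 (x, y, z) $ 1 = x" "vec3 (x, y, z) $ 2 = y" "vec3 (x, y, z) $ 3 = z"
  by (simp_all add: vec3_def axis_def)

lemma continuous_on_vec3: "continuous_on S vec3"
  unfolding vec3_def by (intro continuous_intros)

lemma norm_vec3: "(norm (x :: real^3))\<^sup>2 = (x $ 1)\<^sup>2 + (x $ 2)\<^sup>2 + (x $ 3)\<^sup>2"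
  unfolding power2_norm_eq_inner by (simp add: inner_vec_def sum_3 power2_eq_square)

lemma prod_Basis_vec3: "(\<Prod>b\<in>Basis. x \<bullet> b) = (x $ 1) * (x $ 2) * ((x :: real^3) $ 3)"
proof -
  have "(Basis :: (real^3) set) = range (\<lambda>i. axis i 1)"
    by (auto simp: Basis_vec_def)
  then have "(\<Prod>b\<in>Basis. x \<bullet> b) = (\<Prod>b\<in>range (\<lambda>i. axis i 1). x \<bullet> b)"
    by (rule arg_cong)
  also have "\<dots> = (\<Prod>i\<in>UNIV. x \<bullet> axis i 1)"
    by (subst prod.reindex) (auto simp: inj_on_def axis_eq_axis)
  also have "\<dots> = (x $ 1) * (x $ 2) * (x $ 3)"
    unfolding UNIV_3 by (simp add: inner_axis ac_simps)
  finally show ?thesis .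
qed

lemma lborel_vec3: "(lborel :: (real^3) measure) = distr lborel borel vec3"
proof (rule lborel_eqI)
  have meas: "vec3 \<in> borel_measurable borel"
    by (intro borel_measurable_continuous_onI continuous_on_vec3)
  fix l u :: "real^3" assume "\<And>b. b \<in> Basis \<Longrightarrow> l \<bullet> b \<le> u \<bullet> b"
  then have le: "l $ i \<le> u $ i" for i
    by (metis axis_in_Basis_iff cart_eq_inner_axis Basis_real_def insertI1)
  have "vec3 -` box l u = box (l $ 1, l $ 2, l $ 3) (u $ 1, u $ 2, u $ 3)"
    by (auto simp: mem_box_cart forall_3 mem_box Basis_prod_def)
  moreover have "box l u \<in> sets borel" by simp
  ultimately show "emeasure (distr lborel borel vec3) (box l u) = (\<Prod>b\<in>Basis. (u - l) \<bullet> b)"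
    unfolding prod_Basis_vec3
    using le meas
    by (subst emeasure_distr)
       (auto simp: emeasure_lborel_box_eq Basis_prod_def prod.union_disjoint prod.reindex inj_on_def mult.assoc)
qed simp

text \<open>The slab contains a straight cylinder of height h whose radius is that of the section of
  the ball at height h.\<close>

lemma measure_cylinder_le_slab:
  fixes \<sigma> h :: real
  assumes "0 \<le> h" "h \<le> \<sigma>" "0 < \<sigma>"
  shows "pi * (\<sigma>\<^sup>2 - h\<^sup>2) * h \<le> measure lebesgue {z :: real^3. z \<in> ball 0 \<sigma> \<and> 0 \<le> z $ 1 \<and> z $ 1 < h}"
proof -
  define S where "S = {z :: real^3. z \<in> ball 0 \<sigma> \<and> 0 \<le> z $ 1 \<and> z $ 1 < h}"
  have "S = ball 0 \<sigma> \<inter> {z. 0 \<le> z $ 1} \<inter> {z. z $ 1 < h}" by (auto simp: S_def)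
  moreover have "{z :: real^3. 0 \<le> z $ 1} \<in> sets borel" "{z :: real^3. z $ 1 < h} \<in> sets borel"
    by (auto intro!: closed_Collect_le open_Collect_less continuous_intros borel_closed borel_open)
  ultimately have S: "S \<in> sets borel"
    by auto
  define C where "C = {0..<h} \<times> ball (0 :: real \<times> real) (sqrt (\<sigma>\<^sup>2 - h\<^sup>2))"
  have nonneg: "\<sigma>\<^sup>2 - h\<^sup>2 \<ge> 0" using assms by (simp add: power_mono)
  have "C \<subseteq> vec3 -` S"
  proof
    fix p assume "p \<in> C"
    then obtain x y z where p: "p = (x, y, z)" "0 \<le> x" "x < h" "norm (y, z) < sqrt (\<sigma>\<^sup>2 - h\<^sup>2)"
      by (cases p) (auto simp: C_def)
    then have "(norm (y, z))\<^sup>2 < (sqrt (\<sigma>\<^sup>2 - h\<^sup>2))\<^sup>2"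
      by (intro power_strict_mono) auto
    then have "y\<^sup>2 + z\<^sup>2 < \<sigma>\<^sup>2 - h\<^sup>2" using nonneg by (simp add: norm_Pair)
    moreover have "x\<^sup>2 \<le> h\<^sup>2" using p by (intro power_mono) auto
    ultimately have "(norm (vec3 p))\<^sup>2 < \<sigma>\<^sup>2"
      by (simp add: norm_vec3 p)
    then have "norm (vec3 p) < \<sigma>" using assms by (simp add: power_less_imp_less_base)
    then show "p \<in> vec3 -` S" using p by (simp add: S_def)
  qed
  moreover have meas: "vec3 \<in> borel_measurable borel"
    by (intro borel_measurable_continuous_onI continuous_on_vec3)
  then have "vec3 -` S \<in> sets borel"
    using S measurable_sets[of vec3 borel borel S] by simp
  ultimately have "emeasure lborel C \<le> emeasure lborel (vec3 -` S)"
    by (intro emeasure_mono) auto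
  also have "\<dots> = emeasure lborel S"
    unfolding lborel_vec3 using S meas by (subst emeasure_distr) auto
  also have "emeasure lborel C = ennreal (pi * (\<sigma>\<^sup>2 - h\<^sup>2) * h)"
  proof -
    have "emeasure lborel C = emeasure lborel {0..<h} * emeasure lborel (ball (0 :: real \<times> real) (sqrt (\<sigma>\<^sup>2 - h\<^sup>2)))"
      using lborel.emeasure_pair_measure_Times[of "{0..<h}" lborel "ball (0 :: real \<times> real) (sqrt (\<sigma>\<^sup>2 - h\<^sup>2))"]
      by (simp add: C_def lborel_prod)
    also have "emeasure lborel (ball (0 :: real \<times> real) (sqrt (\<sigma>\<^sup>2 - h\<^sup>2))) = ennreal (pi * (\<sigma>\<^sup>2 - h\<^sup>2))"
      using nonneg by (subst emeasure_ball) (auto simp: unit_ball_vol_2)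
    finally show ?thesis using assms nonneg by (simp add: ennreal_mult[symmetric] mult.commute)
  qed
  finally have "ennreal (pi * (\<sigma>\<^sup>2 - h\<^sup>2) * h) \<le> emeasure lborel S" .
  moreover have "S \<in> lmeasurable"
    using S by (intro bounded_set_imp_lmeasurable bounded_subset[OF bounded_ball[of 0 \<sigma>]]) (auto simp: S_def)
  then have "emeasure lborel S = ennreal (measure lebesgue S)"
    using S emeasure_eq_measure2[of S lebesgue] by simp
  ultimately show ?thesis
    unfolding S_def[symmetric] by simp
qed

lemma slab_orthogonal_image:
  fixes f :: "real^3 \<Rightarrow> real^3" and T :: "real^3"
  assumes "orthogonal_transformation f"
  shows "f ` {z \<in> ball 0 \<sigma>. P (z \<bullet> T)} = {z \<in> ball 0 \<sigma>. P (z \<bullet> f T)}"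
proof -
  have "z \<in> f ` {z \<in> ball 0 \<sigma>. P (z \<bullet> T)}" if z: "z \<in> ball 0 \<sigma>" "P (z \<bullet> f T)" for z
  proof -
    obtain w where w: "z = f w"
      using orthogonal_transformation_surj[OF assms] by (metis surjD)
    then have "norm w = norm z" "w \<bullet> T = z \<bullet> f T"
      using assms by (simp_all add: orthogonal_transformation_norm orthogonal_transformation_def)
    then show ?thesis using w z by auto
  qed
  then show ?thesis
    using assms by (auto simp: orthogonal_transformation_norm orthogonal_transformation_def)
qed

text \<open>An orthogonal map taking T to S preserves the ball and carries one slab to the
  other.\<close>

lemma measure_slab_rotate:
  fixes T S :: "real^3"
  assumes "norm T = norm S" "{x. P x} \<in> sets borel"
  shows "measure lebesgue {z \<in> ball 0 \<sigma>. P (z \<bullet> T)} = measure lebesgue {z \<in> ball 0 \<sigma>. P (z \<bullet> S)}"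
    and "{z \<in> ball 0 \<sigma>. P (z \<bullet> T)} \<in> lmeasurable"
proof -
  have "(\<lambda>z. z \<bullet> T) \<in> borel_measurable borel"
    by (intro borel_measurable_continuous_onI continuous_intros)
  then have "(\<lambda>z. z \<bullet> T) -` {x. P x} \<in> sets borel"
    using assms(2) measurable_sets[of "\<lambda>z. z \<bullet> T" borel borel "{x. P x}"] by simp
  then have "ball 0 \<sigma> \<inter> (\<lambda>z. z \<bullet> T) -` {x. P x} \<in> sets borel" by auto
  also have "ball 0 \<sigma> \<inter> (\<lambda>z. z \<bullet> T) -` {x. P x} = {z \<in> ball 0 \<sigma>. P (z \<bullet> T)}" by auto
  finally show lm: "{z \<in> ball 0 \<sigma>. P (z \<bullet> T)} \<in> lmeasurable"
    by (intro bounded_set_imp_lmeasurable bounded_subset[OF bounded_ball[of 0 \<sigma>]]) auto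
  obtain f where f: "orthogonal_transformation f" "f T = S"
    using orthogonal_transformation_exists[OF assms(1)] by blast
  show "measure lebesgue {z \<in> ball 0 \<sigma>. P (z \<bullet> T)} = measure lebesgue {z \<in> ball 0 \<sigma>. P (z \<bullet> S)}"
    using measure_orthogonal_image[OF f(1) lm] slab_orthogonal_image[OF f(1), of \<sigma> P T] f(2) by simp
qed

text \<open>Only caps of one ball are compared, so the two planes need not be parallel.\<close>

lemma measure_wedge_ge:
  fixes T S p :: "real^3"
  assumes "T \<noteq> 0" "norm S = 1" "0 \<le> h" "h \<le> \<sigma>" "0 < \<sigma>"
  shows "pi * (\<sigma>\<^sup>2 - h\<^sup>2) * h \<le> measure lebesgue {z \<in> ball p \<sigma>. 0 \<le> (z - p) \<bullet> T \<and> (z - p) \<bullet> S < h}"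
    and "{z \<in> ball p \<sigma>. 0 \<le> (z - p) \<bullet> T \<and> (z - p) \<bullet> S < h} \<in> lmeasurable"
proof -
  let ?U = "T /\<^sub>R norm T"
  define W where "W = {z \<in> ball 0 \<sigma>. 0 \<le> z \<bullet> ?U} \<inter> {z \<in> ball 0 \<sigma>. z \<bullet> S < h}"
  have U: "norm ?U = 1" using assms(1) by simp
  have sgn: "0 \<le> z \<bullet> ?U \<longleftrightarrow> 0 \<le> z \<bullet> T" for z
    using assms(1) by (simp add: zero_le_mult_iff)
  have W: "W \<in> lmeasurable"
    unfolding W_def
    by (rule fmeasurable.Int[OF measure_slab_rotate(2)[OF refl, of "\<lambda>x. 0 \<le> x"]
          measure_slab_rotate(2)[OF refl, of "\<lambda>x. x < h"]]; measurable)
  have WW: "{z \<in> ball p \<sigma>. 0 \<le> (z - p) \<bullet> T \<and> (z - p) \<bullet> S < h} = (+) p ` W"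
  proof -
    have "z \<in> (+) p ` W" if "z \<in> ball p \<sigma>" "0 \<le> (z - p) \<bullet> T" "(z - p) \<bullet> S < h" for z
      using that sgn unfolding W_def
      by (intro image_eqI[of _ _ "z - p"]) (auto simp: dist_norm norm_minus_commute)
    then show ?thesis
      using sgn unfolding W_def by (auto simp: dist_norm)
  qed
  show "{z \<in> ball p \<sigma>. 0 \<le> (z - p) \<bullet> T \<and> (z - p) \<bullet> S < h} \<in> lmeasurable"
    unfolding WW using W by (rule measurable_translation)
  let ?S0 = "{z \<in> ball 0 \<sigma>. z \<bullet> S < 0}" and ?S1 = "{z \<in> ball 0 \<sigma>. 0 \<le> z \<bullet> S \<and> z \<bullet> S < h}"
    and ?U0 = "{z \<in> ball 0 \<sigma>. z \<bullet> ?U < 0}" and ?Sh = "{z \<in> ball 0 \<sigma>. z \<bullet> S < h}"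
  have slab: "{x :: real. 0 \<le> x \<and> x < h} \<in> sets borel" by measurable
  have lm: "?S0 \<in> lmeasurable" "?U0 \<in> lmeasurable" "?Sh \<in> lmeasurable" "?S1 \<in> lmeasurable"
    using measure_slab_rotate(2)[OF refl, of "\<lambda>x. x < 0" \<sigma>] measure_slab_rotate(2)[OF refl, of "\<lambda>x. x < h" \<sigma>]
      measure_slab_rotate(2)[OF refl slab, of \<sigma>] by (simp_all del: inner_scaleR_right)
  have "pi * (\<sigma>\<^sup>2 - h\<^sup>2) * h + measure lebesgue ?S0
      \<le> measure lebesgue {z \<in> ball 0 \<sigma>. 0 \<le> z \<bullet> (axis 1 1 :: real^3) \<and> z \<bullet> axis 1 1 < h} + measure lebesgue ?S0"
    using measure_cylinder_le_slab[OF assms(3-5)] by (simp add: inner_axis)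
  also have "measure lebesgue {z \<in> ball 0 \<sigma>. 0 \<le> z \<bullet> (axis 1 1 :: real^3) \<and> z \<bullet> axis 1 1 < h} = measure lebesgue ?S1"
    by (rule measure_slab_rotate(1)[OF _ slab]) (simp add: assms)
  also have "measure lebesgue ?S1 + measure lebesgue ?S0 = measure lebesgue (?S1 \<union> ?S0)"
  proof -
    have "?S1 \<inter> ?S0 = {}" by auto
    then show ?thesis using measure_Un3[OF lm(4) lm(1)] by simp
  qed
  also have "?S1 \<union> ?S0 = ?Sh" using assms(3) by auto
  \<comment> \<open>\<open>?Sh\<close> is \<open>?S1\<close> together with the half ball
    \<open>?S0\<close>, and outside W it lies in the half ball \<open>?U0\<close>. Half balls have
    equal volume, so W is at least as large as \<open>?S1\<close> although T and S may
    differ.\<close>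
  also have "measure lebesgue ?Sh \<le> measure lebesgue (W \<union> ?U0)"
    by (rule measure_mono_fmeasurable) (use lm W in \<open>auto simp: W_def\<close>)
  also have "\<dots> \<le> measure lebesgue W + measure lebesgue ?U0"
    using W lm by (intro measure_Un_le) auto
  also have "measure lebesgue ?U0 = measure lebesgue ?S0"
    by (rule measure_slab_rotate(1)[of _ _ "\<lambda>x. x < 0"]) (use U assms in auto)
  finally have "pi * (\<sigma>\<^sup>2 - h\<^sup>2) * h \<le> measure lebesgue W" by simp
  then show "pi * (\<sigma>\<^sup>2 - h\<^sup>2) * h \<le> measure lebesgue {z \<in> ball p \<sigma>. 0 \<le> (z - p) \<bullet> T \<and> (z - p) \<bullet> S < h}"
    unfolding WW by (simp add: measure_translation)
qed

section \<open>Circles and tubes\<close>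

abbreviation velocity :: "(real \<Rightarrow> real^3) \<Rightarrow> real \<Rightarrow> real^3" where
  "velocity \<gamma> t \<equiv> vector_derivative \<gamma> (at t)"

context
  fixes \<gamma> :: "real \<Rightarrow> real^3"
  assumes circle: "C1_embedded_circle \<gamma>"
begin

lemma circle_has_velocity: "(\<gamma> has_vector_derivative velocity \<gamma> t) (at t)"
  using circle unfolding C1_embedded_circle_def C1_differentiable_on_eq
  by (simp add: vector_derivative_works)

lemma circle_has_derivative: "(\<gamma> has_derivative (\<lambda>h. h *\<^sub>R velocity \<gamma> t)) (at t within S)"
  using circle_has_velocity[of t] unfolding has_vector_derivative_def
  by (rule has_derivative_at_withinI)

lemma continuous_on_velocity: "continuous_on S (velocity \<gamma>)"
  using circle unfolding C1_embedded_circle_def C1_differentiable_on_eq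
  by (blast intro: continuous_on_subset)

lemma circle_continuous_on: "continuous_on S \<gamma>"
  using circle_has_velocity
  by (meson continuous_at_imp_continuous_on has_vector_derivative_continuous)

lemma velocity_nonzero: "velocity \<gamma> t \<noteq> 0"
  using circle unfolding C1_embedded_circle_def by blast

lemma circle_add_int: "\<gamma> (t + of_int k) = \<gamma> t"
proof -
  have nat: "\<gamma> (t + real k) = \<gamma> t" for k t
  proof (induction k)
    case (Suc k)
    have "\<gamma> (t + real (Suc k)) = \<gamma> ((t + real k) + 1)" by (simp add: add_ac)
    then show ?case
      using Suc circle unfolding C1_embedded_circle_def by metis
  qed simp
  show ?thesis
  proof (cases "k \<ge> 0")
    case True
    then show ?thesis using nat[of t "nat k"] by simp
  next
    case False
    then show ?thesis using nat[of "t + of_int k" "nat (- k)"] by simp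
  qed
qed

lemma circle_frac: "\<gamma> (frac t) = \<gamma> t"
  using circle_add_int[of t "- \<lfloor>t\<rfloor>"] by (simp add: frac_def)

lemma velocity_add_int: "velocity \<gamma> (t + of_int k) = velocity \<gamma> t"
proof -
  have "((\<lambda>s. \<gamma> (s + of_int k)) has_vector_derivative 1 *\<^sub>R velocity \<gamma> (t + of_int k)) (at t)"
    by (rule vector_diff_chain_at[unfolded o_def, of "\<lambda>s. s + of_int k" 1 t \<gamma>])
       (auto intro!: derivative_eq_intros circle_has_velocity)
  then show ?thesis
    by (simp add: circle_add_int vector_derivative_at)
qed

lemma velocity_frac: "velocity \<gamma> (frac t) = velocity \<gamma> t"
  using velocity_add_int[of t "- \<lfloor>t\<rfloor>"] by (simp add: frac_def)

lemma circle_eq_iff: "\<gamma> s = \<gamma> t \<longleftrightarrow> frac s = frac t"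
proof
  assume "\<gamma> s = \<gamma> t"
  then have "\<gamma> (frac s) = \<gamma> (frac t)" by (simp add: circle_frac)
  then show "frac s = frac t"
    using circle unfolding C1_embedded_circle_def
    by (auto dest!: inj_onD simp: frac_ge_0 frac_lt_1)
next
  assume "frac s = frac t"
  then show "\<gamma> s = \<gamma> t" by (metis circle_frac)
qed

lemma range_circle: "range \<gamma> = \<gamma> ` {0..<1}"
proof
  show "range \<gamma> \<subseteq> \<gamma> ` {0..<1}"
    by (metis atLeastLessThan_iff circle_frac frac_ge_0 frac_lt_1 image_eqI image_subsetI)
qed auto

lemma range_circle_closed: "range \<gamma> = \<gamma> ` {0..1}"
  using range_circle by auto

lemma compact_range_circle: "compact (range \<gamma>)"
  unfolding range_circle_closed by (intro compact_continuous_image circle_continuous_on) simp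

lemma velocity_uniform:
  assumes "\<epsilon> > 0"
  shows "\<exists>\<delta>>0. \<forall>s t. \<bar>s - t\<bar> < \<delta> \<longrightarrow> norm (velocity \<gamma> s - velocity \<gamma> t) < \<epsilon>"
proof -
  have "uniformly_continuous_on {-1..2} (velocity \<gamma>)"
    by (intro compact_uniformly_continuous continuous_on_velocity) simp
  then obtain d where d: "d > 0" "\<And>s t. s \<in> {-1..2} \<Longrightarrow> t \<in> {-1..2} \<Longrightarrow> dist s t < d \<Longrightarrow>
      dist (velocity \<gamma> s) (velocity \<gamma> t) < \<epsilon>"
    unfolding uniformly_continuous_on_def using assms by metis
  show ?thesis
  proof (intro exI[of _ "min d 1"] conjI allI impI)
    fix s t :: real assume st: "\<bar>s - t\<bar> < min d 1"
    let ?k = "- \<lfloor>s\<rfloor>"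
    have "of_int \<lfloor>s\<rfloor> \<le> s" "s < of_int \<lfloor>s\<rfloor> + 1"
      by linarith+
    then have "s + of_int ?k \<in> {-1..2}" "t + of_int ?k \<in> {-1..2}"
      using st unfolding atLeastAtMost_iff of_int_minus by linarith+
    then have "dist (velocity \<gamma> (s + of_int ?k)) (velocity \<gamma> (t + of_int ?k)) < \<epsilon>"
      using st by (intro d) (auto simp: dist_real_def)
    then show "norm (velocity \<gamma> s - velocity \<gamma> t) < \<epsilon>"
      by (simp only: velocity_add_int dist_norm)
  qed (use d in auto)
qed

text \<open>The mean value inequality for
  \<open>\<gamma> x - x *\<^sub>R velocity \<gamma> u\<close>. The velocity may be taken at any
  nearby u, and \<delta> is uniform over all parameters, as the estimates on a grid require.\<close>

lemma circle_increment:
  assumes "\<epsilon> > 0"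
  shows "\<exists>\<delta>>0. \<forall>s t u. \<bar>s - u\<bar> < \<delta> \<longrightarrow> \<bar>t - u\<bar> < \<delta> \<longrightarrow>
    norm (\<gamma> t - \<gamma> s - (t - s) *\<^sub>R velocity \<gamma> u) \<le> \<epsilon> * \<bar>t - s\<bar>"
proof -
  obtain \<delta> where \<delta>: "\<delta> > 0" "\<And>s t. \<bar>s - t\<bar> < \<delta> \<Longrightarrow> norm (velocity \<gamma> s - velocity \<gamma> t) < \<epsilon>"
    using velocity_uniform[OF assms] by blast
  show ?thesis
  proof (intro exI[of _ \<delta>] conjI allI impI \<delta>)
    fix s t u :: real assume st: "\<bar>s - u\<bar> < \<delta>" "\<bar>t - u\<bar> < \<delta>"
    define g where "g x = \<gamma> x - x *\<^sub>R velocity \<gamma> u" for x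
    have "norm (g t - g s) \<le> \<epsilon> * norm (t - s)"
    proof (rule differentiable_bound[where S = "ball u \<delta>" and f' = "\<lambda>x h. h *\<^sub>R (velocity \<gamma> x - velocity \<gamma> u)"])
      fix x assume x: "x \<in> ball u \<delta>"
      show "(g has_derivative (\<lambda>h. h *\<^sub>R (velocity \<gamma> x - velocity \<gamma> u))) (at x within ball u \<delta>)"
        unfolding g_def
        by (auto intro!: derivative_eq_intros circle_has_derivative simp: algebra_simps)
      show "onorm (\<lambda>h. h *\<^sub>R (velocity \<gamma> x - velocity \<gamma> u)) \<le> \<epsilon>"
      proof (rule onorm_le)
        fix h :: real
        have "norm (velocity \<gamma> x - velocity \<gamma> u) \<le> \<epsilon>"
          using x \<delta>(2)[of x u] by (simp add: dist_real_def abs_minus_commute)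
        then have "\<bar>h\<bar> * norm (velocity \<gamma> x - velocity \<gamma> u) \<le> \<bar>h\<bar> * \<epsilon>"
          by (rule mult_left_mono) simp
        then show "norm (h *\<^sub>R (velocity \<gamma> x - velocity \<gamma> u)) \<le> \<epsilon> * norm h"
          by (simp add: mult.commute)
      qed
    qed (use st in \<open>auto simp: dist_real_def abs_minus_commute\<close>)
    then show "norm (\<gamma> t - \<gamma> s - (t - s) *\<^sub>R velocity \<gamma> u) \<le> \<epsilon> * \<bar>t - s\<bar>"
      by (simp add: g_def algebra_simps)
  qed
qed

lemma speed_lower_bound: "\<exists>c>0. \<forall>t. c \<le> norm (velocity \<gamma> t)"
proof -
  have "continuous_on {0..1} (\<lambda>t. norm (velocity \<gamma> t))"
    by (intro continuous_intros continuous_on_velocity)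
  then obtain x where x: "\<And>t. t \<in> {0..1} \<Longrightarrow> norm (velocity \<gamma> x) \<le> norm (velocity \<gamma> t)"
    using continuous_attains_inf[of "{0..1::real}" "\<lambda>t. norm (velocity \<gamma> t)"]
    by (metis atLeastAtMost_iff compact_Icc empty_iff order_refl zero_le_one)
  have "norm (velocity \<gamma> x) \<le> norm (velocity \<gamma> t)" for t
    using x[of "frac t"] velocity_frac[of t] frac_lt_1[of t] by (simp add: frac_ge_0)
  then show ?thesis
    using velocity_nonzero[of x] by (intro exI[of _ "norm (velocity \<gamma> x)"]) auto
qed

lemma speed_upper_bound: "\<exists>C>0. \<forall>t. norm (velocity \<gamma> t) \<le> C"
proof -
  have "continuous_on {0..1} (\<lambda>t. norm (velocity \<gamma> t))"
    by (intro continuous_intros continuous_on_velocity)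
  then obtain x where x: "\<And>t. t \<in> {0..1} \<Longrightarrow> norm (velocity \<gamma> t) \<le> norm (velocity \<gamma> x)"
    using continuous_attains_sup[of "{0..1::real}" "\<lambda>t. norm (velocity \<gamma> t)"]
    by (metis atLeastAtMost_iff compact_Icc empty_iff order_refl zero_le_one)
  have "norm (velocity \<gamma> t) \<le> norm (velocity \<gamma> x)" for t
    using x[of "frac t"] velocity_frac[of t] frac_lt_1[of t] by (simp add: frac_ge_0)
  then show ?thesis
    using velocity_nonzero[of x] by (intro exI[of _ "norm (velocity \<gamma> x)"]) auto
qed

end

section \<open>Geometric consequences of disjoint normal discs\<close>

text \<open>The radius is any one with disjoint discs and not the reach itself: it is left open
  whether the supremum in \<open>reach\<close> is attained, so estimates are made for such radii and
  passed to the limit at the end.\<close>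

locale thick_link =
  fixes n :: nat and L :: "nat \<Rightarrow> real \<Rightarrow> real^3" and r :: real
  assumes link: "link n L" and tube: "embedded_tube n L r" and r_pos: "r > 0"
begin

lemma circle: "i \<in> {1..n} \<Longrightarrow> C1_embedded_circle (L i)"
  using link unfolding link_def by blast

lemma components_disjoint: "i \<in> {1..n} \<Longrightarrow> j \<in> {1..n} \<Longrightarrow> i \<noteq> j \<Longrightarrow> L i s \<noteq> L j t"
  using link unfolding link_def disjoint_family_on_def by blast

lemma link_eq_iff:
  assumes "i \<in> {1..n}" "j \<in> {1..n}"
  shows "L i s = L j t \<longleftrightarrow> i = j \<and> frac s = frac t"
  using components_disjoint[OF assms] circle_eq_iff[OF circle[OF assms(1)]] by blast

lemma normal_disc_frac:
  assumes "i \<in> {1..n}"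
  shows "normal_disc r (L i) (frac t) = normal_disc r (L i) t"
  unfolding normal_disc_def circle_frac[OF circle[OF assms]] velocity_frac[OF circle[OF assms]] ..

lemma normal_disc_disjoint:
  assumes "i \<in> {1..n}" "j \<in> {1..n}" "z \<in> normal_disc r (L i) s" "z \<in> normal_disc r (L j) t"
  shows "i = j \<and> frac s = frac t"
proof (rule ccontr)
  assume "\<not> ?thesis"
  then have "normal_disc r (L i) (frac s) \<inter> normal_disc r (L j) (frac t) = {}"
    using tube disjoint_family_onD[of "\<lambda>(i, t). normal_disc r (L i) t" "{1..n} \<times> {0..<1}" "(i, frac s)" "(j, frac t)"] assms
    unfolding embedded_tube_def by (auto simp: frac_ge_0 frac_lt_1)
  then show False
    using assms by (auto simp: normal_disc_frac)
qed

lemma nearest_point_orthogonal: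
  assumes "i \<in> {1..n}" "\<And>t. norm (z - L i s) \<le> norm (z - L i t)"
  shows "(z - L i s) \<bullet> velocity (L i) s = 0"
proof -
  let ?f = "\<lambda>t. (z - L i t) \<bullet> (z - L i t)"
  have "(?f has_derivative (\<lambda>h. h * (- 2 * ((z - L i s) \<bullet> velocity (L i) s)))) (at s)"
    by (rule derivative_eq_intros circle_has_derivative circle assms refl)+
       (auto simp: inner_commute algebra_simps inner_diff_left inner_diff_right)
  then have "(?f has_real_derivative - 2 * ((z - L i s) \<bullet> velocity (L i) s)) (at s)"
    unfolding has_field_derivative_def
    by (rule back_subst[of "\<lambda>f. (?f has_derivative f) (at s)"]) (simp add: fun_eq_iff)
  then have "- 2 * ((z - L i s) \<bullet> velocity (L i) s) = 0"
    by (rule DERIV_local_min[of _ _ _ 1])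
       (use assms(2) in \<open>auto simp: norm_le\<close>)
  then show ?thesis by simp
qed

lemma nearest_point_exists:
  assumes "i \<in> {1..n}"
  obtains s where "\<And>t. norm (z - L i s) \<le> norm (z - L i t)"
proof -
  obtain x where "x \<in> range (L i)" "\<And>y. y \<in> range (L i) \<Longrightarrow> dist z x \<le> dist z y"
    using distance_attains_inf[of "range (L i)" z] compact_range_circle[OF circle[OF assms]]
    by (metis compact_imp_closed UNIV_not_empty image_is_empty)
  then show ?thesis using that by (metis dist_norm rangeE rangeI)
qed

text \<open>At a closest pair the connecting segment is normal to both components, so for a distance
  below 2r its midpoint would lie in two normal discs.\<close>

lemma component_distance:
  assumes ij: "i \<in> {1..n}" "j \<in> {1..n}" "i \<noteq> j"
  shows "2 * r \<le> norm (L i s - L j t)"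
proof -
  have "compact (range (L i) \<times> range (L j))"
    by (intro compact_Times compact_range_circle circle ij)
  moreover have "continuous_on (range (L i) \<times> range (L j)) (\<lambda>(x, y). norm (x - y))"
    unfolding case_prod_beta by (intro continuous_intros)
  ultimately obtain a b where ab: "\<And>s t. norm (L i a - L j b) \<le> norm (L i s - L j t)"
    using continuous_attains_inf[of "range (L i) \<times> range (L j)" "\<lambda>(x, y). norm (x - y)"] by fastforce
  have "\<not> norm (L i a - L j b) < 2 * r"
  proof
    assume less: "norm (L i a - L j b) < 2 * r"
    define z where "z = (1/2) *\<^sub>R (L i a + L j b)"
    have zi: "z - L i a = (1/2) *\<^sub>R (L j b - L i a)" and zj: "z - L j b = (1/2) *\<^sub>R (L i a - L j b)"
      unfolding z_def by (simp_all add: vec_eq_iff field_simps)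
    have "(L j b - L i a) \<bullet> velocity (L i) a = 0"
      by (rule nearest_point_orthogonal[OF ij(1)]) (use ab in \<open>simp add: norm_minus_commute\<close>)
    moreover have "(L i a - L j b) \<bullet> velocity (L j) b = 0"
      by (rule nearest_point_orthogonal[OF ij(2)]) (use ab in simp)
    ultimately have "z \<in> normal_disc r (L i) a" "z \<in> normal_disc r (L j) b"
      using less by (auto simp: normal_disc_def zi zj norm_minus_commute)
    then show False using normal_disc_disjoint[OF ij(1,2)] ij(3) by blast
  qed
  then show ?thesis using ab[of s t] by linarith
qed

text \<open>The centre \<open>L i s + N\<close> lies in the normal disc at s, and also in the one at
  its nearest point on the component. By disjointness these are the same point, so the component
  stays outside the ball that touches it at \<open>L i s\<close>; squaring this gives the
  inequality.\<close>

lemma tangent_ball_empty: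
  assumes i: "i \<in> {1..n}" and N: "N \<bullet> velocity (L i) s = 0" "norm N < r"
  shows "2 * (N \<bullet> (L i t - L i s)) \<le> (norm (L i t - L i s))\<^sup>2"
proof -
  define c where "c = L i s + N"
  have c: "c \<in> normal_disc r (L i) s" using N by (simp add: normal_disc_def c_def)
  obtain q where q: "\<And>t. norm (c - L i q) \<le> norm (c - L i t)"
    using nearest_point_exists[OF i] by blast
  have "norm (c - L i q) < r" using q[of s] N by (simp add: c_def)
  then have "c \<in> normal_disc r (L i) q"
    using nearest_point_orthogonal[OF i q] by (simp add: normal_disc_def)
  then have "frac q = frac s" using normal_disc_disjoint[OF i i] c by blast
  then have "L i q = L i s" using link_eq_iff[OF i i] by blast
  then have "norm N \<le> norm (c - L i t)" using q[of t] by (simp add: c_def)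
  also have "c - L i t = N - (L i t - L i s)" by (simp add: c_def)
  finally have "(norm N)\<^sup>2 \<le> (norm (N - (L i t - L i s)))\<^sup>2" by (intro power_mono) auto
  then show ?thesis
    by (simp add: power2_norm_eq_inner inner_diff_left inner_diff_right inner_commute)
qed

text \<open>Half the radius keeps the norm of the normal vector strictly below r; the factor lost
  only affects a Lipschitz constant.\<close>

lemma chord_normal_component:
  assumes i: "i \<in> {1..n}" and u: "u \<bullet> velocity (L i) s = 0" "norm u = 1"
  shows "r * (u \<bullet> (L i t - L i s)) \<le> (norm (L i t - L i s))\<^sup>2"
  using tangent_ball_empty[OF i, of "(r / 2) *\<^sub>R u" s t] u r_pos by simp

end

section \<open>Generic projections\<close>

text \<open>The cone has only two parameters, the scale and t. They are placed in a hyperplane of a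
  three-dimensional space, so that a null set is mapped by a locally Lipschitz map into a space of
  no smaller dimension.\<close>

lemma negligible_cone_Lipschitz:
  fixes g :: "real \<Rightarrow> 'b::euclidean_space"
  assumes "3 \<le> DIM('b)"
    and lip: "\<And>t. t \<in> A \<Longrightarrow> \<exists>d>0. \<exists>B. \<forall>s\<in>A. \<bar>s - t\<bar> < d \<longrightarrow> norm (g s - g t) \<le> B * \<bar>s - t\<bar>"
  shows "negligible {c *\<^sub>R g t | c t. t \<in> A}"
proof -
  define S where "S = (UNIV :: real set) \<times> A \<times> {0 :: real}"
  define f where "f p = fst p *\<^sub>R g (fst (snd p))" for p :: "real \<times> real \<times> real"
  have "negligible {x :: real \<times> real \<times> real. (0, 0, 1) \<bullet> x = 0}"
    by (rule negligible_hyperplane) (simp add: zero_prod_def)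
  then have "negligible S"
    by (rule negligible_subset) (auto simp: S_def)
  then have "negligible (f ` S)"
  proof (rule negligible_locally_Lipschitz_image[rotated])
    fix x assume "x \<in> S"
    then obtain c t where x: "x = (c, t, 0)" "t \<in> A" by (auto simp: S_def)
    obtain d B where d: "d > 0" "\<And>s. s \<in> A \<Longrightarrow> \<bar>s - t\<bar> < d \<Longrightarrow> norm (g s - g t) \<le> B * \<bar>s - t\<bar>"
      using lip[OF x(2)] by blast
    define d' where "d' = min d 1"
    define M where "M = norm (g t) + (\<bar>c\<bar> + 1) * \<bar>B\<bar>"
    have "norm (f y - f x) \<le> M * norm (y - x)" if y: "y \<in> S" "y \<in> ball x d'" for y
    proof -
      obtain c' s where cs: "y = (c', s, 0)" "s \<in> A" using y by (auto simp: S_def)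
      have n: "\<bar>c' - c\<bar> \<le> norm (y - x)" "\<bar>s - t\<bar> \<le> norm (y - x)"
        using norm_fst_le[of "c' - c" "(s - t, 0::real)"] norm_snd_le[of "(s - t, 0::real)" "c' - c"]
          norm_fst_le[of "s - t" "0::real"] by (auto simp: cs x)
      have "norm (y - x) < d'" using y by (simp add: dist_norm norm_minus_commute)
      then have st: "\<bar>s - t\<bar> < d" "\<bar>c' - c\<bar> < 1" using n by (auto simp: d'_def)
      have "f y - f x = c' *\<^sub>R (g s - g t) + (c' - c) *\<^sub>R g t"
        by (simp add: f_def cs x algebra_simps)
      then have "norm (f y - f x) \<le> \<bar>c'\<bar> * norm (g s - g t) + \<bar>c' - c\<bar> * norm (g t)"
        by (metis norm_scaleR norm_triangle_ineq)
      also have "\<bar>c'\<bar> * norm (g s - g t) \<le> (\<bar>c\<bar> + 1) * (\<bar>B\<bar> * norm (y - x))"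
      proof (rule mult_mono)
        have "norm (g s - g t) \<le> B * \<bar>s - t\<bar>" using d cs st by blast
        also have "\<dots> \<le> \<bar>B\<bar> * norm (y - x)" using n by (intro mult_mono) auto
        finally show "norm (g s - g t) \<le> \<bar>B\<bar> * norm (y - x)" .
      qed (use st in auto)
      also have "\<bar>c' - c\<bar> * norm (g t) \<le> norm (y - x) * norm (g t)"
        using n by (intro mult_right_mono) auto
      finally show ?thesis by (simp add: M_def algebra_simps)
    qed
    then show "\<exists>T B. open T \<and> x \<in> T \<and> (\<forall>y\<in>S \<inter> T. norm (f y - f x) \<le> B * norm (y - x))"
      using d(1) by (intro exI[of _ "ball x d'"] exI[of _ M]) (auto simp: d'_def)
  qed (use assms(1) in simp)
  moreover have "{c *\<^sub>R g t | c t. t \<in> A} \<subseteq> f ` S"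
  proof
    fix y assume "y \<in> {c *\<^sub>R g t | c t. t \<in> A}"
    then obtain c t where "y = c *\<^sub>R g t" "t \<in> A" by blast
    then show "y \<in> f ` S" by (intro image_eqI[of _ _ "(c, t, 0)"]) (auto simp: f_def S_def)
  qed
  ultimately show ?thesis by (rule negligible_subset)
qed

text \<open>The projections of D to the lines of S and of T are both within \<eta> of D, hence
  within 2 \<eta> of each other, and so are their lengths. Positive inner products exclude opposite
  directions.\<close>

lemma unit_vectors_close:
  fixes S T D :: "'a::real_inner"
  assumes "norm S = 1" "norm T = 1" "0 < D \<bullet> S" "0 < D \<bullet> T"
    and "norm (D - (D \<bullet> S) *\<^sub>R S) \<le> \<eta>" "norm (D - (D \<bullet> T) *\<^sub>R T) \<le> \<eta>"
  shows "(D \<bullet> S) * norm (T - S) \<le> 4 * \<eta>"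
proof -
  define \<alpha> \<beta> where "\<alpha> = D \<bullet> S" and "\<beta> = D \<bullet> T"
  have "\<alpha> *\<^sub>R S - \<beta> *\<^sub>R T = (D - \<beta> *\<^sub>R T) - (D - \<alpha> *\<^sub>R S)" by simp
  then have d: "norm (\<alpha> *\<^sub>R S - \<beta> *\<^sub>R T) \<le> 2 * \<eta>"
    using norm_triangle_ineq4[of "D - \<beta> *\<^sub>R T" "D - \<alpha> *\<^sub>R S"] assms(5,6) by (simp add: \<alpha>_def \<beta>_def)
  have "\<bar>norm (\<alpha> *\<^sub>R S) - norm (\<beta> *\<^sub>R T)\<bar> \<le> norm (\<alpha> *\<^sub>R S - \<beta> *\<^sub>R T)"
    by (rule norm_triangle_ineq3)
  then have ab: "\<bar>\<alpha> - \<beta>\<bar> \<le> 2 * \<eta>"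
    using assms d by (simp add: \<alpha>_def \<beta>_def)
  have "\<alpha> *\<^sub>R (T - S) = (\<alpha> - \<beta>) *\<^sub>R T - (\<alpha> *\<^sub>R S - \<beta> *\<^sub>R T)"
    by (simp add: algebra_simps)
  then have "norm (\<alpha> *\<^sub>R (T - S)) \<le> \<bar>\<alpha> - \<beta>\<bar> * norm T + norm (\<alpha> *\<^sub>R S - \<beta> *\<^sub>R T)"
    by (metis norm_scaleR norm_triangle_ineq4)
  then show ?thesis
    using ab d assms by (simp add: \<alpha>_def \<beta>_def)
qed

context thick_link
begin

text \<open>The normal part N of the chord is tested against its own direction, its inner product
  with the chord being the square of its norm.\<close>

lemma chord_normal_norm:
  assumes i: "i \<in> {1..n}"
  defines "T \<equiv> \<lambda>s. velocity (L i) s /\<^sub>R norm (velocity (L i) s)"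
  shows "norm ((L i t - L i s) - ((L i t - L i s) \<bullet> T s) *\<^sub>R T s) \<le> (norm (L i t - L i s))\<^sup>2 / r"
proof -
  define D where "D = L i t - L i s"
  define N where "N = D - (D \<bullet> T s) *\<^sub>R T s"
  have v: "velocity (L i) s \<noteq> 0" by (rule velocity_nonzero[OF circle[OF i]])
  have vT: "velocity (L i) s = norm (velocity (L i) s) *\<^sub>R T s" "norm (T s) = 1"
    using v by (auto simp: T_def)
  have NT: "N \<bullet> T s = 0"
    using vT(2) by (simp add: N_def inner_diff_left norm_eq_1)
  show ?thesis
  proof (cases "N = 0")
    case False
    have "(N /\<^sub>R norm N) \<bullet> velocity (L i) s = 0"
      by (subst vT(1)) (simp add: NT)
    then have "r * ((N /\<^sub>R norm N) \<bullet> D) \<le> (norm D)\<^sup>2"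
      unfolding D_def using False by (intro chord_normal_component i) auto
    moreover have "N \<bullet> D = (norm N)\<^sup>2"
    proof -
      have "D = N + (D \<bullet> T s) *\<^sub>R T s" by (simp add: N_def)
      then have "N \<bullet> D = N \<bullet> N + (D \<bullet> T s) * (N \<bullet> T s)"
        by (metis inner_add_right inner_scaleR_right)
      then show ?thesis by (simp add: NT power2_norm_eq_inner)
    qed
    ultimately have "r * norm N \<le> (norm D)\<^sup>2"
      using False by (simp add: power2_eq_square field_simps)
    then show ?thesis
      using r_pos by (simp add: N_def[symmetric] D_def[symmetric] pos_le_divide_eq mult.commute)
  qed (use r_pos in \<open>simp add: N_def[symmetric] D_def[symmetric]\<close>)
qed

text \<open>The chord between two nearby points serves as common reference: by the empty tangent
  balls at both ends its distance from either tangent line is of second order in its length, while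
  its tangential part is of first order.\<close>

lemma unit_tangent_Lipschitz:
  assumes i: "i \<in> {1..n}"
  defines "T \<equiv> \<lambda>s. velocity (L i) s /\<^sub>R norm (velocity (L i) s)"
  shows "\<exists>d>0. \<exists>B. \<forall>t. \<bar>t - s\<bar> < d \<longrightarrow> norm (T t - T s) \<le> B * \<bar>t - s\<bar>"
proof -
  note ci = circle[OF i]
  let ?v = "velocity (L i)"
  obtain c where c: "c > 0" "\<And>t. c \<le> norm (?v t)"
    using speed_lower_bound[OF ci] by blast
  obtain C where C: "C > 0" "\<And>t. norm (?v t) \<le> C"
    using speed_upper_bound[OF ci] by blast
  obtain \<delta> where \<delta>: "\<delta> > 0" "\<And>s t u. \<bar>s - u\<bar> < \<delta> \<Longrightarrow> \<bar>t - u\<bar> < \<delta> \<Longrightarrow>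
      norm (L i t - L i s - (t - s) *\<^sub>R ?v u) \<le> c / 2 * \<bar>t - s\<bar>"
    using circle_increment[OF ci, of "c / 2"] c by auto
  have vT: "?v s = norm (?v s) *\<^sub>R T s" "norm (T s) = 1" for s
    using velocity_nonzero[OF ci, of s] by (auto simp: T_def)
  have cn: "norm ((L i t - L i s) - ((L i t - L i s) \<bullet> T s) *\<^sub>R T s) \<le> (norm (L i t - L i s))\<^sup>2 / r" for s t
    using chord_normal_norm[OF i, of t s] by (simp add: T_def)
  \<comment> \<open>Four times the squared chord bound \<open>(2 * C)\<^sup>2 / r\<close>, divided
    by the lower bound \<open>c / 2\<close> for the tangential part of the chord.\<close>
  define B where "B = 8 * (2 * C)\<^sup>2 / (c * r)"
  have pos: "c / 2 * (t - s) \<le> (L i t - L i s) \<bullet> T u" if "\<bar>s - u\<bar> < \<delta>" "\<bar>t - u\<bar> < \<delta>" "s \<le> t" for s t u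
  proof -
    define X where "X = (L i t - L i s) \<bullet> T u"
    define y where "y = ?v u \<bullet> T u"
    have "\<bar>(L i t - L i s - (t - s) *\<^sub>R ?v u) \<bullet> T u\<bar> \<le> c / 2 * \<bar>t - s\<bar>"
      using \<delta>(2)[OF that(1,2)] Cauchy_Schwarz_ineq2[of "L i t - L i s - (t - s) *\<^sub>R ?v u" "T u"] vT(2)[of u]
      by simp
    then have "\<bar>X - (t - s) * y\<bar> \<le> c / 2 * (t - s)"
      using that by (simp add: inner_diff_left[of "L i t - L i s"] X_def y_def)
    moreover have "y = norm (?v u)"
      using vT[of u] unfolding y_def by (metis inner_scaleR_left mult.right_neutral norm_eq_1)
    then have "(t - s) * c \<le> (t - s) * y"
      using c(2)[of u] that by (simp add: mult_left_mono)
    ultimately have "(t - s) * c - c / 2 * (t - s) \<le> X"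
      by linarith
    moreover have "(t - s) * c - c / 2 * (t - s) = c / 2 * (t - s)" by (simp add: field_simps)
    ultimately show ?thesis by (simp add: X_def)
  qed
  have main: "norm (T t - T s) \<le> B * (t - s)" if st: "s < t" "t - s < \<delta>" for s t
  proof -
    let ?D = "L i t - L i s"
    have "norm ?D \<le> norm ((t - s) *\<^sub>R ?v s) + norm (?D - (t - s) *\<^sub>R ?v s)"
      by (metis add.commute diff_add_cancel norm_triangle_ineq)
    also have "norm ((t - s) *\<^sub>R ?v s) \<le> C * (t - s)"
      using C(2)[of s] st by simp
    also have "norm (?D - (t - s) *\<^sub>R ?v s) \<le> c / 2 * \<bar>t - s\<bar>"
      using st \<delta>(1) by (intro \<delta>(2)) auto
    also have "c / 2 * \<bar>t - s\<bar> \<le> C * (t - s)"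
      using st c(1) order_trans[OF c(2) C(2)] by (simp add: mult_right_mono)
    finally have D: "norm ?D \<le> 2 * C * (t - s)" by simp
    have p1: "c / 2 * (t - s) \<le> ?D \<bullet> T s" and p2: "c / 2 * (t - s) \<le> ?D \<bullet> T t"
      using st \<delta>(1) pos[of s s t] pos[of s t t] by auto
    have c0: "0 < c / 2 * (t - s)" using c st by simp
    have sym: "norm (?D - (?D \<bullet> T t) *\<^sub>R T t) \<le> (norm ?D)\<^sup>2 / r"
    proof -
      have "?D - (?D \<bullet> T t) *\<^sub>R T t = - ((L i s - L i t) - ((L i s - L i t) \<bullet> T t) *\<^sub>R T t)"
        by (simp add: algebra_simps inner_diff_left)
      then show ?thesis
        using cn[of s t] by (simp only: norm_minus_cancel norm_minus_commute[of "L i s"])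
    qed
    have "(?D \<bullet> T s) * norm (T t - T s) \<le> 4 * ((norm ?D)\<^sup>2 / r)"
      using p1 p2 c0 vT(2) sym cn[of t s]
      by (intro unit_vectors_close) auto
    moreover have "c / 2 * (t - s) * norm (T t - T s) \<le> (?D \<bullet> T s) * norm (T t - T s)"
      using p1 by (rule mult_right_mono) simp
    moreover have "(norm ?D)\<^sup>2 / r \<le> (2 * C * (t - s))\<^sup>2 / r"
      using D r_pos by (intro divide_right_mono power_mono) auto
    ultimately have "c / 2 * (t - s) * norm (T t - T s) \<le> 4 * ((2 * C * (t - s))\<^sup>2 / r)"
      by linarith
    also have "\<dots> = c / 2 * (t - s) * (B * (t - s))"
      using c(1) r_pos by (simp add: B_def power2_eq_square)
    finally show ?thesis
      using c0 by (rule mult_left_le_imp_le)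
  qed
  have "norm (T t - T s) \<le> B * \<bar>t - s\<bar>" if "\<bar>t - s\<bar> < \<delta>" for t
    using main[of s t] main[of t s] that
    by (cases s t rule: linorder_cases) (auto simp: norm_minus_commute)
  then show ?thesis using \<delta>(1) by blast
qed

lemma negligible_tangent_cone:
  assumes i: "i \<in> {1..n}"
  shows "negligible {c *\<^sub>R velocity (L i) t | c t. True}"
proof -
  let ?T = "\<lambda>s. velocity (L i) s /\<^sub>R norm (velocity (L i) s)"
  have "negligible {c *\<^sub>R ?T t | c t. t \<in> UNIV}"
    using unit_tangent_Lipschitz[OF i] by (intro negligible_cone_Lipschitz) auto
  moreover have "{c *\<^sub>R velocity (L i) t | c t. True} \<subseteq> {c *\<^sub>R ?T t | c t. t \<in> UNIV}"
  proof clarify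
    fix c t
    have "c *\<^sub>R velocity (L i) t = (c * norm (velocity (L i) t)) *\<^sub>R ?T t"
      using velocity_nonzero[OF circle[OF i], of t] by simp
    then show "\<exists>c' t'. c *\<^sub>R velocity (L i) t = c' *\<^sub>R ?T t' \<and> t' \<in> UNIV" by blast
  qed
  ultimately show ?thesis by (rule negligible_subset)
qed

end

section \<open>Directions of degenerate crossings\<close>

lemma det_matrix_columns:
  fixes A B C :: "real^3"
  shows "det (matrix (\<lambda>h :: real^3. (h $ 1) *\<^sub>R A + (h $ 2) *\<^sub>R B + (h $ 3) *\<^sub>R C)) = A \<bullet> (cross3 B C)"
  by (simp add: det_3 matrix_def axis_def cross3_simps inner_vec_def sum_3 vector_def algebra_simps)

lemma has_derivative_nth_within: "((\<lambda>x. x $ i) has_derivative (\<lambda>h. h $ i)) (at x within S)"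
  by (rule bounded_linear_imp_has_derivative bounded_linear_vec_nth)+

text \<open>The map taking (c, s, t) to c (\<alpha> s - \<beta> t) has Jacobian determinant -c^2
  times the triple product, so these are critical values and Sard's theorem applies.\<close>

lemma negligible_critical_values:
  assumes ci: "C1_embedded_circle \<alpha>" and cj: "C1_embedded_circle \<beta>"
  shows "negligible {c *\<^sub>R (\<alpha> s - \<beta> t) | c s t.
     (\<alpha> s - \<beta> t) \<bullet> (cross3 (velocity \<alpha> s) (velocity \<beta> t)) = 0}"
proof -
  define S where "S = {x :: real^3. (\<alpha> (x $ 2) - \<beta> (x $ 3)) \<bullet>
      (cross3 (velocity \<alpha> (x $ 2)) (velocity \<beta> (x $ 3))) = 0}"
  define f where "f x = (x $ 1) *\<^sub>R (\<alpha> (x $ 2) - \<beta> (x $ 3))" for x :: "real^3"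
  define f' where "f' x h = (h $ 1) *\<^sub>R (\<alpha> (x $ 2) - \<beta> (x $ 3)) + (h $ 2) *\<^sub>R ((x $ 1) *\<^sub>R velocity \<alpha> (x $ 2))
     + (h $ 3) *\<^sub>R (- (x $ 1) *\<^sub>R velocity \<beta> (x $ 3))" for x h :: "real^3"
  have "negligible (f ` S)"
  proof (rule baby_Sard[where f' = f'])
    fix x assume x: "x \<in> S"
    show "(f has_derivative f' x) (at x within S)"
      unfolding f_def f'_def
      by (rule derivative_eq_intros has_derivative_nth_within
            has_derivative_compose[OF has_derivative_nth_within circle_has_derivative[OF ci]]
            has_derivative_compose[OF has_derivative_nth_within circle_has_derivative[OF cj]] refl)+
         (simp add: fun_eq_iff algebra_simps)
    have "det (matrix (f' x)) = 0"
      using x unfolding f'_def det_matrix_columns by (simp add: S_def cross_mult_left cross_mult_right cross_minus_right)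
    then have "\<not> invertible (matrix (f' x))"
      using invertible_det_nz by blast
    then show "rank (matrix (f' x)) < CARD(3)"
      using invertible_left_inverse matrix_left_invertible_injective less_rank_noninjective by metis
  qed simp
  moreover have "{c *\<^sub>R (\<alpha> s - \<beta> t) | c s t. (\<alpha> s - \<beta> t) \<bullet> (cross3 (velocity \<alpha> s) (velocity \<beta> t)) = 0} \<subseteq> f ` S"
  proof clarify
    fix c s t assume "(\<alpha> s - \<beta> t) \<bullet> (cross3 (velocity \<alpha> s) (velocity \<beta> t)) = 0"
    then show "c *\<^sub>R (\<alpha> s - \<beta> t) \<in> f ` S"
      by (intro image_eqI[of _ _ "vector [c, s, t]"]) (auto simp: f_def S_def)
  qed
  ultimately show ?thesis by (rule negligible_subset)
qed

lemma circle_Lipschitz: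
  assumes "C1_embedded_circle \<alpha>"
  shows "\<exists>C>0. \<forall>s t. norm (\<alpha> s - \<alpha> t) \<le> C * \<bar>s - t\<bar>"
proof -
  obtain C where C: "C > 0" "\<And>t. norm (velocity \<alpha> t) \<le> C"
    using speed_upper_bound[OF assms] by blast
  have "norm (\<alpha> s - \<alpha> t) \<le> C * norm (s - t)" for s t
  proof (rule differentiable_bound[where S = UNIV and f' = "\<lambda>x h. h *\<^sub>R velocity \<alpha> x"])
    fix x :: real
    show "onorm (\<lambda>h. h *\<^sub>R velocity \<alpha> x) \<le> C"
      by (rule onorm_le) (use C(2)[of x] in \<open>simp add: mult.commute[of C] mult_left_mono\<close>)
  qed (auto intro: circle_has_derivative[OF assms])
  then show ?thesis using C(1) by auto
qed

text \<open>The three points lie on one line through \<beta> t, and the last condition makes the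
  projections of \<alpha> and \<gamma> along it transverse. This transversality is what lets t
  determine s and w nearby; directions where it fails are critical values already.\<close>

definition triple_params ::
    "(real \<Rightarrow> real^3) \<Rightarrow> (real \<Rightarrow> real^3) \<Rightarrow> (real \<Rightarrow> real^3) \<Rightarrow> (real \<times> real \<times> real) set" where
  "triple_params \<alpha> \<beta> \<gamma> = {(s, t, w). \<alpha> s \<noteq> \<beta> t \<and> \<gamma> w \<noteq> \<beta> t \<and> cross3 (\<alpha> s - \<beta> t) (\<gamma> w - \<beta> t) = 0 \<and>
     (\<alpha> s - \<beta> t) \<bullet> (cross3 (velocity \<alpha> s) (velocity \<gamma> w)) \<noteq> 0}"

text \<open>Near each of its points, \<open>triple_params\<close> is a Lipschitz graph over the middle parameter.\<close>

lemma triple_params_graph: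
  assumes "C1_embedded_circle \<alpha>" "C1_embedded_circle \<beta>" "C1_embedded_circle \<gamma>"
    and p: "p \<in> triple_params \<alpha> \<beta> \<gamma>"
  shows "\<exists>m::nat. m > 0 \<and> (\<forall>q\<in>triple_params \<alpha> \<beta> \<gamma>. norm (q - p) < 1 / m \<longrightarrow>
     norm (q - p) \<le> m * \<bar>fst (snd q) - fst (snd p)\<bar>)"
proof -
  obtain s t w where p_eq: "p = (s, t, w)" by (cases p)
  define X Y a b c where "X = \<alpha> s - \<beta> t" and "Y = \<gamma> w - \<beta> t" and "a = velocity \<alpha> s" and
    "b = velocity \<beta> t" and "c = velocity \<gamma> w"
  have nz: "X \<noteq> 0" "Y \<noteq> 0" "cross3 X Y = 0" "X \<bullet> (cross3 a c) \<noteq> 0"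
    using p by (auto simp: triple_params_def p_eq X_def Y_def a_def c_def)
  \<comment> \<open>Collinearity makes the second displacement a nonzero multiple of the first, so a
    single nonzero triple product controls both outer parameters.\<close>
  have "collinear {0, X, Y}" using nz(3) by (simp add: cross_eq_0)
  then obtain \<kappa> where \<kappa>: "Y = \<kappa> *\<^sub>R X" "\<kappa> \<noteq> 0"
    using nz by (auto simp: collinear_lemma)
  define G where "G q = cross3 (\<alpha> (fst q) - \<beta> (fst (snd q))) (\<gamma> (snd (snd q)) - \<beta> (fst (snd q)))"
    for q :: "real \<times> real \<times> real"
  define G' where "G' h = cross3 X (snd (snd h) *\<^sub>R c - fst (snd h) *\<^sub>R b) + cross3 (fst h *\<^sub>R a - fst (snd h) *\<^sub>R b) Y"
    for h :: "real \<times> real \<times> real"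
  have bb: "bounded_bilinear cross3"
    using bilinear_cross bilinear_conv_bounded_bilinear by blast
  have "(G has_derivative G') (at p)"
    unfolding G_def G'_def X_def Y_def a_def b_def c_def
    apply (rule bounded_bilinear.FDERIV[OF bb, THEN has_derivative_eq_rhs])
      apply (rule derivative_eq_intros has_derivative_compose[OF _ circle_has_derivative[OF assms(1)]]
         has_derivative_compose[OF _ circle_has_derivative[OF assms(2)]]
         has_derivative_compose[OF _ circle_has_derivative[OF assms(3)]] refl)+
    by (simp add: p_eq)
  define D where "D = \<bar>X \<bullet> cross3 a c\<bar>"
  define k where "k = min 1 \<bar>\<kappa>\<bar>"
  have D: "D > 0" "k > 0" using nz \<kappa> by (auto simp: D_def k_def)
  define M where "M = norm (cross3 X b) + norm (cross3 b Y)"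
  define N where "N = norm a + norm c + 1"
  have N: "N > 0" by (simp add: N_def add_nonneg_pos)
  text \<open>Pairing the derivative with \<open>a\<close> and \<open>c\<close> isolates the third and the first coordinate.\<close>
  have coord: "k * D * (\<bar>fst h\<bar> + \<bar>snd (snd h)\<bar>) \<le> N * norm (G' h) + N * M * \<bar>fst (snd h)\<bar>" for h
  proof -
    obtain ds dt dw where h: "h = (ds, dt, dw)" by (cases h)
    define E where "E = cross3 X b + cross3 b Y"
    have "norm E \<le> M" unfolding E_def M_def by (rule norm_triangle_ineq)
    have G': "G' h = dw *\<^sub>R cross3 X c + (ds * \<kappa>) *\<^sub>R cross3 a X - dt *\<^sub>R E"
      by (simp add: G'_def h E_def \<kappa> cross3_simps algebra_simps)
    have inn: "\<bar>(G' h + dt *\<^sub>R E) \<bullet> z\<bar> \<le> norm z * (norm (G' h) + M * \<bar>dt\<bar>)" for z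
    proof -
      have "\<bar>(G' h + dt *\<^sub>R E) \<bullet> z\<bar> \<le> norm (G' h + dt *\<^sub>R E) * norm z"
        by (rule Cauchy_Schwarz_ineq2)
      also have "\<dots> \<le> (norm (G' h) + \<bar>dt\<bar> * norm E) * norm z"
        by (intro mult_right_mono norm_triangle_le) auto
      also have "\<dots> \<le> (norm (G' h) + \<bar>dt\<bar> * M) * norm z"
        using \<open>norm E \<le> M\<close> by (intro mult_right_mono add_left_mono mult_left_mono) auto
      finally show ?thesis by (simp add: mult_ac)
    qed
    have "(G' h + dt *\<^sub>R E) \<bullet> a = - dw * (X \<bullet> cross3 a c)" "(G' h + dt *\<^sub>R E) \<bullet> c = - (ds * \<kappa>) * (X \<bullet> cross3 a c)"
      unfolding G' by (simp_all add: cross3_def inner_vec_def sum_3 algebra_simps)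
    then have "\<bar>dw\<bar> * D \<le> norm a * (norm (G' h) + M * \<bar>dt\<bar>)" "\<bar>ds\<bar> * \<bar>\<kappa>\<bar> * D \<le> norm c * (norm (G' h) + M * \<bar>dt\<bar>)"
      using inn[of a] inn[of c] by (simp_all add: abs_mult D_def)
    moreover have "k * D * \<bar>dw\<bar> \<le> \<bar>dw\<bar> * D" "k * D * \<bar>ds\<bar> \<le> \<bar>ds\<bar> * \<bar>\<kappa>\<bar> * D"
      using mult_right_mono[of k 1 "\<bar>dw\<bar> * D"] mult_right_mono[of k "\<bar>\<kappa>\<bar>" "\<bar>ds\<bar> * D"] D(1)
      by (simp_all add: k_def mult_ac)
    moreover have "0 \<le> norm (G' h) + M * \<bar>dt\<bar>" by (simp add: M_def)
    ultimately have "k * D * (\<bar>ds\<bar> + \<bar>dw\<bar>) \<le> N * (norm (G' h) + M * \<bar>dt\<bar>)"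
      by (simp add: N_def algebra_simps)
    then show ?thesis by (simp add: h algebra_simps)
  qed
  \<comment> \<open>With this choice \<open>N * (e * norm h)\<close> is half of
    \<open>k * D * norm h\<close>, which can be absorbed on the left.\<close>
  define e where "e = k * D / (2 * N)"
  have e: "e > 0" using D N by (simp add: e_def)
  then obtain d where d: "d > 0" "\<And>q. norm (q - p) < d \<Longrightarrow> norm (G q - G p - G' (q - p)) \<le> e * norm (q - p)"
    using \<open>(G has_derivative G') (at p)\<close> unfolding has_derivative_at_alt by blast
  define K where "K = 2 * (N * M / (k * D) + 1)"
  have main: "norm (q - p) \<le> K * \<bar>fst (snd q) - fst (snd p)\<bar>"
    if q: "q \<in> triple_params \<alpha> \<beta> \<gamma>" "norm (q - p) < d" for q
  proof -
    have "G q = 0" "G p = 0" using q p by (auto simp: G_def triple_params_def)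
    then have "norm (G' (q - p)) \<le> e * norm (q - p)" using d(2)[OF q(2)] by simp
    define h where "h = q - p"
    obtain ds dt dw where hh: "h = (ds, dt, dw)" by (cases h)
    have "norm h \<le> \<bar>ds\<bar> + \<bar>dt\<bar> + \<bar>dw\<bar>"
      using norm_Pair_le[of ds "(dt, dw)"] norm_Pair_le[of dt dw] by (simp add: hh)
    have "k * D * (\<bar>ds\<bar> + \<bar>dw\<bar>) \<le> N * norm (G' h) + N * M * \<bar>dt\<bar>"
      using coord[of h] by (simp add: hh)
    also have "N * norm (G' h) \<le> N * (e * norm h)"
      using \<open>norm (G' (q - p)) \<le> e * norm (q - p)\<close> N by (simp add: h_def)
    also have "N * (e * norm h) = k * D * (norm h / 2)"
      using N by (simp add: e_def)
    also have "k * D * (norm h / 2) + N * M * \<bar>dt\<bar> = k * D * (norm h / 2 + N * M / (k * D) * \<bar>dt\<bar>)"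
      using D by (simp add: field_simps)
    finally have "\<bar>ds\<bar> + \<bar>dw\<bar> \<le> norm h / 2 + N * M / (k * D) * \<bar>dt\<bar>"
      using D by simp
    with \<open>norm h \<le> \<bar>ds\<bar> + \<bar>dt\<bar> + \<bar>dw\<bar>\<close>
    have "norm h \<le> 2 * (N * M / (k * D) * \<bar>dt\<bar>) + 2 * \<bar>dt\<bar>" by linarith
    also have "\<dots> = K * \<bar>dt\<bar>" by (simp add: K_def algebra_simps)
    finally have "norm h \<le> K * \<bar>dt\<bar>" .
    moreover have "dt = fst (snd q) - fst (snd p)" using hh by (simp add: h_def prod_eq_iff)
    ultimately show ?thesis by (simp add: h_def)
  qed
  \<comment> \<open>A single natural number is both the Lipschitz constant and the inverse radius,
    so that countably many classes exhaust the set.\<close>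
  obtain m :: nat where m: "real m > max K (1 / d)" using reals_Archimedean2 by blast
  then have "m > 0" using d(1) by (metis divide_pos_pos gr0I less_asym' max_less_iff_conj of_nat_0 zero_less_one)
  moreover have "1 / m < d" using m d(1) \<open>m > 0\<close> by (simp add: field_simps)
  ultimately show ?thesis
  proof (intro exI[of _ m] conjI ballI impI)
    fix q assume "q \<in> triple_params \<alpha> \<beta> \<gamma>" "norm (q - p) < 1 / real m"
    then have "norm (q - p) \<le> K * \<bar>fst (snd q) - fst (snd p)\<bar>"
      using main[of q] \<open>1 / m < d\<close> by linarith
    also have "\<dots> \<le> m * \<bar>fst (snd q) - fst (snd p)\<bar>"
      using m by (intro mult_right_mono) auto
    finally show "norm (q - p) \<le> m * \<bar>fst (snd q) - fst (snd p)\<bar>" .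
  qed (use \<open>m > 0\<close> in simp)
qed

text \<open>Points sharing the constant m of the graph property are sorted into grid cells of
  diameter below 1/m. Within a cell the middle parameter determines the point in a Lipschitz way, so
  each cell yields a cone over a Lipschitz curve, and there are countably many cells.\<close>

lemma negligible_triple_cone:
  assumes ca: "C1_embedded_circle \<alpha>" and cb: "C1_embedded_circle \<beta>" and cc: "C1_embedded_circle \<gamma>"
  shows "negligible {c *\<^sub>R (\<alpha> s - \<beta> t) | c s t w. (s, t, w) \<in> triple_params \<alpha> \<beta> \<gamma>}"
proof -
  let ?P = "triple_params \<alpha> \<beta> \<gamma>"
  define good where "good m p \<longleftrightarrow> (\<forall>q\<in>?P. norm (q - p) < 1 / m \<longrightarrow>
     norm (q - p) \<le> m * \<bar>fst (snd q) - fst (snd p)\<bar>)" for m :: nat and p :: "real \<times> real \<times> real"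
  \<comment> \<open>Side 1/(4m), so that three coordinate differences add up to less than
    1/m.\<close>
  define cell where "cell m p = (\<lfloor>4 * real m * fst p\<rfloor>, \<lfloor>4 * real m * fst (snd p)\<rfloor>, \<lfloor>4 * real m * snd (snd p)\<rfloor>)"
    for m :: nat and p :: "real \<times> real \<times> real"
  define Q where "Q m z = {p \<in> ?P. m > 0 \<and> good m p \<and> cell m p = z}" for m z
  define cone where "cone A = {c *\<^sub>R (\<alpha> s - \<beta> t) | c s t w. (s, t, w) \<in> A}" for A :: "(real \<times> real \<times> real) set"
  have near: "norm (q - p) < 1 / m" if "p \<in> Q m z" "q \<in> Q m z" for p q m z
  proof -
    have m: "m > 0" using that by (auto simp: Q_def)
    have *: "\<bar>x - y\<bar> < 1 / (4 * m)" if "\<lfloor>4 * real m * x\<rfloor> = \<lfloor>4 * real m * y\<rfloor>" for x y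
    proof -
      have "\<bar>4 * real m * x - 4 * real m * y\<bar> < 1" using that by linarith
      then have "4 * real m * \<bar>x - y\<bar> < 1" by (simp add: abs_mult flip: right_diff_distrib)
      then show ?thesis using m by (simp add: field_simps)
    qed
    obtain a b c a' b' c' where pq: "p = (a, b, c)" "q = (a', b', c')" by (cases p, cases q)
    have "norm (q - p) \<le> \<bar>a' - a\<bar> + (\<bar>b' - b\<bar> + \<bar>c' - c\<bar>)"
      using norm_Pair_le[of "a' - a" "(b' - b, c' - c)"] norm_Pair_le[of "b' - b" "c' - c"] by (simp add: pq)
    also have "\<dots> < 1 / (4 * m) + (1 / (4 * m) + 1 / (4 * m))"
      using that by (intro add_strict_mono *) (auto simp: Q_def cell_def pq)
    also have "\<dots> \<le> 1 / m" using m by (simp add: field_simps)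
    finally show ?thesis .
  qed
  obtain C1 where C1: "C1 > 0" "\<And>s t. norm (\<alpha> s - \<alpha> t) \<le> C1 * \<bar>s - t\<bar>" using circle_Lipschitz[OF ca] by blast
  obtain C2 where C2: "C2 > 0" "\<And>s t. norm (\<beta> s - \<beta> t) \<le> C2 * \<bar>s - t\<bar>" using circle_Lipschitz[OF cb] by blast
  have "negligible (cone (Q m z))" for m z
  proof -
    define A where "A = (\<lambda>p. fst (snd p)) ` Q m z"
    define \<sigma> where "\<sigma> t = (SOME p. p \<in> Q m z \<and> fst (snd p) = t)" for t
    have \<sigma>: "\<sigma> t \<in> Q m z" "fst (snd (\<sigma> t)) = t" if "t \<in> A" for t
    proof -
      have "\<exists>p. p \<in> Q m z \<and> fst (snd p) = t" using that unfolding A_def by (metis imageE)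
      from someI_ex[OF this] show "\<sigma> t \<in> Q m z" "fst (snd (\<sigma> t)) = t" by (auto simp: \<sigma>_def)
    qed
    have lip: "norm (q - p) \<le> m * \<bar>fst (snd q) - fst (snd p)\<bar>" if "p \<in> Q m z" "q \<in> Q m z"
      for p q :: "real \<times> real \<times> real"
    proof -
      have "good m p" "q \<in> ?P" using that unfolding Q_def by blast+
      then show ?thesis using near[OF that] unfolding good_def by blast
    qed
    define g where "g t = \<alpha> (fst (\<sigma> t)) - \<beta> t" for t
    have "negligible {c *\<^sub>R g t | c t. t \<in> A}"
    proof (rule negligible_cone_Lipschitz)
      fix t assume t: "t \<in> A"
      have "norm (g s - g t) \<le> (C1 * m + C2) * \<bar>s - t\<bar>" if s: "s \<in> A" for s
      proof -
        have "\<bar>fst (\<sigma> s) - fst (\<sigma> t)\<bar> \<le> norm (\<sigma> s - \<sigma> t)"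
          by (metis fst_diff norm_fst_le prod.collapse real_norm_def)
        also have "\<dots> \<le> m * \<bar>s - t\<bar>"
          using lip[OF \<sigma>(1)[OF t] \<sigma>(1)[OF s]] \<sigma>(2)[OF t] \<sigma>(2)[OF s] by simp
        finally have "C1 * \<bar>fst (\<sigma> s) - fst (\<sigma> t)\<bar> \<le> C1 * (m * \<bar>s - t\<bar>)"
          using C1(1) by simp
        moreover have "g s - g t = (\<alpha> (fst (\<sigma> s)) - \<alpha> (fst (\<sigma> t))) - (\<beta> s - \<beta> t)"
          by (simp add: g_def)
        then have "norm (g s - g t) \<le> norm (\<alpha> (fst (\<sigma> s)) - \<alpha> (fst (\<sigma> t))) + norm (\<beta> s - \<beta> t)"
          by (metis norm_triangle_ineq4)
        ultimately show ?thesis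
          using C1(2)[of "fst (\<sigma> s)" "fst (\<sigma> t)"] C2(2)[of s t] by (simp add: algebra_simps)
      qed
      then show "\<exists>d>0. \<exists>B. \<forall>s\<in>A. \<bar>s - t\<bar> < d \<longrightarrow> norm (g s - g t) \<le> B * \<bar>s - t\<bar>"
        by (intro exI[of _ 1]) auto
    qed simp
    moreover have "cone (Q m z) \<subseteq> {c *\<^sub>R g t | c t. t \<in> A}"
    proof
      fix x assume "x \<in> cone (Q m z)"
      then obtain c s t w where x: "x = c *\<^sub>R (\<alpha> s - \<beta> t)" "(s, t, w) \<in> Q m z" by (auto simp: cone_def)
      have t: "t \<in> A" using x(2) by (force simp: A_def)
      \<comment> \<open>Two points of a cell with the same middle parameter coincide, so the choice
        \<sigma> misses none of them.\<close>
      have "norm (\<sigma> t - (s, t, w)) \<le> m * \<bar>t - t\<bar>"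
        using lip[OF x(2) \<sigma>(1)[OF t]] \<sigma>(2)[OF t] by simp
      then have "\<sigma> t = (s, t, w)" by simp
      then have "x = c *\<^sub>R g t" by (simp add: x g_def)
      then show "x \<in> {c *\<^sub>R g t | c t. t \<in> A}" using t by blast
    qed
    ultimately show ?thesis by (rule negligible_subset)
  qed
  then have "negligible (\<Union>i. cone (case_prod Q (from_nat i)))"
    by (intro negligible_Union_nat) (simp add: case_prod_beta)
  moreover have "{c *\<^sub>R (\<alpha> s - \<beta> t) | c s t w. (s, t, w) \<in> ?P} \<subseteq> (\<Union>i. cone (case_prod Q (from_nat i)))"
  proof
    fix x assume "x \<in> {c *\<^sub>R (\<alpha> s - \<beta> t) | c s t w. (s, t, w) \<in> ?P}"
    then obtain c s t w where x: "x = c *\<^sub>R (\<alpha> s - \<beta> t)" "(s, t, w) \<in> ?P" by auto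
    obtain m :: nat where "m > 0" "good m (s, t, w)"
      using triple_params_graph[OF ca cb cc x(2), folded good_def] by auto
    then have "x \<in> cone (Q m (cell m (s, t, w)))"
      using x unfolding cone_def Q_def by blast
    then have "x \<in> cone (case_prod Q (from_nat (to_nat (m, cell m (s, t, w)))))" by simp
    then show "x \<in> (\<Union>i. cone (case_prod Q (from_nat i)))" by blast
  qed
  ultimately show ?thesis by (rule negligible_subset)
qed

lemma plane_proj_diff: "plane_proj u (x - y) = plane_proj u x - plane_proj u y"
  by (simp add: plane_proj_def algebra_simps inner_diff_left)

lemma plane_proj_scaleR: "plane_proj u (c *\<^sub>R x) = c *\<^sub>R plane_proj u x"
  by (simp add: plane_proj_def algebra_simps)

lemma bounded_linear_plane_proj: "bounded_linear (plane_proj u)"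
  unfolding plane_proj_def[abs_def]
  by (intro bounded_linear_sub bounded_linear_ident bounded_linear_scaleR_const bounded_linear_inner_left)

lemma norm_plane_proj_le:
  assumes "norm u = 1"
  shows "norm (plane_proj u x) \<le> norm x"
proof -
  have uu: "u \<bullet> u = 1" using assms by (simp add: norm_eq_1)
  have "(norm (plane_proj u x))\<^sup>2 = (norm x)\<^sup>2 - (x \<bullet> u)\<^sup>2"
    unfolding power2_norm_eq_inner plane_proj_def
    by (simp add: inner_diff_left inner_diff_right uu inner_commute power2_eq_square)
  then have "(norm (plane_proj u x))\<^sup>2 \<le> (norm x)\<^sup>2" by simp
  then show ?thesis by (rule power2_le_imp_le) simp
qed

lemma plane_proj_eq_0D: "plane_proj u x = 0 \<Longrightarrow> x = (x \<bullet> u) *\<^sub>R u"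
  by (simp add: plane_proj_def)

text \<open>Removing multiples of u from a and b does not change their triple product with
  u.\<close>

lemma cross_plane_proj_eq_0:
  assumes "cross3 (plane_proj u a) (plane_proj u b) = 0"
  shows "u \<bullet> cross3 a b = 0"
proof -
  have "u \<bullet> cross3 a b = u \<bullet> cross3 (plane_proj u a) (plane_proj u b)"
    by (simp add: plane_proj_def cross3_simps inner_vec_def sum_3 algebra_simps)
  then show ?thesis using assms by simp
qed

lemma finite_no_limit_in_compact:
  assumes "compact K" "E \<subseteq> K" "\<And>p. p \<in> K \<Longrightarrow> \<exists>d>0. \<forall>q\<in>E. dist q p < d \<longrightarrow> q = p"
  shows "finite E"
proof (rule ccontr)
  assume "infinite E"
  then obtain p where p: "p \<in> K" "p islimpt E"
    using assms(1,2) by (auto simp: compact_eq_Bolzano_Weierstrass)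
  obtain d where "d > 0" "\<And>q. q \<in> E \<Longrightarrow> dist q p < d \<Longrightarrow> q = p" using assms(3)[OF p(1)] by blast
  then show False using p(2) by (auto simp: islimpt_approachable)
qed

section \<open>Regular diagrams away from the bad directions\<close>

context thick_link
begin

text \<open>Full cones instead of unit vectors, so that volume in space replaces surface measure on
  the sphere. The three families obstruct, in turn, immersion, transversality and the absence of
  triple points. Two parameters of the same point contribute only the zero vector.\<close>

definition bad_directions :: "(real^3) set" where
  "bad_directions = (\<Union>i\<in>{1..n}. {c *\<^sub>R velocity (L i) t | c t. True})
     \<union> (\<Union>i\<in>{1..n}. \<Union>j\<in>{1..n}. {c *\<^sub>R (L i s - L j t) | c s t.
           (L i s - L j t) \<bullet> (cross3 (velocity (L i) s) (velocity (L j) t)) = 0})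
     \<union> (\<Union>i\<in>{1..n}. \<Union>j\<in>{1..n}. \<Union>k\<in>{1..n}. {c *\<^sub>R (L i s - L j t) | c s t w.
           (s, t, w) \<in> triple_params (L i) (L j) (L k)})"

lemma negligible_bad_directions: "negligible bad_directions"
proof -
  have U: "negligible (\<Union>i\<in>{1..n}. A i)" if "\<And>i. i \<in> {1..n} \<Longrightarrow> negligible (A i)" for A :: "nat \<Rightarrow> (real^3) set"
    using that by (intro negligible_Union) auto
  show ?thesis
    unfolding bad_directions_def
    by (intro negligible_Un U negligible_tangent_cone negligible_critical_values negligible_triple_cone circle)
qed

lemma tangent_bad: "i \<in> {1..n} \<Longrightarrow> c *\<^sub>R velocity (L i) t \<in> bad_directions"
  unfolding bad_directions_def by (rule UnI1, rule UnI1, rule UN_I, assumption) blast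

lemma critical_bad:
  assumes "i \<in> {1..n}" "j \<in> {1..n}"
    "(L i s - L j t) \<bullet> cross3 (velocity (L i) s) (velocity (L j) t) = 0"
  shows "c *\<^sub>R (L i s - L j t) \<in> bad_directions"
  unfolding bad_directions_def
  by (rule UnI1, rule UnI2, rule UN_I[OF assms(1)], rule UN_I[OF assms(2)]) (use assms(3) in blast)

lemma triple_bad:
  assumes "i \<in> {1..n}" "j \<in> {1..n}" "k \<in> {1..n}" "(s, t, w) \<in> triple_params (L i) (L j) (L k)"
  shows "c *\<^sub>R (L i s - L j t) \<in> bad_directions"
  unfolding bad_directions_def
  by (rule UnI2, rule UN_I[OF assms(1)], rule UN_I[OF assms(2)], rule UN_I[OF assms(3)]) (use assms(4) in blast)

lemma bad_directions_scaleR: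
  assumes "u \<in> bad_directions"
  shows "c *\<^sub>R u \<in> bad_directions"
  using assms[unfolded bad_directions_def]
proof (elim UnE UN_E CollectE exE conjE)
qed (simp_all add: tangent_bad critical_bad triple_bad)

context
  fixes u :: "real^3"
  assumes u: "norm u = 1" "u \<notin> bad_directions"
begin

lemma proj_velocity_nonzero:
  assumes "i \<in> {1..n}"
  shows "plane_proj u (velocity (L i) t) \<noteq> 0"
proof
  let ?v = "velocity (L i) t"
  assume "plane_proj u ?v = 0"
  then have v: "?v = (?v \<bullet> u) *\<^sub>R u" by (rule plane_proj_eq_0D)
  then have "?v \<bullet> u \<noteq> 0" using velocity_nonzero[OF circle[OF assms], of t] by (metis scaleR_zero_left)
  then have "u = (1 / (?v \<bullet> u)) *\<^sub>R ?v" by (subst v) simp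
  then show False using u(2) tangent_bad[OF assms] by metis
qed

lemma proj_eq_obtain:
  assumes "plane_proj u x = plane_proj u y" "x \<noteq> y"
  obtains c where "c \<noteq> 0" "x - y = c *\<^sub>R u" "u = (1 / c) *\<^sub>R (x - y)"
proof -
  have xy: "x - y = ((x - y) \<bullet> u) *\<^sub>R u"
    using assms(1) by (intro plane_proj_eq_0D) (simp add: plane_proj_diff)
  then have c: "(x - y) \<bullet> u \<noteq> 0" using assms(2) by (metis eq_iff_diff_eq_0 scaleR_zero_left)
  have "u = (1 / ((x - y) \<bullet> u)) *\<^sub>R (x - y)" using c by (subst (2) xy) simp
  with c xy that show thesis by blast
qed

lemma transversal:
  assumes ij: "i \<in> {1..n}" "j \<in> {1..n}" and "L i s \<noteq> L j t" "plane_proj u (L i s) = plane_proj u (L j t)"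
  shows "u \<bullet> cross3 (velocity (L i) s) (velocity (L j) t) \<noteq> 0"
proof
  assume 0: "u \<bullet> cross3 (velocity (L i) s) (velocity (L j) t) = 0"
  obtain c where c: "c \<noteq> 0" "L i s - L j t = c *\<^sub>R u" "u = (1 / c) *\<^sub>R (L i s - L j t)"
    using proj_eq_obtain[OF assms(4,3)] .
  then have "(L i s - L j t) \<bullet> cross3 (velocity (L i) s) (velocity (L j) t) = 0" using 0 by simp
  then have "u \<in> bad_directions" using c(3) critical_bad[OF ij] by metis
  then show False using u(2) by blast
qed

lemma proj_velocities_not_collinear:
  assumes "i \<in> {1..n}" "j \<in> {1..n}" "L i s \<noteq> L j t" "plane_proj u (L i s) = plane_proj u (L j t)"
  shows "\<not> collinear {0, plane_proj u (velocity (L i) s), plane_proj u (velocity (L j) t)}"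
proof
  assume "collinear {0, plane_proj u (velocity (L i) s), plane_proj u (velocity (L j) t)}"
  then have "cross3 (plane_proj u (velocity (L i) s)) (plane_proj u (velocity (L j) t)) = 0"
    by (simp only: cross_eq_0)
  then show False
    using transversal[OF assms] cross_plane_proj_eq_0 by blast
qed

lemma no_triple_points:
  assumes ijk: "i \<in> {1..n}" "j \<in> {1..n}" "k \<in> {1..n}"
    and eq: "plane_proj u (L i s) = plane_proj u (L j t)" "plane_proj u (L j t) = plane_proj u (L k w)"
    and ne: "L i s \<noteq> L j t" "L j t \<noteq> L k w" "L i s \<noteq> L k w"
  shows False
proof -
  obtain c where c: "c \<noteq> 0" "L i s - L j t = c *\<^sub>R u" "u = (1 / c) *\<^sub>R (L i s - L j t)"
    using proj_eq_obtain[OF eq(1) ne(1)] .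
  obtain c' where c': "c' \<noteq> 0" "L k w - L j t = c' *\<^sub>R u"
    using proj_eq_obtain[OF eq(2)[symmetric] ne(2)[symmetric]] .
  \<comment> \<open>The crossing of the outer pair is transverse too, which supplies the last
    condition of \<open>triple_params\<close>.\<close>
  have "u \<bullet> cross3 (velocity (L i) s) (velocity (L k) w) \<noteq> 0"
    using eq ne by (intro transversal ijk) auto
  then have "(s, t, w) \<in> triple_params (L i) (L j) (L k)"
    using c(1,2) c' ne by (simp add: triple_params_def cross_mult_left cross_mult_right)
  then have "u \<in> bad_directions" using c(3) triple_bad[OF ijk] by metis
  then show False using u(2) by blast
qed

text \<open>Crossing parameters cannot accumulate in the closed square. Near two parameters of one
  and the same point the projection is injective, being an immersion; near a crossing the derivative
  of the difference of the projections is injective; elsewhere this difference is nonzero.\<close>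

lemma finite_crossing_params:
  assumes ij: "i \<in> {1..n}" "j \<in> {1..n}"
  shows "finite {(s, t). s \<in> {0..1} \<and> t \<in> {0..1} \<and> L i s \<noteq> L j t \<and> plane_proj u (L i s) = plane_proj u (L j t)}"
    (is "finite ?E")
proof (rule finite_no_limit_in_compact)
  show "compact ({0..1::real} \<times> {0..1::real})" by (intro compact_Times) auto
  show "?E \<subseteq> {0..1} \<times> {0..1}" by auto
  fix p :: "real \<times> real"
  obtain s t where p: "p = (s, t)" by (cases p)
  note ci = circle[OF ij(1)] and cj = circle[OF ij(2)]
  show "\<exists>d>0. \<forall>q\<in>?E. dist q p < d \<longrightarrow> q = p"
  proof (cases "L i s = L j t")
    case True
    then have "i = j" "frac s = frac t" using link_eq_iff[OF ij] by auto
    \<comment> \<open>Parameters of the same point may differ by a period, as at the corners (0, 1)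
      and (1, 0); the integer shift brings both to s.\<close>
    define k where "k = \<lfloor>s\<rfloor> - \<lfloor>t\<rfloor>"
    have st: "s = t + of_int k" using \<open>frac s = frac t\<close> by (simp add: frac_def k_def)
    let ?v = "velocity (L i) s"
    define e where "e = norm (plane_proj u ?v) / 2"
    have "norm (plane_proj u ?v) > 0" using proj_velocity_nonzero[OF ij(1)] by simp
    then have e: "0 < e" "e < norm (plane_proj u ?v)" by (simp_all add: e_def)
    obtain \<delta> where \<delta>: "\<delta> > 0" "\<And>a b. \<bar>a - s\<bar> < \<delta> \<Longrightarrow> \<bar>b - s\<bar> < \<delta> \<Longrightarrow>
        norm (L i b - L i a - (b - a) *\<^sub>R ?v) \<le> e * \<bar>b - a\<bar>"
      using circle_increment[OF ci e(1)] by blast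
    have False if q: "(a, b) \<in> ?E" "dist (a, b) p < \<delta>" for a b
    proof -
      let ?b = "b + of_int k"
      have "\<bar>a - s\<bar> < \<delta>" "\<bar>?b - s\<bar> < \<delta>"
        using q(2) dist_fst_le[of "(a, b)" p] dist_snd_le[of "(a, b)" p] by (auto simp: p st dist_real_def)
      then have "norm (L i ?b - L i a - (?b - a) *\<^sub>R ?v) \<le> e * \<bar>?b - a\<bar>" by (rule \<delta>(2))
      moreover have "L i ?b = L i b" by (rule circle_add_int[OF ci])
      moreover have "plane_proj u (L i b - L i a - (?b - a) *\<^sub>R ?v) = - ((?b - a) *\<^sub>R plane_proj u ?v)"
        using q(1) \<open>i = j\<close> by (simp add: plane_proj_diff plane_proj_scaleR)
      ultimately have "\<bar>?b - a\<bar> * norm (plane_proj u ?v) \<le> e * \<bar>?b - a\<bar>"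
        using norm_plane_proj_le[OF u(1), of "L i b - L i a - (?b - a) *\<^sub>R ?v"] by simp
      then have "\<bar>?b - a\<bar> * (norm (plane_proj u ?v) - e) \<le> 0" by (simp add: algebra_simps)
      then have "?b = a" using e(2) by (simp add: mult_le_0_iff)
      then have "L i a = L j b" using \<open>L i ?b = L i b\<close> \<open>i = j\<close> by simp
      then show False using q(1) by simp
    qed
    then show ?thesis using \<delta>(1) by (intro exI[of _ \<delta>]) auto
  next
    case False
    define F where "F q = plane_proj u (L i (fst q) - L j (snd q))" for q
    define F' where "F' h = plane_proj u (fst h *\<^sub>R velocity (L i) s - snd h *\<^sub>R velocity (L j) t)" for h
    have der: "(F has_derivative F') (at p)"
      unfolding F_def F'_def
      by (rule bounded_linear.has_derivative[OF bounded_linear_plane_proj] derivative_eq_intros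
           has_derivative_compose[OF _ circle_has_derivative[OF ci]]
           has_derivative_compose[OF _ circle_has_derivative[OF cj]] refl)+ (simp add: p)
    show ?thesis
    proof (cases "F p = 0")
      case True
      then have "plane_proj u (L i s) = plane_proj u (L j t)" by (simp add: F_def p plane_proj_diff)
      then have X: "cross3 (plane_proj u (velocity (L i) s)) (plane_proj u (velocity (L j) t)) \<noteq> 0"
        using proj_velocities_not_collinear[OF ij False] by (simp add: cross_eq_0)
      have "linear F'" using der by (rule has_derivative_linear)
      moreover have "h = 0" if "F' h = 0" for h
      proof -
        have h: "fst h *\<^sub>R plane_proj u (velocity (L i) s) = snd h *\<^sub>R plane_proj u (velocity (L j) t)"
          using that by (simp add: F'_def plane_proj_diff plane_proj_scaleR)
        have "snd h *\<^sub>R cross3 (plane_proj u (velocity (L i) s)) (plane_proj u (velocity (L j) t)) = 0"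
          by (metis h cross_mult_right cross_refl scaleR_zero_right)
        moreover have "fst h *\<^sub>R cross3 (plane_proj u (velocity (L i) s)) (plane_proj u (velocity (L j) t)) = 0"
          by (metis h cross_mult_left cross_refl scaleR_zero_right)
        ultimately show ?thesis using X by (simp add: prod_eq_iff)
      qed
      ultimately have "inj F'" by (metis linear_injective_0)
      then obtain B where B: "B > 0" "\<And>h. B * norm h \<le> norm (F' h)"
        using linear_inj_bounded_below_pos[OF \<open>linear F'\<close>] by blast
      obtain d where d: "d > 0" "\<And>q. norm (q - p) < d \<Longrightarrow> norm (F q - F p - F' (q - p)) \<le> B / 2 * norm (q - p)"
        using der B(1) unfolding has_derivative_at_alt by (meson half_gt_zero)
      have "q = p" if q: "q \<in> ?E" "dist q p < d" for q
      proof -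
        have "F q = 0" using q(1) by (auto simp: F_def plane_proj_diff)
        then have "norm (F' (q - p)) \<le> B / 2 * norm (q - p)"
          using d(2)[of q] q(2) True by (simp add: dist_norm)
        then have "B * norm (q - p) \<le> B / 2 * norm (q - p)" using B(2)[of "q - p"] by linarith
        then have "norm (q - p) \<le> 0" using B(1) by (simp add: mult_le_cancel_right)
        then show ?thesis by simp
      qed
      then show ?thesis using d(1) by blast
    next
      case False
      have "isCont F p" using der by (rule has_derivative_continuous)
      then have "eventually (\<lambda>q. F q \<noteq> 0) (at p)"
        using False by (simp add: isCont_def tendsto_imp_eventually_ne)
      then obtain d where "d > 0" "\<And>q. q \<noteq> p \<Longrightarrow> dist q p < d \<Longrightarrow> F q \<noteq> 0"
        by (auto simp: eventually_at)
      moreover have "F q = 0" if "q \<in> ?E" for q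
        using that by (auto simp: F_def plane_proj_diff)
      ultimately show ?thesis by blast
    qed
  qed
qed

lemma regular_diagram_good_direction: "regular_diagram n L u"
proof -
  define X where "X = (\<Union>i\<in>{1..n}. range (L i))"
  define E where "E i j = {(s, t). s \<in> {0..1} \<and> t \<in> {0..1} \<and> L i s \<noteq> L j t \<and> plane_proj u (L i s) = plane_proj u (L j t)}" for i j
  have "{q. \<exists>x\<in>X. \<exists>y\<in>X. x \<noteq> y \<and> plane_proj u x = q \<and> plane_proj u y = q}
      \<subseteq> (\<Union>i\<in>{1..n}. \<Union>j\<in>{1..n}. (\<lambda>(s, t). plane_proj u (L i s)) ` E i j)"
  proof clarify
    fix q x y assume xy: "x \<in> X" "y \<in> X" "x \<noteq> y" "plane_proj u y = plane_proj u x"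
    obtain i j where ij: "i \<in> {1..n}" "j \<in> {1..n}" "x \<in> range (L i)" "y \<in> range (L j)"
      using xy(1,2) by (auto simp: X_def)
    then obtain s t where "x = L i s" "s \<in> {0..1}" "y = L j t" "t \<in> {0..1}"
      using range_circle_closed[OF circle[OF ij(1)]] range_circle_closed[OF circle[OF ij(2)]] by auto
    then have "plane_proj u x \<in> (\<lambda>(s, t). plane_proj u (L i s)) ` E i j"
      using xy by (intro image_eqI[of _ _ "(s, t)"]) (auto simp: E_def)
    then show "plane_proj u x \<in> (\<Union>i\<in>{1..n}. \<Union>j\<in>{1..n}. (\<lambda>(s, t). plane_proj u (L i s)) ` E i j)"
      using ij by blast
  qed
  moreover have "finite (\<Union>i\<in>{1..n}. \<Union>j\<in>{1..n}. (\<lambda>(s, t). plane_proj u (L i s)) ` E i j)"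
    unfolding E_def by (intro finite_UN_I finite_imageI finite_crossing_params) auto
  ultimately have fin: "finite {q. \<exists>x\<in>X. \<exists>y\<in>X. x \<noteq> y \<and> plane_proj u x = q \<and> plane_proj u y = q}"
    by (rule finite_subset)
  have tri: "\<forall>x\<in>X. \<forall>y\<in>X. \<forall>z\<in>X. plane_proj u x = plane_proj u y \<and> plane_proj u y = plane_proj u z \<longrightarrow> x = y \<or> y = z \<or> x = z"
    unfolding X_def using no_triple_points by blast
  show ?thesis
    unfolding regular_diagram_def Let_def
    using u(1) fin tri proj_velocity_nonzero proj_velocities_not_collinear by (simp add: X_def)
qed

end

end

section \<open>Volume of the tube\<close>

context thick_link
begin

text \<open>The wedge W between the normal planes at consecutive parameters s and t is swept by
  normal discs: for z in W the inner product of \<open>z - L i u\<close> with the velocity at u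
  changes sign between s and t, so z lies in a normal plane in between. The volume of W is nearly
  \<pi> r^2 times the length of the piece.\<close>

lemma tube_piece:
  assumes i: "i \<in> {1..n}" and \<theta>: "0 < \<theta>" "\<theta> < 1"
  shows "\<forall>\<^sub>F m in sequentially. \<forall>a<m. \<exists>W. W \<in> lmeasurable \<and> W \<subseteq> ball (L i (a / m)) r \<and>
     W \<subseteq> (\<Union>t\<in>{real a / m..<(real a + 1) / m}. normal_disc r (L i) t) \<and>
     \<theta> * (pi * r\<^sup>2) * (norm (velocity (L i) (a / m)) / m) \<le> measure lebesgue W"
proof -
  note ci = circle[OF i]
  let ?v = "velocity (L i)"
  \<comment> \<open>The losses add up to 3 \<eta>: the section area keeps the factor (1 - \<eta>)^2
    - \<eta>^2 = 1 - 2 \<eta>, the height keeps 1 - \<eta>, and the product is at least 1 - 3 \<eta>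
    = \<theta>.\<close>
  define \<eta> where "\<eta> = (1 - \<theta>) / 3"
  have "\<theta> = 1 - 3 * \<eta>" by (simp add: \<eta>_def field_simps)
  also have "\<dots> \<le> (1 - 2 * \<eta>) * (1 - \<eta>)" by (simp add: algebra_simps)
  finally have \<eta>: "0 < \<eta>" "\<eta> < 1 / 3" "\<theta> \<le> (1 - 2 * \<eta>) * (1 - \<eta>)"
    using \<theta> by (auto simp: \<eta>_def)
  obtain c where c: "c > 0" "\<And>t. c \<le> norm (?v t)" using speed_lower_bound[OF ci] by blast
  obtain C where C: "C > 0" "\<And>s t. norm (L i s - L i t) \<le> C * \<bar>s - t\<bar>" using circle_Lipschitz[OF ci] by blast
  define \<epsilon> where "\<epsilon> = \<eta> * c / 2"
  have \<epsilon>: "\<epsilon> > 0" using \<eta> c by (simp add: \<epsilon>_def)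
  obtain d1 where d1: "d1 > 0" "\<And>s t u. \<bar>s - u\<bar> < d1 \<Longrightarrow> \<bar>t - u\<bar> < d1 \<Longrightarrow>
      norm (L i t - L i s - (t - s) *\<^sub>R ?v u) \<le> \<epsilon> * \<bar>t - s\<bar>" using circle_increment[OF ci \<epsilon>] by blast
  obtain d2 where d2: "d2 > 0" "\<And>s t. \<bar>s - t\<bar> < d2 \<Longrightarrow> norm (?v s - ?v t) < \<epsilon>"
    using velocity_uniform[OF ci \<epsilon>] by blast
  define d where "d = min (min d1 d2) (\<eta> * r / C)"
  have "d > 0" using d1 d2 \<eta> r_pos C by (simp add: d_def)
  then have "\<forall>\<^sub>F m in sequentially. 1 / real m < d"
    using order_tendstoD(2)[OF lim_1_over_n] by blast
  then show ?thesis
    using eventually_gt_at_top[of 0]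
  proof eventually_elim
    case (elim m)
    show ?case
    proof (intro allI impI)
      fix a assume "a < m"
      define s t where "s = real a / m" and "t = (real a + 1) / m"
      have st: "t - s = 1 / m" "s < t" using elim by (auto simp: s_def t_def field_simps)
      then have near: "t - s < d1" "t - s < d2" "C * (t - s) \<le> \<eta> * r"
      proof -
        have "t - s < d" using elim st(1) by simp
        then show "t - s < d1" "t - s < d2" by (simp_all add: d_def)
        have "t - s < \<eta> * r / C" using \<open>t - s < d\<close> by (simp add: d_def)
        then show "C * (t - s) \<le> \<eta> * r"
          using C(1) by (simp add: pos_less_divide_eq mult.commute)
      qed
      \<comment> \<open>The smaller radius \<sigma> leaves a margin of \<eta> r for moving the
        centre of the disc from \<open>p\<close> to a nearby point of the curve.\<close>
      define p S h \<sigma> where "p = L i s" and "S = ?v t /\<^sub>R norm (?v t)" and "h = (L i t - p) \<bullet> S" and "\<sigma> = (1 - \<eta>) * r"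
      have vS: "?v t = norm (?v t) *\<^sub>R S" "norm S = 1" using velocity_nonzero[OF ci, of t] by (auto simp: S_def)
      have vt: "norm (?v t) \<ge> norm (?v s) - \<epsilon>"
        using d2(2)[of s t] near st norm_triangle_ineq2[of "?v s" "?v t"] by auto
      have "\<bar>(L i t - p - (t - s) *\<^sub>R ?v t) \<bullet> S\<bar> \<le> \<epsilon> * (t - s)"
        using d1(2)[of s t t] near st d1(1) Cauchy_Schwarz_ineq2[of "L i t - p - (t - s) *\<^sub>R ?v t" S]
        by (simp add: p_def vS(2))
      moreover have "?v t \<bullet> S = norm (?v t)"
        using vS by (metis inner_scaleR_left mult.right_neutral norm_eq_1)
      ultimately have "h \<ge> (t - s) * norm (?v t) - \<epsilon> * (t - s)"
        by (simp add: h_def inner_diff_left[of "L i t - p"])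
      moreover have "(t - s) * norm (?v t) \<ge> (t - s) * (norm (?v s) - \<epsilon>)"
        using vt st by (intro mult_left_mono) auto
      ultimately have "h \<ge> (t - s) * (norm (?v s) - 2 * \<epsilon>)" by (simp add: algebra_simps)
      moreover have "norm (?v s) - 2 * \<epsilon> \<ge> (1 - \<eta>) * norm (?v s)"
        using c(2)[of s] \<eta> by (simp add: \<epsilon>_def algebra_simps)
      then have "(t - s) * (norm (?v s) - 2 * \<epsilon>) \<ge> (t - s) * ((1 - \<eta>) * norm (?v s))"
        using st by (intro mult_left_mono) auto
      ultimately have h1: "h \<ge> (1 - \<eta>) * (norm (?v s) / m)"
        using st by (simp add: mult_ac)
      moreover have "0 \<le> (1 - \<eta>) * (norm (?v s) / m)" using \<eta> by simp
      ultimately have h0: "h \<ge> 0" by linarith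
      have "h \<le> norm (L i t - p)"
        using Cauchy_Schwarz_ineq2[of "L i t - p" S] by (simp add: h_def vS(2))
      also have "\<dots> \<le> C * (t - s)" using C(2)[of t s] st by (simp add: p_def)
      finally have h2: "h \<le> \<eta> * r" using near by simp
      also have "\<dots> \<le> \<sigma>" using \<eta> r_pos by (simp add: \<sigma>_def)
      finally have h3: "h \<le> \<sigma>" .
      have \<sigma>: "0 < \<sigma>" using \<eta> r_pos by (simp add: \<sigma>_def)
      define W where "W = {z \<in> ball p \<sigma>. 0 \<le> (z - p) \<bullet> ?v s \<and> (z - p) \<bullet> S < h}"
      have "W \<subseteq> (\<Union>u\<in>{s..<t}. normal_disc r (L i) u)"
      proof
        fix z assume z: "z \<in> W"
        define \<phi> where "\<phi> u = (z - L i u) \<bullet> ?v u" for u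
        have "\<phi> s \<ge> 0" using z by (simp add: W_def \<phi>_def p_def)
        have "\<phi> t = norm (?v t) * ((z - p) \<bullet> S - h)"
        proof -
          have "\<phi> t = norm (?v t) * ((z - L i t) \<bullet> S)"
            unfolding \<phi>_def by (metis inner_scaleR_right vS(1))
          then show ?thesis by (simp add: h_def inner_diff_left)
        qed
        then have "\<phi> t < 0" using z velocity_nonzero[OF ci, of t] by (simp add: W_def mult_less_0_iff)
        have "continuous_on {s..t} \<phi>"
          unfolding \<phi>_def by (intro continuous_intros continuous_on_velocity[OF ci] circle_continuous_on[OF ci])
        then obtain u where u: "s \<le> u" "u \<le> t" "\<phi> u = 0"
          using IVT2'[of \<phi> t 0 s] \<open>\<phi> s \<ge> 0\<close> \<open>\<phi> t < 0\<close> st by auto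
        then have "u < t" using \<open>\<phi> t < 0\<close> by (cases "u = t") auto
        have "norm (z - L i u) \<le> norm (z - p) + norm (p - L i u)"
          using norm_triangle_ineq[of "z - p" "p - L i u"] by simp
        also have "norm (z - p) < \<sigma>" using z by (simp add: W_def dist_norm norm_minus_commute)
        also have "norm (p - L i u) \<le> C * \<bar>s - u\<bar>" unfolding p_def by (rule C(2))
        also have "C * \<bar>s - u\<bar> \<le> C * (t - s)" using u C(1) by simp
        finally have "norm (z - L i u) < r" using near(3) by (simp add: \<sigma>_def algebra_simps)
        then show "z \<in> (\<Union>u\<in>{s..<t}. normal_disc r (L i) u)"
          using u \<open>u < t\<close> by (auto simp: normal_disc_def \<phi>_def)
      qed
      moreover have "\<sigma> \<le> r" using \<eta> r_pos by (simp add: \<sigma>_def algebra_simps)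
      then have "W \<subseteq> ball p r" by (auto simp: W_def)
      moreover have "\<theta> * (pi * r\<^sup>2) * (norm (?v s) / m) \<le> measure lebesgue W"
      proof -
        have "h\<^sup>2 \<le> (\<eta> * r)\<^sup>2" using h0 h2 by (intro power_mono) auto
        then have "(1 - 2 * \<eta>) * r\<^sup>2 \<le> \<sigma>\<^sup>2 - h\<^sup>2"
          by (simp add: \<sigma>_def power2_eq_square algebra_simps)
        moreover have "h\<^sup>2 \<le> \<sigma>\<^sup>2" using h0 h3 by (intro power_mono) auto
        ultimately have "pi * ((1 - 2 * \<eta>) * r\<^sup>2) * ((1 - \<eta>) * (norm (?v s) / m)) \<le> pi * (\<sigma>\<^sup>2 - h\<^sup>2) * h"
          using \<eta> h1 h0 by (intro mult_mono) auto
        also have "\<dots> \<le> measure lebesgue W"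
          unfolding W_def using vS(2) velocity_nonzero[OF ci] h0 h3 \<sigma> by (intro measure_wedge_ge(1)) auto
        finally have "(1 - 2 * \<eta>) * (1 - \<eta>) * (pi * r\<^sup>2 * (norm (?v s) / m)) \<le> measure lebesgue W"
          by (simp add: mult_ac)
        moreover have "\<theta> * (pi * r\<^sup>2 * (norm (?v s) / m)) \<le> (1 - 2 * \<eta>) * (1 - \<eta>) * (pi * r\<^sup>2 * (norm (?v s) / m))"
          using \<eta>(3) by (rule mult_right_mono) simp
        ultimately show ?thesis by (simp add: mult_ac)
      qed
      moreover have "W \<in> lmeasurable"
        unfolding W_def using vS(2) velocity_nonzero[OF ci] h0 h3 \<sigma> by (intro measure_wedge_ge(2)) auto
      ultimately show "\<exists>W. W \<in> lmeasurable \<and> W \<subseteq> ball (L i (a / m)) r \<and>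
         W \<subseteq> (\<Union>t\<in>{real a / m..<(real a + 1) / m}. normal_disc r (L i) t) \<and>
         \<theta> * (pi * r\<^sup>2) * (norm (?v (a / m)) / m) \<le> measure lebesgue W"
        unfolding s_def t_def p_def by - (rule exI[of _ W], intro conjI, assumption+)
    qed
  qed
qed

definition sample :: "nat \<Rightarrow> nat \<times> nat \<Rightarrow> real^3" where
  "sample m p = L (fst p) (real (snd p) / m)"

definition weight :: "nat \<Rightarrow> nat \<times> nat \<Rightarrow> real" where
  "weight m p = norm (velocity (L (fst p)) (real (snd p) / m)) / m"

text \<open>The wedges are pairwise disjoint because the normal discs are, and those of samples
  within \<rho> of x fit into the ball of radius \<rho> + r; \<pi> cancels. How large m must be
  depends neither on x nor on \<rho>.\<close>

lemma sampled_volume_bound: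
  assumes \<theta>: "0 < \<theta>" "\<theta> < 1"
  shows "\<forall>\<^sub>F m in sequentially. \<forall>x \<rho>. 0 \<le> \<rho> \<longrightarrow>
     \<theta> * r\<^sup>2 * (\<Sum>p\<in>{p \<in> {1..n} \<times> {..<m}. norm (sample m p - x) \<le> \<rho>}. weight m p) \<le> 4 / 3 * (\<rho> + r) ^ 3"
proof -
  have "\<forall>\<^sub>F m in sequentially. \<forall>i\<in>{1..n}. \<forall>a<m. \<exists>W. W \<in> lmeasurable \<and> W \<subseteq> ball (L i (a / m)) r \<and>
     W \<subseteq> (\<Union>t\<in>{real a / m..<(real a + 1) / m}. normal_disc r (L i) t) \<and>
     \<theta> * (pi * r\<^sup>2) * (norm (velocity (L i) (a / m)) / m) \<le> measure lebesgue W"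
    using tube_piece[OF _ \<theta>] by (intro eventually_ball_finite) auto
  then show ?thesis
    using eventually_gt_at_top[of 0]
  proof eventually_elim
    case (elim m)
    then have m: "m > 0" by simp
    have "\<forall>p\<in>{1..n} \<times> {..<m}. \<exists>W. W \<in> lmeasurable \<and> W \<subseteq> ball (sample m p) r \<and>
       W \<subseteq> (\<Union>t\<in>{real (snd p) / m..<(real (snd p) + 1) / m}. normal_disc r (L (fst p)) t) \<and>
       \<theta> * (pi * r\<^sup>2) * weight m p \<le> measure lebesgue W"
    proof
      fix p assume p: "p \<in> {1..n} \<times> {..<m}"
      then have "fst p \<in> {1..n}" "snd p < m" by auto
      from elim(1)[rule_format, OF this]
      show "\<exists>W. W \<in> lmeasurable \<and> W \<subseteq> ball (sample m p) r \<and>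
         W \<subseteq> (\<Union>t\<in>{real (snd p) / m..<(real (snd p) + 1) / m}. normal_disc r (L (fst p)) t) \<and>
         \<theta> * (pi * r\<^sup>2) * weight m p \<le> measure lebesgue W"
        by (simp add: sample_def weight_def add.commute)
    qed
    from bchoice[OF this] obtain W where
      WW: "\<forall>p\<in>{1..n} \<times> {..<m}. W p \<in> lmeasurable \<and> W p \<subseteq> ball (sample m p) r \<and>
       W p \<subseteq> (\<Union>t\<in>{real (snd p) / m..<(real (snd p) + 1) / m}. normal_disc r (L (fst p)) t) \<and>
       \<theta> * (pi * r\<^sup>2) * weight m p \<le> measure lebesgue (W p)" by blast
    note W = bspec[OF WW, THEN conjunct1] bspec[OF WW, THEN conjunct2, THEN conjunct1]
      bspec[OF WW, THEN conjunct2, THEN conjunct2, THEN conjunct1]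
      bspec[OF WW, THEN conjunct2, THEN conjunct2, THEN conjunct2]
    have disj: "disjoint_family_on W ({1..n} \<times> {..<m})"
      unfolding disjoint_family_on_def
    proof (intro ballI impI, rule ccontr)
      fix p q assume pq: "p \<in> {1..n} \<times> {..<m}" "q \<in> {1..n} \<times> {..<m}" "p \<noteq> q" "W p \<inter> W q \<noteq> {}"
      from pq(4) obtain z where z: "z \<in> W p" "z \<in> W q" by blast
      obtain s where s: "s \<in> {real (snd p) / m..<(real (snd p) + 1) / m}" "z \<in> normal_disc r (L (fst p)) s"
        using subsetD[OF W(3)[OF pq(1)] z(1)] by (elim UN_E)
      obtain t where t: "t \<in> {real (snd q) / m..<(real (snd q) + 1) / m}" "z \<in> normal_disc r (L (fst q)) t"
        using subsetD[OF W(3)[OF pq(2)] z(2)] by (elim UN_E)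
      \<comment> \<open>Half-open cells inside the unit interval: a parameter is its own fractional
        part and determines its cell.\<close>
      have *: "frac x = x \<and> nat \<lfloor>m * x\<rfloor> = b" if "x \<in> {real b / m..<(real b + 1) / m}" "b < m" for x :: real and b :: nat
      proof -
        have "real b \<le> m * x" "m * x < real b + 1" using that m by (auto simp: field_simps)
        moreover have "0 \<le> x" using that m by (auto intro: order_trans[of 0 "real b / m"])
        moreover have "x < 1"
        proof -
          have "(real b + 1) / m \<le> 1" using that m by (simp add: field_simps)
          moreover have "x < (real b + 1) / m" using that(1) by (simp add: add.commute)
          ultimately show ?thesis by linarith
        qed
        moreover from calculation have "\<lfloor>m * x\<rfloor> = int b" by (intro floor_unique) auto
        ultimately show ?thesis by (simp add: frac_eq)
      qed
      have "fst p = fst q \<and> frac s = frac t"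
        using pq by (intro normal_disc_disjoint[OF _ _ s(2) t(2)]) auto
      moreover have "frac s = s \<and> nat \<lfloor>m * s\<rfloor> = snd p" "frac t = t \<and> nat \<lfloor>m * t\<rfloor> = snd q"
        using pq s(1) t(1) by (auto intro!: * simp del: atLeastLessThan_iff)
      ultimately have "p = q" by (metis prod_eqI)
      then show False using pq by simp
    qed
    show ?case
    proof (intro allI impI)
      fix x and \<rho> :: real assume \<rho>: "0 \<le> \<rho>"
      define F where "F = {p \<in> {1..n} \<times> {..<m}. norm (sample m p - x) \<le> \<rho>}"
      have F: "F \<subseteq> {1..n} \<times> {..<m}" "finite F" by (auto simp: F_def)
      have "\<theta> * (pi * r\<^sup>2) * (\<Sum>p\<in>F. weight m p) = (\<Sum>p\<in>F. \<theta> * (pi * r\<^sup>2) * weight m p)"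
        by (rule sum_distrib_left)
      also have "\<dots> \<le> (\<Sum>p\<in>F. measure lebesgue (W p))"
        using F by (intro sum_mono W) auto
      also have "\<dots> = measure lebesgue (\<Union>p\<in>F. W p)"
      proof (rule measure_finite_Union[symmetric])
        show "disjoint_family_on W F" using disj F(1) by (rule disjoint_family_on_mono[rotated])
        show "W ` F \<subseteq> sets lebesgue" using W(1) F(1) by (auto simp: fmeasurableD)
        show "emeasure lebesgue (W p) \<noteq> \<infinity>" if "p \<in> F" for p
          using W(1)[of p] F(1) that by (auto simp: fmeasurable_def)
      qed (rule F)
      also have "\<dots> \<le> measure lebesgue (ball x (\<rho> + r))"
      proof (rule measure_mono_fmeasurable)
        show "(\<Union>p\<in>F. W p) \<subseteq> ball x (\<rho> + r)"
        proof clarify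
          fix z i a assume "(i, a) \<in> F" "z \<in> W (i, a)"
          then have "dist (sample m (i, a)) z < r" "dist x (sample m (i, a)) \<le> \<rho>"
            using W(2)[of "(i, a)"] F(1) by (auto simp: F_def dist_norm norm_minus_commute)
          then show "z \<in> ball x (\<rho> + r)"
            using dist_triangle[of x z "sample m (i, a)"] by simp
        qed
        show "(\<Union>p\<in>F. W p) \<in> sets lebesgue" using W(1) F by (intro sets.finite_UN) (auto simp: fmeasurableD)
      qed simp
      also have "measure lebesgue (ball x (\<rho> + r)) = 4 / 3 * pi * (\<rho> + r) ^ 3"
        using \<rho> r_pos content_ball[of "\<rho> + r" x] by (simp add: unit_ball_vol_numeral fact_numeral)
      finally have "pi * (\<theta> * r\<^sup>2 * (\<Sum>p\<in>F. weight m p)) \<le> pi * (4 / 3 * (\<rho> + r) ^ 3)" by (simp add: mult_ac)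
      then show "\<theta> * r\<^sup>2 * (\<Sum>p\<in>{p \<in> {1..n} \<times> {..<m}. norm (sample m p - x) \<le> \<rho>}. weight m p) \<le> 4 / 3 * (\<rho> + r) ^ 3"
        unfolding F_def[symmetric] by (rule mult_left_le_imp_le) simp
    qed
  qed
qed

end

section \<open>Counting crossings\<close>

text \<open>\<open>shell_map\<close> sweeps out directions; the cube root makes its Jacobian independent of the
  radial parameter.\<close>

definition shell_map :: "(real \<Rightarrow> real^3) \<Rightarrow> (real \<Rightarrow> real^3) \<Rightarrow> real^3 \<Rightarrow> real^3" where
  "shell_map \<alpha> \<beta> x = root 3 (x $ 1) *\<^sub>R sgn (\<alpha> (x $ 2) - \<beta> (x $ 3))"

lemma abs_triple_product_le: "\<bar>A \<bullet> cross3 B C\<bar> \<le> norm A * (norm B * norm C)"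
proof -
  have "(norm (cross3 B C))\<^sup>2 \<le> (norm B * norm C)\<^sup>2"
    using norm_cross_dot[of B C] by (metis le_add_same_cancel1 zero_le_power2)
  then have "norm (cross3 B C) \<le> norm B * norm C" by (rule power2_le_imp_le) simp
  then have "norm A * norm (cross3 B C) \<le> norm A * (norm B * norm C)" by (rule mult_left_mono) simp
  then show ?thesis using Cauchy_Schwarz_ineq2[of A "cross3 B C"] by linarith
qed

text \<open>A, B and C are the partial derivatives. Their lengths multiply to at most
  \<open>M / 3\<close>, as the two factors \<rho> from B and C cancel the inverse square in A.
  Bounding the triple product by the product of lengths discards all angles between chord and
  tangents.\<close>

lemma measure_shell_map_box:
  fixes \<alpha> \<beta> :: "real \<Rightarrow> real^3"
  assumes ca: "C1_embedded_circle \<alpha>" and cb: "C1_embedded_circle \<beta>" and ne: "\<And>s t. \<alpha> s \<noteq> \<beta> t"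
    and le: "s0 \<le> s1" "t0 \<le> t1"
    and M: "\<And>s t. s \<in> {s0..s1} \<Longrightarrow> t \<in> {t0..t1} \<Longrightarrow>
      norm (velocity \<alpha> s) * norm (velocity \<beta> t) / (norm (\<alpha> s - \<beta> t))\<^sup>2 \<le> M"
  defines "S \<equiv> cbox (vector [1, s0, t0]) (vector [2, s1, t1]) :: (real^3) set"
  shows "shell_map \<alpha> \<beta> ` S \<in> lmeasurable"
    and "measure lebesgue (shell_map \<alpha> \<beta> ` S) \<le> M / 3 * ((s1 - s0) * (t1 - t0))"
proof -
  define z where "z x = \<alpha> (x $ 2) - \<beta> (x $ 3)" for x :: "real^3"
  define \<rho> where "\<rho> x = root 3 (x $ 1)" for x :: "real^3"
  define A where "A x = (1 / (3 * (\<rho> x)\<^sup>2)) *\<^sub>R sgn (z x)" for x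
  define B where "B x = (\<rho> x / norm (z x)) *\<^sub>R plane_proj (sgn (z x)) (velocity \<alpha> (x $ 2))" for x
  define C where "C x = (- \<rho> x / norm (z x)) *\<^sub>R plane_proj (sgn (z x)) (velocity \<beta> (x $ 3))" for x
  define f' where "f' x h = (h $ 1) *\<^sub>R A x + (h $ 2) *\<^sub>R B x + (h $ 3) *\<^sub>R C x" for x h :: "real^3"
  have z0: "z x \<noteq> 0" for x using ne by (simp add: z_def)
  have S: "x $ 1 \<ge> 1" "x $ 2 \<in> {s0..s1}" "x $ 3 \<in> {t0..t1}" if "x \<in> S" for x
    using that by (auto simp: S_def mem_box_cart forall_3)
  have \<rho>: "\<rho> x > 0" if "x \<in> S" for x using S(1)[OF that] by (simp add: \<rho>_def)
  have der: "(shell_map \<alpha> \<beta> has_derivative f' x) (at x within S)" if x: "x \<in> S" for x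
  proof -
    have "(\<rho> has_derivative (\<lambda>h. 1 / (3 * (\<rho> x)\<^sup>2) * h $ 1)) (at x within S)"
    proof -
      have "(root 3 has_real_derivative 1 / (3 * (\<rho> x)\<^sup>2)) (at (x $ 1))"
        using DERIV_real_root[of 3 "x $ 1"] S(1)[OF x] by (simp add: \<rho>_def inverse_eq_divide)
      then have "(root 3 has_derivative (\<lambda>h. 1 / (3 * (\<rho> x)\<^sup>2) * h)) (at (x $ 1))"
        unfolding has_field_derivative_def .
      from has_derivative_compose[OF has_derivative_nth_within this] show ?thesis
        by (simp add: \<rho>_def[abs_def])
    qed
    moreover have zd: "(z has_derivative (\<lambda>h. h $ 2 *\<^sub>R velocity \<alpha> (x $ 2) - h $ 3 *\<^sub>R velocity \<beta> (x $ 3))) (at x within S)"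
      unfolding z_def
      by (intro has_derivative_diff has_derivative_compose[OF has_derivative_nth_within circle_has_derivative[OF ca]]
            has_derivative_compose[OF has_derivative_nth_within circle_has_derivative[OF cb]])
    have "((\<lambda>y. sgn (z y)) has_derivative
        (\<lambda>h. (1 / norm (z x)) *\<^sub>R plane_proj (sgn (z x)) (h $ 2 *\<^sub>R velocity \<alpha> (x $ 2) - h $ 3 *\<^sub>R velocity \<beta> (x $ 3)))) (at x within S)"
    proof -
      have "((\<lambda>y. inverse (norm (z y)) *\<^sub>R z y) has_derivative
          (\<lambda>h. inverse (norm (z x)) *\<^sub>R (h $ 2 *\<^sub>R velocity \<alpha> (x $ 2) - h $ 3 *\<^sub>R velocity \<beta> (x $ 3))
            + (- (inverse (norm (z x)) * ((h $ 2 *\<^sub>R velocity \<alpha> (x $ 2) - h $ 3 *\<^sub>R velocity \<beta> (x $ 3)) \<bullet> sgn (z x)) * inverse (norm (z x)))) *\<^sub>R z x)) (at x within S)"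
        by (rule has_derivative_scaleR[OF Deriv.has_derivative_inverse[OF _ has_derivative_compose[OF zd has_derivative_norm[OF z0]]] zd])
           (simp add: z0)
      then show ?thesis
        unfolding sgn_div_norm
        by (rule has_derivative_eq_rhs)
           (simp add: plane_proj_def sgn_div_norm fun_eq_iff divide_inverse algebra_simps)
    qed
    ultimately show ?thesis
      unfolding shell_map_def \<rho>_def[symmetric] z_def[symmetric]
      by (intro has_derivative_eq_rhs[OF has_derivative_scaleR])
         (auto simp: fun_eq_iff f'_def A_def B_def C_def plane_proj_diff plane_proj_scaleR algebra_simps)
  qed
  have detf: "\<bar>det (matrix (f' x))\<bar> = \<bar>A x \<bullet> cross3 (B x) (C x)\<bar>" for x
    unfolding f'_def det_matrix_columns ..
  have cont: "continuous_on S (\<lambda>x. \<bar>det (matrix (f' x))\<bar>)"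
  proof -
    have nth: "continuous_on S (\<lambda>x. x $ i)" for i by (intro continuous_intros)
    have c: "continuous_on S (\<lambda>x. \<alpha> (x $ 2))" "continuous_on S (\<lambda>x. \<beta> (x $ 3))"
        "continuous_on S (\<lambda>x. velocity \<alpha> (x $ 2))" "continuous_on S (\<lambda>x. velocity \<beta> (x $ 3))"
      by (intro continuous_on_compose2[OF _ nth subset_UNIV] circle_continuous_on continuous_on_velocity ca cb)+
    have "continuous_on S \<rho>" unfolding \<rho>_def by (intro continuous_intros nth)
    moreover have "continuous_on S z" unfolding z_def by (intro continuous_intros c)
    ultimately show ?thesis
      unfolding detf A_def B_def C_def plane_proj_def using z0 less_imp_neq[OF \<rho>, symmetric]
      by (intro continuous_intros continuous_on_cross c) auto
  qed
  have bound: "\<bar>det (matrix (f' x))\<bar> \<le> M / 3" if x: "x \<in> S" for x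
  proof -
    let ?N = "norm (z x)"
    have n1: "norm (sgn (z x)) = 1" using z0 by (simp add: norm_sgn)
    have "norm (A x) = 1 / (3 * (\<rho> x)\<^sup>2)" by (simp add: A_def n1)
    moreover have "norm (B x) \<le> \<rho> x / ?N * norm (velocity \<alpha> (x $ 2))"
      using \<rho>[OF x] norm_plane_proj_le[OF n1] by (simp add: B_def divide_right_mono mult_left_mono)
    moreover have "norm (C x) \<le> \<rho> x / ?N * norm (velocity \<beta> (x $ 3))"
      using \<rho>[OF x] norm_plane_proj_le[OF n1] by (simp add: C_def divide_right_mono mult_left_mono)
    ultimately have "norm (A x) * (norm (B x) * norm (C x))
       \<le> 1 / (3 * (\<rho> x)\<^sup>2) * ((\<rho> x / ?N * norm (velocity \<alpha> (x $ 2))) * (\<rho> x / ?N * norm (velocity \<beta> (x $ 3))))"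
      using less_imp_le[OF \<rho>[OF x]] by (intro mult_mono) auto
    also have "\<dots> = norm (velocity \<alpha> (x $ 2)) * norm (velocity \<beta> (x $ 3)) / ?N\<^sup>2 / 3"
      using \<rho>[OF x] by (simp add: power2_eq_square field_simps)
    also have "\<dots> \<le> M / 3" using M[OF S(2,3)[OF x]] by (simp add: z_def)
    finally show ?thesis unfolding detf using abs_triple_product_le[of "A x" "B x" "C x"] by linarith
  qed
  have lm: "S \<in> lmeasurable" unfolding S_def by simp
  have int: "(\<lambda>x. \<bar>det (matrix (f' x))\<bar>) integrable_on S"
    unfolding S_def by (rule integrable_continuous) (use cont in \<open>simp add: S_def\<close>)
  show "shell_map \<alpha> \<beta> ` S \<in> lmeasurable"
    by (rule measurable_bounded_differentiable_image[OF lm der int bound])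
  have ne: "S \<noteq> {}" using le by (auto simp: S_def interval_ne_empty_cart forall_3)
  have "measure lebesgue S = (s1 - s0) * (t1 - t0)"
  proof -
    have "measure lebesgue S = (\<Prod>i\<in>UNIV. vector [2, s1, t1] $ i - (vector [1, s0, t0] :: real^3) $ i)"
      using content_cbox_cart[OF ne[unfolded S_def]] by (simp add: S_def)
    then show ?thesis unfolding UNIV_3 by simp
  qed
  then show "measure lebesgue (shell_map \<alpha> \<beta> ` S) \<le> M / 3 * ((s1 - s0) * (t1 - t0))"
    using measure_bounded_differentiable_image[OF lm der int bound] by simp
qed

lemma sum_ordered_pairs:
  fixes f :: "nat \<Rightarrow> nat \<Rightarrow> 'a::comm_monoid_add"
  shows "(\<Sum>i\<in>{1..n}. \<Sum>j\<in>{i<..n}. f i j + f j i)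
     = (\<Sum>i\<in>{1..n}. \<Sum>j\<in>{1..n}. if i = j then 0 else f i j)"
proof -
  have "(\<Sum>i\<in>{1..n}. \<Sum>j\<in>{i<..n}. f i j + f j i)
      = (\<Sum>i\<in>{1..n}. \<Sum>j\<in>{1..n}. if i < j then f i j + f j i else 0)"
    by (intro sum.cong refl sum.mono_neutral_cong_left) auto
  also have "\<dots> = (\<Sum>i\<in>{1..n}. \<Sum>j\<in>{1..n}. if i < j then f i j else 0)
      + (\<Sum>i\<in>{1..n}. \<Sum>j\<in>{1..n}. if i < j then f j i else 0)"
    unfolding sum.distrib[symmetric] by (intro sum.cong refl) auto
  also have "(\<Sum>i\<in>{1..n}. \<Sum>j\<in>{1..n}. if i < j then f j i else 0)
      = (\<Sum>i\<in>{1..n}. \<Sum>j\<in>{1..n}. if j < i then f i j else 0)"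
    by (rule sum.swap)
  also have "(\<Sum>i\<in>{1..n}. \<Sum>j\<in>{1..n}. if i < j then f i j else 0) + \<dots>
      = (\<Sum>i\<in>{1..n}. \<Sum>j\<in>{1..n}. if i = j then 0 else f i j)"
    unfolding sum.distrib[symmetric] by (intro sum.cong refl) auto
  finally show ?thesis .
qed

lemma isotopic_refl: "isotopic n L L"
  unfolding isotopic_def
proof (intro exI conjI)
  show "continuous_on ({0..1} \<times> UNIV) (\<lambda>(t :: real, x :: real^3). (\<lambda>_ y. y) t x)"
    unfolding case_prod_beta by (intro continuous_intros)
  show "\<forall>t\<in>{0..1::real}. \<exists>g. homeomorphism UNIV UNIV ((\<lambda>_ y. y) t :: real^3 \<Rightarrow> real^3) g"
    using homeomorphism_ident by blast
qed auto

context thick_link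
begin

text \<open>Half-open intervals represent each point of a circle once. The positive multiple puts
  component i on the viewer's side, so that u and - u see different crossings for an ordered
  pair.\<close>

definition over_params :: "nat \<Rightarrow> nat \<Rightarrow> real^3 \<Rightarrow> (real \<times> real) set" where
  "over_params i j u = {(s, t). s \<in> {0..<1} \<and> t \<in> {0..<1} \<and> (\<exists>c>0. L i s - L j t = c *\<^sub>R u)}"

lemma plane_proj_parallel:
  assumes "norm u = 1" "x - y = c *\<^sub>R u"
  shows "plane_proj u x = plane_proj u y"
proof -
  have "plane_proj u (x - y) = 0"
    using assms by (simp add: plane_proj_def norm_eq_1)
  then show ?thesis by (simp add: plane_proj_diff)
qed

lemma finite_over_params:
  assumes "norm u = 1" "u \<notin> bad_directions" "i \<in> {1..n}" "j \<in> {1..n}" "i \<noteq> j"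
  shows "finite (over_params i j u)"
proof (rule finite_subset[OF _ finite_crossing_params[OF assms(1-4)]])
  show "over_params i j u \<subseteq> {(s, t). s \<in> {0..1} \<and> t \<in> {0..1} \<and> L i s \<noteq> L j t \<and>
      plane_proj u (L i s) = plane_proj u (L j t)}"
    using components_disjoint[OF assms(3-5)] plane_proj_parallel[OF assms(1)]
    by (auto simp: over_params_def)
qed

lemma card_overcrossings_le:
  assumes "norm u = 1" "u \<notin> bad_directions" "i \<in> {1..n}" "j \<in> {1..n}" "i \<noteq> j"
  shows "card (overcrossings L u i j) \<le> card (over_params i j u)"
proof -
  have "overcrossings L u i j \<subseteq> (\<lambda>(s, t). (L i s, L j t)) ` over_params i j u"
  proof clarify
    fix x y assume "(x, y) \<in> overcrossings L u i j"
    then have xy: "x \<in> range (L i)" "y \<in> range (L j)" "plane_proj u x = plane_proj u y" "x \<bullet> u > y \<bullet> u"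
      by (auto simp: overcrossings_def)
    then obtain s t where st: "x = L i s" "s \<in> {0..<1}" "y = L j t" "t \<in> {0..<1}"
      using range_circle[OF circle[OF assms(3)]] range_circle[OF circle[OF assms(4)]] by auto
    have "x - y = ((x - y) \<bullet> u) *\<^sub>R u"
      using xy(3) by (intro plane_proj_eq_0D) (simp add: plane_proj_diff)
    moreover have "(x - y) \<bullet> u > 0" using xy(4) by (simp add: inner_diff_left)
    ultimately have "(s, t) \<in> over_params i j u"
      unfolding over_params_def using st by blast
    then show "(x, y) \<in> (\<lambda>(s, t). (L i s, L j t)) ` over_params i j u"
      using st by force
  qed
  then have "card (overcrossings L u i j) \<le> card ((\<lambda>(s, t). (L i s, L j t)) ` over_params i j u)"
    using finite_over_params[OF assms] by (intro card_mono finite_imageI)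
  also have "\<dots> \<le> card (over_params i j u)"
    by (rule card_image_le[OF finite_over_params[OF assms]])
  finally show ?thesis .
qed

text \<open>L itself, projected along u, is one of the competitors in the minimum.\<close>

lemma PCr_le_over_params:
  assumes u: "norm u = 1" "u \<notin> bad_directions"
  shows "PCr n L \<le> (\<Sum>i\<in>{1..n}. \<Sum>j\<in>{1..n}. if i = j then 0 else card (over_params i j u))"
proof -
  have "PCr n L \<le> (\<Sum>i\<in>{1..n}. \<Sum>j\<in>{i<..n}. cr L u i j)"
    unfolding PCr_def
    using link isotopic_refl regular_diagram_good_direction[OF u] by (intro wellorder_Inf_le1) blast
  also have "\<dots> = (\<Sum>i\<in>{1..n}. \<Sum>j\<in>{1..n}. if i = j then 0 else card (overcrossings L u i j))"
    unfolding cr_def by (rule sum_ordered_pairs)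
  also have "\<dots> \<le> (\<Sum>i\<in>{1..n}. \<Sum>j\<in>{1..n}. if i = j then 0 else card (over_params i j u))"
    using card_overcrossings_le[OF u] by (intro sum_mono) auto
  finally show ?thesis .
qed

section \<open>Grid cells and the directions they cover\<close>

text \<open>Directions of the chords between two grid cells, thickened radially; the radial range
  from 1 to 2, before the cube root, corresponds to \<open>shell\<close>.\<close>

definition box_image :: "nat \<Rightarrow> nat \<times> nat \<Rightarrow> nat \<times> nat \<Rightarrow> (real^3) set" where
  "box_image m p q = shell_map (L (fst p)) (L (fst q)) `
     cbox (vector [1, real (snd p) / m, real (snd q) / m])
       (vector [2, (real (snd p) + 1) / m, (real (snd q) + 1) / m])"

definition shell :: "(real^3) set" where
  "shell = cball 0 (root 3 2) - ball 0 1"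

lemma floor_cell:
  fixes m :: nat and x :: real
  assumes "m > 0" "x \<in> {0..<1}"
  shows "nat \<lfloor>m * x\<rfloor> < m" "x \<in> {real (nat \<lfloor>m * x\<rfloor>) / m..(real (nat \<lfloor>m * x\<rfloor>) + 1) / m}"
proof -
  have x: "0 \<le> real m * x" "real m * x < m" using assms by auto
  then show "nat \<lfloor>m * x\<rfloor> < m" by linarith
  have "real (nat \<lfloor>m * x\<rfloor>) \<le> m * x" "m * x \<le> real (nat \<lfloor>m * x\<rfloor>) + 1" using x by linarith+
  then show "x \<in> {real (nat \<lfloor>m * x\<rfloor>) / m..(real (nat \<lfloor>m * x\<rfloor>) + 1) / m}"
    using assms by (simp add: field_simps)
qed

lemma eventually_floor_neq:
  fixes x y :: real
  assumes "x \<in> {0..<1}" "y \<in> {0..<1}" "x \<noteq> y"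
  shows "\<forall>\<^sub>F m in sequentially. nat \<lfloor>real m * x\<rfloor> \<noteq> nat \<lfloor>real m * y\<rfloor>"
proof -
  have "\<forall>\<^sub>F m in sequentially. 1 / \<bar>x - y\<bar> < real m"
    by (metis eventually_at_top_dense filterlim_at_top_dense filterlim_real_sequentially)
  then show ?thesis
  proof eventually_elim
    case (elim m)
    then have "1 < \<bar>real m * x - real m * y\<bar>"
      using assms(3) by (simp add: divide_less_eq abs_mult flip: right_diff_distrib)
    moreover have "0 \<le> real m * x" "0 \<le> real m * y" using assms by auto
    ultimately show ?case by linarith
  qed
qed

text \<open>Cubing the norm undoes the cube root, and on the shell this cube lies between 1 and
  2.\<close>

lemma shell_map_over_params:
  assumes d: "d \<in> shell" and st: "(s, t) \<in> over_params i j (sgn d)"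
  shows "shell_map (L i) (L j) (vector [(norm d) ^ 3, s, t]) = d" "1 \<le> (norm d) ^ 3" "(norm d) ^ 3 \<le> 2"
proof -
  have d1: "1 \<le> norm d" "norm d \<le> root 3 2" using d by (auto simp: shell_def)
  then show "1 \<le> (norm d) ^ 3" by simp
  have "(norm d) ^ 3 \<le> (root 3 2) ^ 3" using d1 by (intro power_mono) auto
  then show "(norm d) ^ 3 \<le> 2" by (simp add: real_root_pow_pos)
  obtain c where c: "c > 0" "L i s - L j t = c *\<^sub>R sgn d" using st by (auto simp: over_params_def)
  have "d \<noteq> 0" using d1 by auto
  then have "sgn (L i s - L j t) = sgn d" using c by (simp add: sgn_div_norm field_simps)
  then show "shell_map (L i) (L j) (vector [(norm d) ^ 3, s, t]) = d"
    using \<open>d \<noteq> 0\<close> by (simp add: shell_map_def real_root_power_cancel sgn_div_norm)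
qed

text \<open>The parameters are finitely many, so a fine enough grid puts them into different pairs
  of cells, and the image of each such pair contains d. The fineness depends on d, so only a lower
  limit in m can be taken later.\<close>

lemma eventually_card_le_hits:
  assumes d: "d \<in> shell" "sgn d \<notin> bad_directions" and ij: "i \<in> {1..n}" "j \<in> {1..n}" "i \<noteq> j"
  shows "\<forall>\<^sub>F m in sequentially. card (over_params i j (sgn d))
     \<le> card {(a, b). a < m \<and> b < m \<and> d \<in> box_image m (i, a) (j, b)}"
proof -
  have "d \<noteq> 0" using d by (auto simp: shell_def)
  then have fin: "finite (over_params i j (sgn d))"
    using d ij by (intro finite_over_params) (auto simp: norm_sgn)
  define \<phi> where "\<phi> m p = (nat \<lfloor>real m * fst p\<rfloor>, nat \<lfloor>real m * snd p\<rfloor>)" for m :: nat and p :: "real \<times> real"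
  have "\<forall>\<^sub>F m in sequentially. \<forall>p\<in>over_params i j (sgn d). \<forall>q\<in>over_params i j (sgn d). p \<noteq> q \<longrightarrow> \<phi> m p \<noteq> \<phi> m q"
  proof (intro eventually_ball_finite fin ballI)
    fix p q assume pq: "p \<in> over_params i j (sgn d)" "q \<in> over_params i j (sgn d)"
    then have I: "fst p \<in> {0..<1}" "fst q \<in> {0..<1}" "snd p \<in> {0..<1}" "snd q \<in> {0..<1}"
      by (auto simp: over_params_def)
    consider "p = q" | "fst p \<noteq> fst q" | "snd p \<noteq> snd q" by (auto simp: prod_eq_iff)
    then show "\<forall>\<^sub>F m in sequentially. p \<noteq> q \<longrightarrow> \<phi> m p \<noteq> \<phi> m q"
    proof cases
      case 2
      show ?thesis
        using eventually_floor_neq[OF I(1,2) 2] by eventually_elim (simp add: \<phi>_def)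
    next
      case 3
      show ?thesis
        using eventually_floor_neq[OF I(3,4) 3] by eventually_elim (simp add: \<phi>_def)
    qed simp
  qed
  then show ?thesis
    using eventually_gt_at_top[of 0]
  proof eventually_elim
    case (elim m)
    have "inj_on (\<phi> m) (over_params i j (sgn d))" using elim(1) by (auto intro!: inj_onI)
    then have "card (over_params i j (sgn d)) = card (\<phi> m ` over_params i j (sgn d))"
      by (simp add: card_image)
    also have "\<dots> \<le> card {(a, b). a < m \<and> b < m \<and> d \<in> box_image m (i, a) (j, b)}"
    proof (rule card_mono)
      show "finite {(a, b). a < m \<and> b < m \<and> d \<in> box_image m (i, a) (j, b)}"
        by (rule finite_subset[of _ "{..<m} \<times> {..<m}"]) auto
      show "\<phi> m ` over_params i j (sgn d) \<subseteq> {(a, b). a < m \<and> b < m \<and> d \<in> box_image m (i, a) (j, b)}"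
      proof clarify
        fix a b s t assume ab: "(a, b) = \<phi> m (s, t)" and st: "(s, t) \<in> over_params i j (sgn d)"
        have I: "s \<in> {0..<1}" "t \<in> {0..<1}" using st by (auto simp: over_params_def)
        have a: "a = nat \<lfloor>real m * s\<rfloor>" and b: "b = nat \<lfloor>real m * t\<rfloor>" using ab by (auto simp: \<phi>_def)
        have "a < m" "b < m" unfolding a b using elim(2) I by (auto intro: floor_cell)
        moreover have "d \<in> box_image m (i, a) (j, b)"
          unfolding box_image_def
        proof (rule image_eqI)
          show "d = shell_map (L (fst (i, a))) (L (fst (j, b))) (vector [(norm d) ^ 3, s, t])"
            using shell_map_over_params(1)[OF d(1) st] by simp
          show "vector [(norm d) ^ 3, s, t] \<in> cbox (vector [1, real (snd (i, a)) / m, real (snd (j, b)) / m])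
              (vector [2, (real (snd (i, a)) + 1) / m, (real (snd (j, b)) + 1) / m] :: real^3)"
            using floor_cell(2)[OF elim(2) I(1)] floor_cell(2)[OF elim(2) I(2)] shell_map_over_params(2,3)[OF d(1) st]
            unfolding a b by (simp add: mem_box_cart forall_3)
        qed
        ultimately show "a < m \<and> b < m \<and> d \<in> box_image m (i, a) (j, b)" by blast
      qed
    qed
    finally show ?case .
  qed
qed

end

lemma card_pairs_eq_sum:
  "card {(a, b). a < m \<and> b < m \<and> P a b} = (\<Sum>a<m. \<Sum>b<m. of_bool (P a b))" for m :: nat
proof -
  have "{(a, b). a < m \<and> b < m \<and> P a b} = (SIGMA a:{..<m}. {b \<in> {..<m}. P a b})" by auto
  then have "card {(a, b). a < m \<and> b < m \<and> P a b} = (\<Sum>a<m. card {b \<in> {..<m}. P a b})"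
    by (simp add: card_SigmaI)
  also have "\<dots> = (\<Sum>a<m. \<Sum>b<m. of_bool (P a b))"
    by (intro sum.cong refl) (simp add: of_bool_def sum.If_cases Int_def)
  finally show ?thesis .
qed

context thick_link
begin

definition samples :: "nat \<Rightarrow> (nat \<times> nat) set" where
  "samples m = {1..n} \<times> {..<m}"

text \<open>Riemann sum of the double integral of the inverse squared distance over ordered pairs of
  points on different components.\<close>

definition crossing_sum :: "nat \<Rightarrow> real" where
  "crossing_sum m = (\<Sum>p\<in>samples m. \<Sum>q\<in>samples m.
     if fst p = fst q then 0 else weight m p * weight m q / (norm (sample m p - sample m q))\<^sup>2)"

text \<open>Uniform continuity on the closed parameter square; disjointness of the components keeps
  the denominator from vanishing there.\<close>

lemma crossing_density_oscillation:
  assumes ij: "i \<in> {1..n}" "j \<in> {1..n}" "i \<noteq> j" and "\<epsilon> > 0"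
  shows "\<forall>\<^sub>F m in sequentially. \<forall>a<m. \<forall>b<m. \<forall>s\<in>{real a / m..(real a + 1) / m}. \<forall>t\<in>{real b / m..(real b + 1) / m}.
     norm (velocity (L i) s) * norm (velocity (L j) t) / (norm (L i s - L j t))\<^sup>2
     \<le> norm (velocity (L i) (real a / m)) * norm (velocity (L j) (real b / m)) / (norm (L i (real a / m) - L j (real b / m)))\<^sup>2 + \<epsilon>"
proof -
  note ci = circle[OF ij(1)] and cj = circle[OF ij(2)]
  define F where "F x = norm (velocity (L i) (fst x)) * norm (velocity (L j) (snd x)) / (norm (L i (fst x) - L j (snd x)))\<^sup>2" for x
  have c1: "continuous_on S fst" "continuous_on S snd" for S :: "(real \<times> real) set"
    by (intro continuous_intros)+
  have c2: "continuous_on S (\<lambda>x. L i (fst x))" "continuous_on S (\<lambda>x. L j (snd x))"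
      "continuous_on S (\<lambda>x. velocity (L i) (fst x))" "continuous_on S (\<lambda>x. velocity (L j) (snd x))" for S :: "(real \<times> real) set"
    by (rule continuous_on_compose2[OF _ c1(1) subset_UNIV] continuous_on_compose2[OF _ c1(2) subset_UNIV]
        circle_continuous_on[OF ci] circle_continuous_on[OF cj] continuous_on_velocity[OF ci] continuous_on_velocity[OF cj])+
  have "continuous_on ({0..1} \<times> {0..1}) F"
    unfolding F_def by (intro continuous_intros c2) (use components_disjoint[OF ij] in auto)
  then have "uniformly_continuous_on ({0..1} \<times> {0..1}) F"
    by (intro compact_uniformly_continuous compact_Times) auto
  then obtain d where d: "d > 0" "\<And>x y. x \<in> {0..1} \<times> {0..1} \<Longrightarrow> y \<in> {0..1} \<times> {0..1} \<Longrightarrow> dist y x < d \<Longrightarrow> dist (F y) (F x) < \<epsilon>"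
    using \<open>\<epsilon> > 0\<close> unfolding uniformly_continuous_on_def by meson
  have "d / 2 > 0" using d by simp
  then have "\<forall>\<^sub>F m in sequentially. 1 / real m < d / 2"
    using order_tendstoD(2)[OF lim_1_over_n] by blast
  then show ?thesis
    using eventually_gt_at_top[of 0]
  proof eventually_elim
    case (elim m)
    have cell: "x \<in> {0..1} \<and> real a / m \<in> {0..1} \<and> \<bar>x - real a / m\<bar> < d / 2"
      if "a < m" "x \<in> {real a / m..(real a + 1) / m}" for a :: nat and x
    proof -
      have "0 \<le> real a / m" "(real a + 1) / m \<le> 1" "(real a + 1) / m = real a / m + 1 / m"
        using that(1) by (auto simp: field_simps)
      moreover have "0 \<le> 1 / real m" by simp
      moreover have "real a / m \<le> x" "x \<le> (real a + 1) / m" using that(2) by (simp_all only: atLeastAtMost_iff)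
      ultimately show ?thesis
        unfolding atLeastAtMost_iff using elim(1) by (intro conjI; linarith)
    qed
    show ?case
    proof (intro allI impI ballI)
      fix a b s t
      assume a: "a < m" "s \<in> {real a / m..(real a + 1) / m}" and b: "b < m" "t \<in> {real b / m..(real b + 1) / m}"
      have "dist (s, t) (real a / m, real b / m) \<le> \<bar>s - real a / m\<bar> + \<bar>t - real b / m\<bar>"
        using norm_Pair_le[of "s - real a / m" "t - real b / m"] by (simp add: dist_norm)
      also have "\<dots> < d" using cell[OF a] cell[OF b] by linarith
      finally have "dist (F (s, t)) (F (real a / m, real b / m)) < \<epsilon>"
        using cell[OF a] cell[OF b] by (intro d(2)) auto
      then have "F (s, t) \<le> F (real a / m, real b / m) + \<epsilon>" by (simp add: dist_real_def)
      then show "norm (velocity (L i) s) * norm (velocity (L j) t) / (norm (L i s - L j t))\<^sup>2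
         \<le> norm (velocity (L i) (real a / m)) * norm (velocity (L j) (real b / m)) / (norm (L i (real a / m) - L j (real b / m)))\<^sup>2 + \<epsilon>"
        by (simp add: F_def)
    qed
  qed
qed

lemma box_image_lmeasurable:
  assumes "p \<in> samples m" "q \<in> samples m" "fst p \<noteq> fst q"
  shows "box_image m p q \<in> lmeasurable"
proof -
  have pq: "fst p \<in> {1..n}" "fst q \<in> {1..n}" using assms by (auto simp: samples_def)
  have nth: "continuous_on S (\<lambda>x :: real^3. x $ i)" for S i by (intro continuous_intros)
  have "continuous_on S (\<lambda>x. L (fst p) (x $ 2))" "continuous_on S (\<lambda>x. L (fst q) (x $ 3))" for S :: "(real^3) set"
    by (intro continuous_on_compose2[OF _ nth subset_UNIV] circle_continuous_on circle pq)+
  then have "continuous_on S (shell_map (L (fst p)) (L (fst q)))" for S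
    unfolding shell_map_def
    by (intro continuous_intros nth) (use components_disjoint[OF pq assms(3)] in auto)
  then have "compact (box_image m p q)"
    unfolding box_image_def by (intro compact_continuous_image compact_cbox)
  then show ?thesis by (rule lmeasurable_compact)
qed

text \<open>A pair of cells has parameter area \<open>1 / m\<^sup>2\<close>, so replacing the
  density by its corner value costs \<open>\<epsilon> / m\<^sup>2\<close> per pair. The n^2 m^2
  pairs together cost at most n^2 \<epsilon>.\<close>

lemma measure_box_image_le:
  assumes "\<epsilon> > 0"
  shows "\<forall>\<^sub>F m in sequentially. \<forall>p\<in>samples m. \<forall>q\<in>samples m. fst p \<noteq> fst q \<longrightarrow>
     measure lebesgue (box_image m p q)
       \<le> (weight m p * weight m q / (norm (sample m p - sample m q))\<^sup>2 + \<epsilon> / (real m)\<^sup>2) / 3"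
proof -
  let ?P = "\<lambda>i j m. \<forall>a<m. \<forall>b<m. \<forall>s\<in>{real a / m..(real a + 1) / m}. \<forall>t\<in>{real b / m..(real b + 1) / m}.
     norm (velocity (L i) s) * norm (velocity (L j) t) / (norm (L i s - L j t))\<^sup>2
     \<le> norm (velocity (L i) (real a / m)) * norm (velocity (L j) (real b / m)) / (norm (L i (real a / m) - L j (real b / m)))\<^sup>2 + \<epsilon>"
  have "\<forall>\<^sub>F m in sequentially. \<forall>i\<in>{1..n}. \<forall>j\<in>{1..n}. i \<noteq> j \<longrightarrow> ?P i j m"
  proof (intro eventually_ball_finite finite_atLeastAtMost ballI)
    fix i j assume ij: "i \<in> {1..n}" "j \<in> {1..n}"
    show "\<forall>\<^sub>F m in sequentially. i \<noteq> j \<longrightarrow> ?P i j m"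
    proof (cases "i = j")
      case False
      then show ?thesis
        using crossing_density_oscillation[OF ij False assms] by (simp add: False)
    qed simp
  qed
  then show ?thesis
    using eventually_gt_at_top[of 0]
  proof eventually_elim
    case (elim m)
    show ?case
    proof (intro ballI impI)
      fix p q assume pq: "p \<in> samples m" "q \<in> samples m" "fst p \<noteq> fst q"
      then have m: "fst p \<in> {1..n}" "fst q \<in> {1..n}" "snd p < m" "snd q < m" by (auto simp: samples_def)
      define X where "X = norm (velocity (L (fst p)) (real (snd p) / m)) * norm (velocity (L (fst q)) (real (snd q) / m))
          / (norm (L (fst p) (real (snd p) / m) - L (fst q) (real (snd q) / m)))\<^sup>2 + \<epsilon>"
      have "measure lebesgue (box_image m p q) \<le> X / 3 *
          (((real (snd p) + 1) / m - real (snd p) / m) * ((real (snd q) + 1) / m - real (snd q) / m))"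
        unfolding box_image_def
      proof (rule measure_shell_map_box(2))
        fix s t assume "s \<in> {real (snd p) / m..(real (snd p) + 1) / m}" "t \<in> {real (snd q) / m..(real (snd q) + 1) / m}"
        then show "norm (velocity (L (fst p)) s) * norm (velocity (L (fst q)) t) / (norm (L (fst p) s - L (fst q) t))\<^sup>2 \<le> X"
          unfolding X_def using elim(1) m pq(3) by blast
      qed (use m pq components_disjoint circle in \<open>auto intro: divide_right_mono\<close>)
      also have "((real (snd p) + 1) / m - real (snd p) / m) * ((real (snd q) + 1) / m - real (snd q) / m) = 1 / (real m)\<^sup>2"
        by (simp add: diff_divide_distrib[symmetric] power2_eq_square)
      also have "X / 3 * (1 / (real m)\<^sup>2)
         = (weight m p * weight m q / (norm (sample m p - sample m q))\<^sup>2 + \<epsilon> / (real m)\<^sup>2) / 3"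
        by (simp add: X_def weight_def sample_def power2_eq_square add_divide_distrib mult_ac)
      finally show "measure lebesgue (box_image m p q)
         \<le> (weight m p * weight m q / (norm (sample m p - sample m q))\<^sup>2 + \<epsilon> / (real m)\<^sup>2) / 3" .
    qed
  qed
qed

text \<open>The bounding balls have volumes in the ratio 1 to 2, so the shell has the volume of the
  unit ball. This is a third of the area of the sphere, matching the factor 1/3 in the Jacobian
  bound.\<close>

lemma emeasure_shell: "emeasure lebesgue shell = ennreal (4 * pi / 3)" "shell \<in> sets lebesgue"
proof -
  have r: "1 \<le> root 3 (2::real)" by simp
  have b: "ball (0 :: real^3) 1 \<subseteq> cball 0 (root 3 2)"
    using r by (intro order_trans[OF ball_subset_cball] subset_cball)
  have "measure lebesgue shell = measure lebesgue (cball (0 :: real^3) (root 3 2)) - measure lebesgue (ball (0 :: real^3) 1)"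
    unfolding shell_def using b emeasure_bounded_finite[of "cball (0 :: real^3) (root 3 2)"]
    by (intro measure_Diff) auto
  also have "\<dots> = 4 / 3 * pi * (root 3 2) ^ 3 - 4 / 3 * pi"
    using content_cball[of "root 3 2" "0 :: real^3"] content_ball[of 1 "0 :: real^3"]
    by (simp add: unit_ball_vol_numeral fact_numeral)
  also have "\<dots> = 4 * pi / 3" by (simp add: real_root_pow_pos)
  finally have "measure lebesgue shell = 4 * pi / 3" .
  moreover have "shell \<in> lmeasurable" unfolding shell_def by (intro fmeasurable_Diff) auto
  ultimately show "emeasure lebesgue shell = ennreal (4 * pi / 3)" "shell \<in> sets lebesgue"
    using emeasure_eq_measure2[of shell lebesgue] by (auto simp: fmeasurableD)
qed

section \<open>Averaging over directions\<close>

text \<open>Values are extended nonnegative reals so that Fatou's lemma applies directly.\<close>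

definition hit_count :: "nat \<Rightarrow> real^3 \<Rightarrow> ennreal" where
  "hit_count m d = (\<Sum>p\<in>samples m. \<Sum>q\<in>samples m. if fst p = fst q then 0 else indicator (box_image m p q) d)"

lemma hit_count_measurable: "hit_count m \<in> borel_measurable lebesgue"
proof -
  have "(\<lambda>d. if fst p = fst q then 0 else indicator (box_image m p q) d :: ennreal) \<in> borel_measurable lebesgue"
    if "p \<in> samples m" "q \<in> samples m" for p q
    using box_image_lmeasurable[OF that] by (cases "fst p = fst q") (auto simp: fmeasurableD)
  then show ?thesis
    unfolding hit_count_def[abs_def] by (intro borel_measurable_sum)
qed

lemma hit_count_eq:
  "hit_count m d = of_nat (\<Sum>i\<in>{1..n}. \<Sum>j\<in>{1..n}.
     if i = j then 0 else card {(a, b). a < m \<and> b < m \<and> d \<in> box_image m (i, a) (j, b)})"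
proof -
  let ?g = "\<lambda>i a j b. if i = j then 0 else (of_bool (d \<in> box_image m (i, a) (j, b)) :: nat)"
  have "hit_count m d = (\<Sum>p\<in>samples m. \<Sum>q\<in>samples m. of_nat (?g (fst p) (snd p) (fst q) (snd q)))"
    unfolding hit_count_def by (intro sum.cong refl) (auto simp: indicator_def)
  also have "\<dots> = of_nat (\<Sum>p\<in>samples m. \<Sum>q\<in>samples m. ?g (fst p) (snd p) (fst q) (snd q))"
    by (simp only: of_nat_sum)
  also have "(\<Sum>p\<in>samples m. \<Sum>q\<in>samples m. ?g (fst p) (snd p) (fst q) (snd q))
      = (\<Sum>i\<in>{1..n}. \<Sum>a<m. \<Sum>j\<in>{1..n}. \<Sum>b<m. ?g i a j b)"
  proof -
    have flat: "(\<Sum>p\<in>samples m. h (fst p) (snd p)) = (\<Sum>i\<in>{1..n}. \<Sum>a<m. h i a)" for h :: "nat \<Rightarrow> nat \<Rightarrow> nat"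
      unfolding samples_def sum.cartesian_product by (simp add: split_beta)
    show ?thesis
      unfolding flat[of "\<lambda>i a. \<Sum>q\<in>samples m. ?g i a (fst q) (snd q)"]
      by (intro sum.cong refl flat)
  qed
  also have "\<dots> = (\<Sum>i\<in>{1..n}. \<Sum>j\<in>{1..n}. \<Sum>a<m. \<Sum>b<m. ?g i a j b)"
    by (intro sum.cong refl sum.swap)
  also have "\<dots> = (\<Sum>i\<in>{1..n}. \<Sum>j\<in>{1..n}.
     if i = j then 0 else card {(a, b). a < m \<and> b < m \<and> d \<in> box_image m (i, a) (j, b)})"
    by (intro sum.cong refl) (simp add: card_pairs_eq_sum)
  finally show ?thesis .
qed

lemma PCr_le_liminf_hit_count:
  assumes d: "d \<in> shell" "d \<notin> bad_directions"
  shows "of_nat (PCr n L) \<le> liminf (\<lambda>m. hit_count m d)"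
proof (rule Liminf_bounded)
  have "d \<noteq> 0" using d by (auto simp: shell_def)
  have u: "norm (sgn d) = 1" using \<open>d \<noteq> 0\<close> by (simp add: norm_sgn)
  \<comment> \<open>The bad set is a cone, so d and its direction are bad together.\<close>
  have ub: "sgn d \<notin> bad_directions"
  proof
    assume "sgn d \<in> bad_directions"
    then have "norm d *\<^sub>R sgn d \<in> bad_directions" by (rule bad_directions_scaleR)
    then show False using d(2) \<open>d \<noteq> 0\<close> by (simp add: sgn_div_norm)
  qed
  have "\<forall>\<^sub>F m in sequentially. \<forall>i\<in>{1..n}. \<forall>j\<in>{1..n}. i \<noteq> j \<longrightarrow> card (over_params i j (sgn d))
     \<le> card {(a, b). a < m \<and> b < m \<and> d \<in> box_image m (i, a) (j, b)}"
  proof (intro eventually_ball_finite finite_atLeastAtMost ballI)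
    fix i j assume ij: "i \<in> {1..n}" "j \<in> {1..n}"
    show "\<forall>\<^sub>F m in sequentially. i \<noteq> j \<longrightarrow> card (over_params i j (sgn d))
       \<le> card {(a, b). a < m \<and> b < m \<and> d \<in> box_image m (i, a) (j, b)}"
      using eventually_card_le_hits[OF d(1) ub ij] by (cases "i = j") auto
  qed
  then show "\<forall>\<^sub>F m in sequentially. of_nat (PCr n L) \<le> hit_count m d"
  proof eventually_elim
    case (elim m)
    have "PCr n L \<le> (\<Sum>i\<in>{1..n}. \<Sum>j\<in>{1..n}. if i = j then 0 else card (over_params i j (sgn d)))"
      by (rule PCr_le_over_params[OF u ub])
    also have "\<dots> \<le> (\<Sum>i\<in>{1..n}. \<Sum>j\<in>{1..n}.
        if i = j then 0 else card {(a, b). a < m \<and> b < m \<and> d \<in> box_image m (i, a) (j, b)})"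
      using elim by (intro sum_mono) auto
    finally show ?case unfolding hit_count_eq by (rule of_nat_mono)
  qed
qed

lemma nn_integral_hit_count_le:
  assumes "\<epsilon> > 0"
  shows "\<forall>\<^sub>F m in sequentially. (\<integral>\<^sup>+d. hit_count m d \<partial>lebesgue) \<le> ennreal ((crossing_sum m + (real n)\<^sup>2 * \<epsilon>) / 3)"
  using measure_box_image_le[OF assms] eventually_gt_at_top[of 0]
proof eventually_elim
  case (elim m)
  let ?c = "\<lambda>p q. if fst p = fst q then 0 else weight m p * weight m q / (norm (sample m p - sample m q))\<^sup>2"
  have w: "weight m p \<ge> 0" for p by (simp add: weight_def)
  have nonneg: "0 \<le> ?c p q" for p q using w by simp
  have ind: "(\<lambda>d. if fst p = fst q then 0 else indicator (box_image m p q) d :: ennreal) \<in> borel_measurable lebesgue"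
    if "p \<in> samples m" "q \<in> samples m" for p q
    using box_image_lmeasurable[OF that] by (cases "fst p = fst q") (auto simp: fmeasurableD)
  have "(\<integral>\<^sup>+d. hit_count m d \<partial>lebesgue)
      = (\<Sum>p\<in>samples m. \<Sum>q\<in>samples m. \<integral>\<^sup>+d. (if fst p = fst q then 0 else indicator (box_image m p q) d) \<partial>lebesgue)"
    unfolding hit_count_def
    by (subst nn_integral_sum, intro borel_measurable_sum ind, assumption+)
       (intro sum.cong refl nn_integral_sum ind)
  also have "\<dots> \<le> (\<Sum>p\<in>samples m. \<Sum>q\<in>samples m. ennreal ((?c p q + \<epsilon> / (real m)\<^sup>2) / 3))"
  proof (intro sum_mono)
    fix p q assume pq: "p \<in> samples m" "q \<in> samples m"
    show "(\<integral>\<^sup>+d. (if fst p = fst q then 0 else indicator (box_image m p q) d) \<partial>lebesgue) \<le> ennreal ((?c p q + \<epsilon> / (real m)\<^sup>2) / 3)"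
    proof (cases "fst p = fst q")
      case False
      have lm: "box_image m p q \<in> lmeasurable" by (rule box_image_lmeasurable[OF pq False])
      have "(\<integral>\<^sup>+d. indicator (box_image m p q) d \<partial>lebesgue) = ennreal (measure lebesgue (box_image m p q))"
        using lm by (simp add: fmeasurableD emeasure_eq_measure2)
      also have "\<dots> \<le> ennreal ((?c p q + \<epsilon> / (real m)\<^sup>2) / 3)"
        using elim(1) pq False by (intro ennreal_leI) auto
      finally show ?thesis using False by simp
    qed simp
  qed
  also have "\<dots> = ennreal (\<Sum>p\<in>samples m. \<Sum>q\<in>samples m. (?c p q + \<epsilon> / (real m)\<^sup>2) / 3)"
    using nonneg assms by (simp add: sum_ennreal sum_nonneg)
  also have "(\<Sum>p\<in>samples m. \<Sum>q\<in>samples m. (?c p q + \<epsilon> / (real m)\<^sup>2) / 3) = (crossing_sum m + (real n)\<^sup>2 * \<epsilon>) / 3"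
  proof -
    have "real (card (samples m)) = real n * real m" by (simp add: samples_def)
    then have "(\<Sum>p\<in>samples m. \<Sum>q\<in>samples m. \<epsilon> / (real m)\<^sup>2) = (real n)\<^sup>2 * \<epsilon>"
      using elim(2) by (simp add: power2_eq_square)
    then show ?thesis
      unfolding crossing_sum_def sum_divide_distrib[symmetric] sum.distrib by simp
  qed
  finally show ?case .
qed

text \<open>Fatou's lemma over the shell: almost everywhere \<open>PCr n L\<close> is at most the
  lower limit of the hit counts, whose integrals are at most a third of \<open>crossing_sum\<close>
  up to an arbitrarily small error. The shell volume 4 \<pi> / 3 against this third gives 4
  \<pi>.\<close>

lemma PCr_le_crossing_sum:
  assumes "\<forall>\<^sub>F m in sequentially. crossing_sum m \<le> c"
  shows "4 * pi * real (PCr n L) \<le> c"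
proof (rule field_le_epsilon)
  fix e :: real assume "e > 0"
  define \<epsilon> where "\<epsilon> = e / ((real n)\<^sup>2 + 1)"
  have \<epsilon>: "\<epsilon> > 0" using \<open>e > 0\<close> by (simp add: \<epsilon>_def add_nonneg_pos)
  have ne: "(real n)\<^sup>2 * \<epsilon> \<le> e"
  proof -
    have "(real n)\<^sup>2 / ((real n)\<^sup>2 + 1) \<le> 1" by (simp add: add_nonneg_pos)
    from mult_right_mono[OF this, of e] show ?thesis using \<open>e > 0\<close> by (simp add: \<epsilon>_def)
  qed
  have "\<exists>m. crossing_sum m \<le> c"
    using eventually_happens[OF assms] by auto
  moreover have "crossing_sum m \<ge> 0" for m
    unfolding crossing_sum_def by (intro sum_nonneg) (auto simp: weight_def)
  ultimately have "c \<ge> 0" by (meson order_trans)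
  have "ennreal (real (PCr n L) * (4 * pi / 3)) = of_nat (PCr n L) * emeasure lebesgue shell"
    unfolding emeasure_shell(1) by (simp add: ennreal_of_nat_eq_real_of_nat ennreal_mult del: times_divide_eq_right)
  also have "\<dots> = (\<integral>\<^sup>+d. of_nat (PCr n L) * indicator shell d \<partial>lebesgue)"
    by (rule nn_integral_cmult_indicator[symmetric, OF emeasure_shell(2)])
  also have "\<dots> \<le> (\<integral>\<^sup>+d. liminf (\<lambda>m. hit_count m d) \<partial>lebesgue)"
  proof (rule nn_integral_mono_AE)
    have "bad_directions \<in> null_sets lebesgue"
      using negligible_bad_directions by (simp add: negligible_iff_null_sets)
    then have "AE d in lebesgue. d \<notin> bad_directions" by (rule AE_not_in)
    then show "AE d in lebesgue. of_nat (PCr n L) * indicator shell d \<le> liminf (\<lambda>m. hit_count m d)"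
    proof eventually_elim
      case (elim d)
      then show ?case
        using PCr_le_liminf_hit_count[of d] by (cases "d \<in> shell") auto
    qed
  qed
  also have "\<dots> \<le> liminf (\<lambda>m. \<integral>\<^sup>+d. hit_count m d \<partial>lebesgue)"
    by (rule nn_integral_liminf[OF hit_count_measurable])
  also have "\<dots> \<le> limsup (\<lambda>m. \<integral>\<^sup>+d. hit_count m d \<partial>lebesgue)"
    by (rule Liminf_le_Limsup) simp
  also have "\<dots> \<le> ennreal ((c + e) / 3)"
  proof (rule Limsup_bounded)
    show "\<forall>\<^sub>F m in sequentially. (\<integral>\<^sup>+d. hit_count m d \<partial>lebesgue) \<le> ennreal ((c + e) / 3)"
      using nn_integral_hit_count_le[OF \<epsilon>] assms
    proof eventually_elim
      case (elim m)
      have "ennreal ((crossing_sum m + (real n)\<^sup>2 * \<epsilon>) / 3) \<le> ennreal ((c + e) / 3)"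
        using elim(2) ne by (intro ennreal_leI) simp
      then show ?case using elim(1) by (rule order_trans[rotated])
    qed
  qed
  finally have "real (PCr n L) * (4 * pi / 3) \<le> (c + e) / 3"
    using \<open>c \<ge> 0\<close> \<open>e > 0\<close> by (simp add: ennreal_le_iff)
  then show "4 * pi * real (PCr n L) \<le> c + e" by simp
qed

end

section \<open>The bounds\<close>

lemma Riemann_sum_tendsto:
  fixes g :: "real \<Rightarrow> real"
  assumes cont: "continuous_on {0..1} g"
  shows "(\<lambda>m. \<Sum>a<m. g (real a / m) / m) \<longlonglongrightarrow> integral {0..1} g"
proof (rule metric_LIMSEQ_I)
  fix e :: real assume "e > 0"
  have "uniformly_continuous_on {0..1} g" using cont by (intro compact_uniformly_continuous) auto
  then obtain d where d: "d > 0" "\<And>x y. x \<in> {0..1} \<Longrightarrow> y \<in> {0..1} \<Longrightarrow> dist y x < d \<Longrightarrow> dist (g y) (g x) < e / 2"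
    using \<open>e > 0\<close> unfolding uniformly_continuous_on_def by (meson half_gt_zero)
  obtain N :: nat where N: "N > 0" "1 / d < N"
    using reals_Archimedean2[of "max (1 / d) 0"] by (metis max_less_iff_conj of_nat_0_less_iff)
  have "dist (\<Sum>a<m. g (real a / m) / m) (integral {0..1} g) < e" if "m \<ge> N" for m
  proof -
    have m: "real m > 0" "1 / d < m" using that N by auto
    then have md: "1 / m < d" using d(1) by (simp add: field_simps)
    have sub: "{real a / m..real b / m} \<subseteq> {0..1}" if "b \<le> m" for a b
      using that m by (auto simp: field_simps intro: order_trans[of 0 "real a / m"])
    have int: "g integrable_on {real a / m..real b / m}" if "b \<le> m" for a b
      using cont sub[OF that] by (intro integrable_continuous_interval) (rule continuous_on_subset)
    have piece: "\<bar>integral {real a / m..real (Suc a) / m} g - g (real a / m) / m\<bar> \<le> e / 2 / m" if "a < m" for a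
    proof -
      have le: "real a / m \<le> real (Suc a) / m" and len: "real (Suc a) / m - real a / m = 1 / m"
        using m by (auto simp: field_simps)
      have "\<bar>g x - g (real a / m)\<bar> \<le> e / 2" if "x \<in> {real a / m..real (Suc a) / m}" for x
      proof -
        have "real a / m \<in> {real a / m..real (Suc a) / m}"
          using le by (simp only: atLeastAtMost_iff order_refl)
        moreover have "Suc a \<le> m" using \<open>a < m\<close> by simp
        note sub[OF this, of a]
        ultimately have "x \<in> {0..1}" "real a / m \<in> {0..1}"
          using that by (metis subsetD)+
        moreover have "dist x (real a / m) < d" using that len md by (auto simp: dist_real_def)
        ultimately show ?thesis using d(2)[of "real a / m" x] by (simp add: dist_real_def)
      qed
      then have "norm (integral {real a / m..real (Suc a) / m} (\<lambda>x. g x - g (real a / m)))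
          \<le> e / 2 * (real (Suc a) / m - real a / m)"
        using int[of "Suc a" a] that le
        by (intro integral_bound continuous_intros continuous_on_subset[OF cont] sub) auto
      moreover have "integral {real a / m..real (Suc a) / m} (\<lambda>x. g x - g (real a / m))
          = integral {real a / m..real (Suc a) / m} g - integral {real a / m..real (Suc a) / m} (\<lambda>x. g (real a / m))"
        using \<open>a < m\<close> by (intro Henstock_Kurzweil_Integration.integral_diff int) auto
      moreover have "integral {real a / m..real (Suc a) / m} (\<lambda>x. g (real a / m)) = g (real a / m) / m"
        unfolding integral_const_real content_real[OF le] len by simp
      ultimately show ?thesis using len by simp
    qed
    have "k \<le> m \<Longrightarrow> integral {0..real k / m} g = (\<Sum>a<k. integral {real a / m..real (Suc a) / m} g)" for k
    proof (induction k)
      case (Suc k)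
      have "integral {0..real k / m} g + integral {real k / m..real (Suc k) / m} g = integral {0..real (Suc k) / m} g"
        using int[of "Suc k" 0] Suc.prems m
        by (intro Henstock_Kurzweil_Integration.integral_combine) (auto simp: divide_right_mono)
      then show ?case using Suc by simp
    qed simp
    from this[of m] have "integral {0..1} g = (\<Sum>a<m. integral {real a / m..real (Suc a) / m} g)"
      using m by simp
    then have "\<bar>integral {0..1} g - (\<Sum>a<m. g (real a / m) / m)\<bar>
        = \<bar>\<Sum>a<m. integral {real a / m..real (Suc a) / m} g - g (real a / m) / m\<bar>"
      by (simp add: sum_subtractf)
    also have "\<dots> \<le> (\<Sum>a<m. \<bar>integral {real a / m..real (Suc a) / m} g - g (real a / m) / m\<bar>)"
      by (rule sum_abs)
    also have "\<dots> \<le> (\<Sum>a<m. e / 2 / m)" using piece by (intro sum_mono) auto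
    also have "\<dots> < e" using m \<open>e > 0\<close> by simp
    finally show ?thesis by (simp add: dist_real_def abs_minus_commute)
  qed
  then show "\<exists>no. \<forall>m\<ge>no. dist (\<Sum>a<m. g (real a / m) / m) (integral {0..1} g) < e" by blast
qed

context thick_link
begin

lemma total_weight_tendsto: "(\<lambda>m. \<Sum>p\<in>samples m. weight m p) \<longlonglongrightarrow> link_length n L"
proof -
  have "(\<Sum>p\<in>samples m. weight m p) = (\<Sum>i=1..n. \<Sum>a<m. norm (velocity (L i) (real a / m)) / m)" for m
    unfolding samples_def weight_def by (simp add: sum.cartesian_product split_beta)
  moreover have "(\<lambda>m. \<Sum>i=1..n. \<Sum>a<m. norm (velocity (L i) (real a / m)) / m) \<longlonglongrightarrow> link_length n L"
    unfolding link_length_def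
    by (intro tendsto_sum Riemann_sum_tendsto continuous_intros continuous_on_velocity circle)
  ultimately show ?thesis by simp
qed

text \<open>The loss \<theta> in the tube volume is moved into the weights: multiplied by \<theta>
  they satisfy the growth bound without a factor, and the double sum acquires
  \<open>\<theta>\<^sup>2\<close>. For the second bound the kernel is the constant
  \<open>1 / (2 * r)\<^sup>2\<close>; its quadratic form is a multiple of the square of a sum, so
  the same block comparison applies.\<close>

lemma PCr_sampled_bounds:
  assumes n: "n \<ge> 2" and \<theta>: "0 < \<theta>" "\<theta> < 1" and "\<epsilon> > 0"
  shows "\<theta>\<^sup>2 * (4 * pi * real (PCr n L))
       \<le> 4 * pi / 3 * ((real n - 1) / real n powr (1 / 3)) * ((link_length n L + \<epsilon>) / r) powr (4 / 3)"
    and "4 * pi * real (PCr n L) \<le> (1 - 1 / real n) * ((link_length n L + \<epsilon>) / (2 * r))\<^sup>2"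
proof -
  have w: "weight m p \<ge> 0" for m p by (simp add: weight_def)
  have fin: "finite (samples m)" for m by (simp add: samples_def)
  have comp: "fst p \<in> {1..n}" if "p \<in> samples m" for p m using that by (auto simp: samples_def)
  have sep: "2 * r \<le> norm (sample m p - sample m q)" if "p \<in> samples m" "q \<in> samples m" "fst p \<noteq> fst q" for m p q
    unfolding sample_def using comp that by (intro component_distance)
  have len: "\<forall>\<^sub>F m in sequentially. (\<Sum>p\<in>samples m. weight m p) < link_length n L + \<epsilon>"
    using \<open>\<epsilon> > 0\<close> by (intro order_tendstoD(2)[OF total_weight_tendsto]) simp
  define B where "B = 4 * pi / 3 * ((real n - 1) / real n powr (1 / 3)) * ((link_length n L + \<epsilon>) / r) powr (4 / 3)"
  have "\<forall>\<^sub>F m in sequentially. crossing_sum m \<le> B / \<theta>\<^sup>2"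
    using sampled_volume_bound[OF \<theta>] len
  proof eventually_elim
    case (elim m)
    have "(\<Sum>p\<in>samples m. \<Sum>q\<in>samples m. if fst p = fst q then 0
          else (\<theta> * weight m p) * (\<theta> * weight m q) / (norm (sample m p - sample m q))\<^sup>2)
        \<le> 4 * pi / 3 * ((real n - 1) / real n powr (1 / 3)) * ((\<Sum>p\<in>samples m. \<theta> * weight m p) / r) powr (4 / 3)"
    proof (rule inverse_square_sum_le[OF fin _ comp n r_pos sep])
      fix q and \<rho> :: real assume "0 \<le> \<rho>"
      then have "\<theta> * r\<^sup>2 * (\<Sum>p\<in>{p \<in> samples m. norm (sample m p - sample m q) \<le> \<rho>}. weight m p) \<le> 4 / 3 * (\<rho> + r) ^ 3"
        using elim(1) unfolding samples_def by blast
      then show "r\<^sup>2 * (\<Sum>p\<in>{p \<in> samples m. norm (sample m p - sample m q) \<le> \<rho>}. \<theta> * weight m p) \<le> 4 / 3 * (\<rho> + r) ^ 3"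
        by (simp add: sum_distrib_left mult_ac)
    qed (use w \<theta> in auto)
    also have "(\<Sum>p\<in>samples m. \<Sum>q\<in>samples m. if fst p = fst q then 0
          else (\<theta> * weight m p) * (\<theta> * weight m q) / (norm (sample m p - sample m q))\<^sup>2) = \<theta>\<^sup>2 * crossing_sum m"
      unfolding crossing_sum_def sum_distrib_left
      by (intro sum.cong refl) (simp add: power2_eq_square)
    finally have "\<theta>\<^sup>2 * crossing_sum m
        \<le> 4 * pi / 3 * ((real n - 1) / real n powr (1 / 3)) * ((\<Sum>p\<in>samples m. \<theta> * weight m p) / r) powr (4 / 3)" .
    moreover have "((\<Sum>p\<in>samples m. \<theta> * weight m p) / r) powr (4 / 3) \<le> ((link_length n L + \<epsilon>) / r) powr (4 / 3)"
    proof (intro powr_mono2 divide_right_mono)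
      have "(\<Sum>p\<in>samples m. \<theta> * weight m p) \<le> (\<Sum>p\<in>samples m. weight m p)"
        using w \<theta> by (intro sum_mono) (simp add: mult_left_le_one_le)
      then show "(\<Sum>p\<in>samples m. \<theta> * weight m p) \<le> link_length n L + \<epsilon>" using elim(2) by simp
      show "0 \<le> (\<Sum>p\<in>samples m. \<theta> * weight m p) / r"
        using w \<theta> r_pos by (intro divide_nonneg_pos sum_nonneg) auto
    qed (use r_pos in auto)
    then have "4 * pi / 3 * ((real n - 1) / real n powr (1 / 3)) * ((\<Sum>p\<in>samples m. \<theta> * weight m p) / r) powr (4 / 3)
        \<le> 4 * pi / 3 * ((real n - 1) / real n powr (1 / 3)) * ((link_length n L + \<epsilon>) / r) powr (4 / 3)"
      using n by (intro mult_left_mono mult_nonneg_nonneg) auto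
    ultimately have "\<theta>\<^sup>2 * crossing_sum m \<le> B"
      unfolding B_def by linarith
    then show ?case using \<theta> by (simp add: pos_le_divide_eq mult.commute)
  qed
  from PCr_le_crossing_sum[OF this] have "\<theta>\<^sup>2 * (4 * pi * real (PCr n L)) \<le> B"
    using \<theta> by (simp add: pos_le_divide_eq mult.commute)
  then show "\<theta>\<^sup>2 * (4 * pi * real (PCr n L))
       \<le> 4 * pi / 3 * ((real n - 1) / real n powr (1 / 3)) * ((link_length n L + \<epsilon>) / r) powr (4 / 3)"
    unfolding B_def .
  have "\<forall>\<^sub>F m in sequentially. crossing_sum m \<le> (1 - 1 / real n) * ((link_length n L + \<epsilon>) / (2 * r))\<^sup>2"
    using len
  proof eventually_elim
    case (elim m)
    let ?W = "\<Sum>p\<in>samples m. weight m p"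
    have "crossing_sum m \<le> (\<Sum>p\<in>samples m. \<Sum>q\<in>samples m. if fst p = fst q then 0 else weight m p * weight m q * (1 / (2 * r)\<^sup>2))"
      unfolding crossing_sum_def
    proof (intro sum_mono)
      fix p q assume pq: "p \<in> samples m" "q \<in> samples m"
      show "(if fst p = fst q then 0 else weight m p * weight m q / (norm (sample m p - sample m q))\<^sup>2)
         \<le> (if fst p = fst q then 0 else weight m p * weight m q * (1 / (2 * r)\<^sup>2))"
      proof (cases "fst p = fst q")
        case False
        have "(2 * r)\<^sup>2 \<le> (norm (sample m p - sample m q))\<^sup>2"
          using sep[OF pq False] r_pos by (intro power_mono) auto
        then have "weight m p * weight m q / (norm (sample m p - sample m q))\<^sup>2 \<le> weight m p * weight m q / (2 * r)\<^sup>2"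
          using w r_pos by (intro divide_left_mono mult_pos_pos mult_nonneg_nonneg) (auto intro: less_le_trans[of _ "(2 * r)\<^sup>2"])
        then show ?thesis using False by simp
      qed simp
    qed
    also have "\<dots> \<le> (1 - 1 / real n) * (\<Sum>p\<in>samples m. \<Sum>q\<in>samples m. weight m p * weight m q * (1 / (2 * r)\<^sup>2))"
    proof (rule off_diagonal_sum_le[OF fin _ comp])
      fix c :: "nat \<times> nat \<Rightarrow> real"
      have "(\<Sum>p\<in>samples m. \<Sum>q\<in>samples m. c p * c q * (1 / (2 * r)\<^sup>2)) = (\<Sum>p\<in>samples m. c p)\<^sup>2 * (1 / (2 * r)\<^sup>2)"
        by (simp add: power2_eq_square[of "sum _ _"] sum_product sum_divide_distrib)
      then show "0 \<le> (\<Sum>p\<in>samples m. \<Sum>q\<in>samples m. c p * c q * (1 / (2 * r)\<^sup>2))" by simp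
    qed (use n in auto)
    also have "(\<Sum>p\<in>samples m. \<Sum>q\<in>samples m. weight m p * weight m q * (1 / (2 * r)\<^sup>2)) = ?W\<^sup>2 * (1 / (2 * r)\<^sup>2)"
      unfolding power2_eq_square[of ?W] sum_product by (simp only: sum_distrib_right)
    also have "?W\<^sup>2 * (1 / (2 * r)\<^sup>2) = (?W / (2 * r))\<^sup>2" by (simp add: power_divide)
    also have "(1 - 1 / real n) * (?W / (2 * r))\<^sup>2 \<le> (1 - 1 / real n) * ((link_length n L + \<epsilon>) / (2 * r))\<^sup>2"
      using elim n r_pos w by (intro mult_left_mono power_mono divide_right_mono divide_nonneg_pos sum_nonneg) auto
    finally show ?case .
  qed
  then show "4 * pi * real (PCr n L) \<le> (1 - 1 / real n) * ((link_length n L + \<epsilon>) / (2 * r))\<^sup>2"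
    by (rule PCr_le_crossing_sum)
qed

end

section \<open>Passage from smaller radii to the reach\<close>

lemma embedded_tube_mono:
  assumes "embedded_tube n L r" "s \<le> r"
  shows "embedded_tube n L s"
proof -
  have sub: "normal_disc s (L i) t \<subseteq> normal_disc r (L i) t" for i t
    using assms(2) by (auto simp: normal_disc_def)
  show ?thesis
    unfolding embedded_tube_def disjoint_family_on_def
  proof (intro ballI impI)
    fix p q assume "p \<in> {1..n} \<times> {0..<1::real}" "q \<in> {1..n} \<times> {0..<1::real}" "p \<noteq> q"
    then have "(case p of (i, t) \<Rightarrow> normal_disc r (L i) t) \<inter> (case q of (i, t) \<Rightarrow> normal_disc r (L i) t) = {}"
      by (rule disjoint_family_onD[OF assms(1)[unfolded embedded_tube_def]])
    then show "(case p of (i, t) \<Rightarrow> normal_disc s (L i) t) \<inter> (case q of (i, t) \<Rightarrow> normal_disc s (L i) t) = {}"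
      using sub[of "fst p" "snd p"] sub[of "fst q" "snd q"] unfolding split_beta by blast
  qed
qed

text \<open>Separation of components 1 and 2 bounds every admissible radius, so the supremum is a
  genuine one; shrinking the discs keeps them disjoint, which covers all radii below it.\<close>

lemma reach_properties:
  assumes "n \<ge> 2" "link n L"
  shows "reach n L \<ge> 0" and "0 < r \<Longrightarrow> r < reach n L \<Longrightarrow> embedded_tube n L r"
proof -
  let ?S = "{r. 0 \<le> r \<and> embedded_tube n L r}"
  have zero: "0 \<in> ?S"
    by (auto simp: embedded_tube_def disjoint_family_on_def normal_disc_def)
  have bdd: "bdd_above ?S"
  proof (rule bdd_aboveI)
    fix r assume r: "r \<in> ?S"
    show "r \<le> norm (L 1 0 - L 2 0)"
    proof (cases "r = 0")
      case False
      then interpret thick_link n L r using r assms by unfold_locales auto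
      have "2 * r \<le> norm (L 1 0 - L 2 0)" using assms(1) by (intro component_distance) auto
      then show ?thesis using r_pos by simp
    qed simp
  qed
  show "reach n L \<ge> 0" unfolding reach_def by (rule cSup_upper[OF zero bdd])
  assume r: "0 < r" "r < reach n L"
  then obtain s where "s \<in> ?S" "r < s"
    using less_cSup_iff[of ?S r] zero bdd unfolding reach_def by blast
  then show "embedded_tube n L r" by (auto intro: embedded_tube_mono)
qed

text \<open>A single \<delta> drives the approximations: the radius is the reach times 1 - \<delta>,
  the length excess is \<delta>, and in the first bound the volume factor is 1 - \<delta>. Then
  \<delta> tends to 0 from the right.\<close>

lemma PCr_reach_bounds:
  assumes n: "n \<ge> 2" and link: "link n L" and pos: "reach n L > 0"
  shows "4 * pi * real (PCr n L)
       \<le> 4 * pi / 3 * ((real n - 1) / real n powr (1 / 3)) * (link_length n L / reach n L) powr (4 / 3)"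
    and "4 * pi * real (PCr n L) \<le> (1 - 1 / real n) * (link_length n L / (2 * reach n L))\<^sup>2"
proof -
  let ?l = "link_length n L" and ?R = "reach n L"
  have len: "?l \<ge> 0"
    unfolding link_length_def
  proof (intro sum_nonneg Henstock_Kurzweil_Integration.integral_nonneg integrable_continuous_interval continuous_intros)
    fix i assume "i \<in> {1..n}"
    then show "continuous_on {0..1} (velocity (L i))"
      using link by (intro continuous_on_velocity) (auto simp: link_def)
  qed auto
  have ev: "\<forall>\<^sub>F \<delta> in at_right 0. \<delta> > 0 \<and> \<delta> < (1 :: real)"
    using eventually_at_right_real[of 0 1] by (auto elim: eventually_mono)
  have bounds: "(1 - \<delta>)\<^sup>2 * (4 * pi * real (PCr n L))
       \<le> 4 * pi / 3 * ((real n - 1) / real n powr (1 / 3)) * ((?l + \<delta>) / (?R * (1 - \<delta>))) powr (4 / 3)"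
     "4 * pi * real (PCr n L) \<le> (1 - 1 / real n) * ((?l + \<delta>) / (2 * (?R * (1 - \<delta>))))\<^sup>2"
    if "\<delta> > 0 \<and> \<delta> < 1" for \<delta>
  proof -
    have "0 < ?R * (1 - \<delta>)" "?R * (1 - \<delta>) < ?R" using that pos by auto
    then interpret thick_link n L "?R * (1 - \<delta>)"
      using link reach_properties(2)[OF n link] by unfold_locales auto
    show "(1 - \<delta>)\<^sup>2 * (4 * pi * real (PCr n L))
       \<le> 4 * pi / 3 * ((real n - 1) / real n powr (1 / 3)) * ((?l + \<delta>) / (?R * (1 - \<delta>))) powr (4 / 3)"
      by (rule PCr_sampled_bounds(1)[OF n]) (use that in auto)
    show "4 * pi * real (PCr n L) \<le> (1 - 1 / real n) * ((?l + \<delta>) / (2 * (?R * (1 - \<delta>))))\<^sup>2"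
      by (rule PCr_sampled_bounds(2)[OF n, of "1 / 2"]) (use that in auto)
  qed
  have quot: "((\<lambda>\<delta>. (?l + \<delta>) / (?R * (1 - \<delta>))) \<longlongrightarrow> ?l / ?R) (at_right 0)"
    using pos by (auto intro!: tendsto_eq_intros)
  have "((\<lambda>\<delta>. (1 - \<delta>)\<^sup>2 * (4 * pi * real (PCr n L))) \<longlongrightarrow> 4 * pi * real (PCr n L)) (at_right 0)"
    by (auto intro!: tendsto_eq_intros)
  moreover have "((\<lambda>\<delta>. ((?l + \<delta>) / (?R * (1 - \<delta>))) powr (4 / 3)) \<longlongrightarrow> (?l / ?R) powr (4 / 3)) (at_right 0)"
    using ev len pos by (intro tendsto_powr' quot tendsto_const) (auto elim!: eventually_mono)
  then have "((\<lambda>\<delta>. 4 * pi / 3 * ((real n - 1) / real n powr (1 / 3)) * ((?l + \<delta>) / (?R * (1 - \<delta>))) powr (4 / 3))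
      \<longlongrightarrow> 4 * pi / 3 * ((real n - 1) / real n powr (1 / 3)) * (?l / ?R) powr (4 / 3)) (at_right 0)"
    by (intro tendsto_mult_left)
  ultimately show "4 * pi * real (PCr n L)
       \<le> 4 * pi / 3 * ((real n - 1) / real n powr (1 / 3)) * (?l / ?R) powr (4 / 3)"
    using eventually_mono[OF ev bounds(1)] by (intro tendsto_le[OF trivial_limit_at_right_real])
  have "((\<lambda>\<delta>. (1 - 1 / real n) * ((?l + \<delta>) / (2 * (?R * (1 - \<delta>))))\<^sup>2)
      \<longlongrightarrow> (1 - 1 / real n) * (?l / (2 * ?R))\<^sup>2) (at_right 0)"
    using pos by (auto intro!: tendsto_eq_intros)
  then show "4 * pi * real (PCr n L) \<le> (1 - 1 / real n) * (?l / (2 * ?R))\<^sup>2"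
    using eventually_mono[OF ev bounds(2)] by (intro tendsto_lowerbound[OF _ _ trivial_limit_at_right_real])
qed

theorem corollary9:
  fixes n :: nat and L :: "nat \<Rightarrow> real \<Rightarrow> real^3"
  assumes "n \<ge> 2" and "link n L"
  shows "ereal_powr (ropelength n L) (4 / 3)
           \<ge> ereal (3 * real n powr (1 / 3) / (real n - 1) * real (PCr n L))
       \<and> (ropelength n L)\<^sup>2
           \<ge> ereal (16 * pi * (real n)\<^sup>2 / ((real n)\<^sup>2 - 1) * real (PCr n L))"
proof (cases "reach n L = 0")
  case True
  then show ?thesis by (simp add: ropelength_def ereal_powr_def power2_eq_square)
next
  case False
  then have pos: "reach n L > 0" using reach_properties(1)[OF assms] by simp
  define x where "x = link_length n L / reach n L"
  define P where "P = real (PCr n L)"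
  have n: "real n \<ge> 2" using assms(1) by simp
  have rop: "ropelength n L = ereal x" using False by (simp add: ropelength_def x_def)
  define K where "K = (real n - 1) / real n powr (1 / 3)"
  have "4 * pi * P \<le> 4 * pi / 3 * K * x powr (4 / 3)"
    using PCr_reach_bounds(1)[OF assms pos] unfolding x_def P_def K_def .
  then have "4 * pi * (3 * P) \<le> 4 * pi * (K * x powr (4 / 3))" by simp
  then have "3 * P \<le> (real n - 1) / real n powr (1 / 3) * x powr (4 / 3)"
    unfolding K_def by (rule mult_left_le_imp_le) simp
  then have "3 * real n powr (1 / 3) / (real n - 1) * P \<le> x powr (4 / 3)"
    using n by (simp add: field_simps)
  moreover have "16 * pi * (real n)\<^sup>2 / ((real n)\<^sup>2 - 1) * P \<le> x\<^sup>2"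
  proof -
    have "4 * pi * P \<le> (1 - 1 / real n) * (x\<^sup>2 / 4)"
      using PCr_reach_bounds(2)[OF assms pos] unfolding P_def
      by (simp add: x_def power_divide power_mult_distrib mult.commute)
    then have "16 * pi * P * real n \<le> (real n - 1) * x\<^sup>2"
      using n by (simp add: field_simps)
    then have "16 * pi * P * real n * real n \<le> (real n - 1) * x\<^sup>2 * real n"
      using n by (intro mult_right_mono) auto
    \<comment> \<open>The factor n / (n - 1) obtained so far exceeds the required n^2 / (n^2 - 1);
      replacing n by n + 1 here passes to the latter.\<close>
    also have "\<dots> \<le> (real n - 1) * x\<^sup>2 * (real n + 1)"
      using n by (intro mult_left_mono) auto
    finally have "16 * pi * (real n)\<^sup>2 * P \<le> x\<^sup>2 * ((real n)\<^sup>2 - 1)"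
      by (simp add: power2_eq_square algebra_simps)
    moreover have "(real n)\<^sup>2 - 1 > 0"
      using n power_mono[of 2 "real n" 2] by simp
    ultimately show ?thesis by (simp add: pos_divide_le_eq)
  qed
  ultimately show ?thesis
    unfolding rop P_def[symmetric] by (simp add: ereal_powr_def)
qed

end
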